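(* Let $I=[0,\gamma)$ with $0<\gamma\le\infty$, let $\varphi$ be an Orlicz function that is an N-function at infinity and let $w$ be a weight function on $I$. Then the space $\mathcal{M}^0_{\varphi,w}$ does not have the local diameter two property. As a consequence, $\mathcal{M}^0_{\varphi,w}$ does not have the diameter two property, the strong diameter two property, the diametral diameter two properties (DLD2P and DD2P), or the Daugavet property.
   Context: All Banach spaces are real. A slice of $B_X$ is $S(x^*,\epsilon)=\{x\in B_X:x^*x>1-\epsilon\}$ with $x^*\in S_{X^*}$, $\epsilon>0$. $X$ has the local diameter two property (LD2P) if every slice of $B_X$ has diameter two; the diameter two property (D2P) if every nonempty relatively weakly open subset of $B_X$ has diameter two; the strong diameter two property (SD2P) if every convex combination of slices of $B_X$ has diameter two; the diametral local diameter two property (DLD2P) if for every slice $S$ of $B_X$, every $x\in S\cap S_X$ and $\epsilon>0$ there is $y\in S$ with $\|x-y\|\ge 2-\epsilon$; the diametral diameter two property (DD2P) if for every nonempty relatively weakly open $V\subset B_X$, every $x\in V\cap S_X$ and $\epsilon>0$ there is $y\in V$ with $\|x-y\|\ge2-\epsilon$; the Daugavet property if $\|\mathrm{Id}+T\|=1+\|T\|$ for every rank-one operator $T:X\to X$. An Orlicz function is a convex function $\varphi:[0,\infty)\to[0,\infty)$ with $\varphi(0)=0$, not identically zero; it is an N-function at infinity if $\lim_{u\to\infty}\varphi(u)/u=\infty$. A weight function is a decreasing (i.e. non-increasing), positive, locally integrable function $w$ on $I=[0,\gamma)$ with $\int_0^t w<\infty$ for $t\in[0,\gamma)$; if $\gamma=\infty$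 it is assumed that $\int_0^\infty w=\infty$. For measurable $f$ on $I$ (Lebesgue measure $m$), $d_f(\lambda)=m\{t:|f(t)|>\lambda\}$ and $f^*(t)=\inf\{\lambda>0:d_f(\lambda)\le t\}$. $v\prec w$ means $\int_0^t v^*\le\int_0^t w^*$ for all $t>0$. Put $P_{\varphi,w}(f)=\inf\{\int_I\varphi(f^*/v)v: v\prec w,\ v>0,\ v\downarrow\}$. Then $\mathcal{M}_{\varphi,w}=\{f:P_{\varphi,w}(kf)<\infty\text{ for some }k>0\}$, and $\mathcal{M}^0_{\varphi,w}$ denotes this space with the Orlicz norm $\|f\|^0_{\mathcal{M}_{\varphi,w}}=\inf_{k>0}\frac1k(1+P_{\varphi,w}(kf))$. (It is the Köthe dual of the Orlicz-Lorentz space $\Lambda_{\varphi_*,w}$ with the Luxemburg norm, where $\varphi_*(v)=\sup_{u>0}\{uv-\varphi(u)\}$.) *)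

theory Defs
  imports "HOL-Analysis.Analysis"
begin

section \<open>Diameter two properties of a normed space with explicit carrier\<close>

text \<open>
  The space of interest depends on the parameters \<open>\<gamma>\<close>, \<open>\<phi>\<close>, \<open>w\<close>, so it cannot be an instance of a
  normed-space type class.  A real normed space is therefore given by a linear subspace \<open>V\<close> of a
  real vector space together with a norm \<open>N\<close> on \<open>V\<close>.  Functionals and operators are HOL functions
  of which only the values on \<open>V\<close> matter.
\<close>

definition unit_ball :: "'a::real_vector set \<Rightarrow> ('a \<Rightarrow> real) \<Rightarrow> 'a set" where
  "unit_ball V N = {x \<in> V. N x \<le> 1}"

definition unit_sphere :: "'a::real_vector set \<Rightarrow> ('a \<Rightarrow> real) \<Rightarrow> 'a set" where
  "unit_sphere V N = {x \<in> V. N x = 1}"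

definition linear_functional_on :: "'a::real_vector set \<Rightarrow> ('a \<Rightarrow> real) \<Rightarrow> bool" where
  "linear_functional_on V f \<longleftrightarrow>
     (\<forall>x\<in>V. \<forall>y\<in>V. f (x + y) = f x + f y) \<and> (\<forall>c. \<forall>x\<in>V. f (c *\<^sub>R x) = c * f x)"

definition dual_space :: "'a::real_vector set \<Rightarrow> ('a \<Rightarrow> real) \<Rightarrow> ('a \<Rightarrow> real) set" where
  "dual_space V N = {f. linear_functional_on V f \<and> (\<exists>C. \<forall>x\<in>V. \<bar>f x\<bar> \<le> C * N x)}"

definition dual_norm :: "'a::real_vector set \<Rightarrow> ('a \<Rightarrow> real) \<Rightarrow> ('a \<Rightarrow> real) \<Rightarrow> real" where
  "dual_norm V N f = (SUP x\<in>unit_ball V N. \<bar>f x\<bar>)"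

definition dual_sphere :: "'a::real_vector set \<Rightarrow> ('a \<Rightarrow> real) \<Rightarrow> ('a \<Rightarrow> real) set" where
  "dual_sphere V N = {f \<in> dual_space V N. dual_norm V N f = 1}"

definition slice :: "'a::real_vector set \<Rightarrow> ('a \<Rightarrow> real) \<Rightarrow> ('a \<Rightarrow> real) \<Rightarrow> real \<Rightarrow> 'a set" where
  "slice V N f \<epsilon> = {x \<in> unit_ball V N. f x > 1 - \<epsilon>}"

definition is_slice :: "'a::real_vector set \<Rightarrow> ('a \<Rightarrow> real) \<Rightarrow> 'a set \<Rightarrow> bool" where
  "is_slice V N S \<longleftrightarrow> (\<exists>f\<in>dual_sphere V N. \<exists>\<epsilon>>0. S = slice V N f \<epsilon>)"

definition weak_topology :: "'a::real_vector set \<Rightarrow> ('a \<Rightarrow> real) \<Rightarrow> 'a topology" where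
  "weak_topology V N =
     topology_generated_by {{x \<in> V. f x \<in> U} | f U. f \<in> dual_space V N \<and> open U}"

definition rel_weakly_open :: "'a::real_vector set \<Rightarrow> ('a \<Rightarrow> real) \<Rightarrow> 'a set \<Rightarrow> bool" where
  "rel_weakly_open V N W \<longleftrightarrow> openin (subtopology (weak_topology V N) (unit_ball V N)) W"

definition convex_comb_of_slices :: "'a::real_vector set \<Rightarrow> ('a \<Rightarrow> real) \<Rightarrow> 'a set \<Rightarrow> bool" where
  "convex_comb_of_slices V N C \<longleftrightarrow>
     (\<exists>(n::nat) (c :: nat \<Rightarrow> real) S. (\<forall>i<n. 0 \<le> c i \<and> is_slice V N (S i)) \<and> (\<Sum>i<n. c i) = 1 \<and>
        C = {\<Sum>i<n. c i *\<^sub>R x i | x. \<forall>i<n. x i \<in> S i})"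

text \<open>The supremum below is only taken for nonempty subsets of the unit ball.\<close>

definition norm_diameter :: "('a::real_vector \<Rightarrow> real) \<Rightarrow> 'a set \<Rightarrow> real" where
  "norm_diameter N S = (SUP (x, y)\<in>S \<times> S. N (x - y))"

definition LD2P :: "'a::real_vector set \<Rightarrow> ('a \<Rightarrow> real) \<Rightarrow> bool" where
  "LD2P V N \<longleftrightarrow> (\<forall>S. is_slice V N S \<longrightarrow> norm_diameter N S = 2)"

definition D2P :: "'a::real_vector set \<Rightarrow> ('a \<Rightarrow> real) \<Rightarrow> bool" where
  "D2P V N \<longleftrightarrow> (\<forall>W. rel_weakly_open V N W \<and> W \<noteq> {} \<longrightarrow> norm_diameter N W = 2)"

definition SD2P :: "'a::real_vector set \<Rightarrow> ('a \<Rightarrow> real) \<Rightarrow> bool" where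
  "SD2P V N \<longleftrightarrow> (\<forall>C. convex_comb_of_slices V N C \<longrightarrow> norm_diameter N C = 2)"

definition DLD2P :: "'a::real_vector set \<Rightarrow> ('a \<Rightarrow> real) \<Rightarrow> bool" where
  "DLD2P V N \<longleftrightarrow>
     (\<forall>S. is_slice V N S \<longrightarrow> (\<forall>x \<in> S \<inter> unit_sphere V N. \<forall>\<epsilon>>0. \<exists>y\<in>S. N (x - y) \<ge> 2 - \<epsilon>))"

definition DD2P :: "'a::real_vector set \<Rightarrow> ('a \<Rightarrow> real) \<Rightarrow> bool" where
  "DD2P V N \<longleftrightarrow>
     (\<forall>W. rel_weakly_open V N W \<and> W \<noteq> {} \<longrightarrow>
        (\<forall>x \<in> W \<inter> unit_sphere V N. \<forall>\<epsilon>>0. \<exists>y\<in>W. N (x - y) \<ge> 2 - \<epsilon>))"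

definition bounded_operator_on :: "'a::real_vector set \<Rightarrow> ('a \<Rightarrow> real) \<Rightarrow> ('a \<Rightarrow> 'a) \<Rightarrow> bool" where
  "bounded_operator_on V N T \<longleftrightarrow>
     T ` V \<subseteq> V \<and> (\<forall>x\<in>V. \<forall>y\<in>V. T (x + y) = T x + T y) \<and> (\<forall>c. \<forall>x\<in>V. T (c *\<^sub>R x) = c *\<^sub>R T x) \<and>
     (\<exists>C. \<forall>x\<in>V. N (T x) \<le> C * N x)"

definition op_norm :: "'a::real_vector set \<Rightarrow> ('a \<Rightarrow> real) \<Rightarrow> ('a \<Rightarrow> 'a) \<Rightarrow> real" where
  "op_norm V N T = (SUP x\<in>unit_ball V N. N (T x))"

definition rank_one_operator :: "'a::real_vector set \<Rightarrow> ('a \<Rightarrow> real) \<Rightarrow> ('a \<Rightarrow> 'a) \<Rightarrow> bool" where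
  "rank_one_operator V N T \<longleftrightarrow> bounded_operator_on V N T \<and> dim (T ` V) = 1"

definition Daugavet_property :: "'a::real_vector set \<Rightarrow> ('a \<Rightarrow> real) \<Rightarrow> bool" where
  "Daugavet_property V N \<longleftrightarrow>
     (\<forall>T. rank_one_operator V N T \<longrightarrow> op_norm V N (\<lambda>x. x + T x) = 1 + op_norm V N T)"


section \<open>Measurable functions modulo equality almost everywhere\<close>

quotient_type L0 = "real \<Rightarrow> real" / partial:
  "\<lambda>f g. f \<in> borel_measurable lebesgue \<and> g \<in> borel_measurable lebesgue \<and>
         (AE x in lebesgue. f x = g x)"
proof (rule part_equivpI)
  show "\<exists>f::real \<Rightarrow> real. f \<in> borel_measurable lebesgue \<and> f \<in> borel_measurable lebesgue \<and>
          (AE x in lebesgue. f x = f x)"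
    by (rule exI[of _ "\<lambda>_. 0"]) simp
  show "symp (\<lambda>f g::real \<Rightarrow> real. f \<in> borel_measurable lebesgue \<and> g \<in> borel_measurable lebesgue \<and>
          (AE x in lebesgue. f x = g x))"
    by (auto intro!: sympI elim!: eventually_mono)
  show "transp (\<lambda>f g::real \<Rightarrow> real. f \<in> borel_measurable lebesgue \<and> g \<in> borel_measurable lebesgue \<and>
          (AE x in lebesgue. f x = g x))"
    by (intro transpI) (auto elim: eventually_elim2)
qed

instantiation L0 :: real_vector
begin

lift_definition zero_L0 :: L0 is "\<lambda>_. 0"
  by simp

lift_definition plus_L0 :: "L0 \<Rightarrow> L0 \<Rightarrow> L0" is "\<lambda>f g x. f x + g x"
  by (auto elim: eventually_elim2)

lift_definition minus_L0 :: "L0 \<Rightarrow> L0 \<Rightarrow> L0" is "\<lambda>f g x. f x - g x"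
  by (auto elim: eventually_elim2)

lift_definition uminus_L0 :: "L0 \<Rightarrow> L0" is "\<lambda>f x. - f x"
  by (auto elim: eventually_mono)

lift_definition scaleR_L0 :: "real \<Rightarrow> L0 \<Rightarrow> L0" is "\<lambda>c f x. c * f x"
  by (auto elim: eventually_mono)

instance
  by standard (transfer; auto simp: algebra_simps)+

end


section \<open>The space $\mathcal{M}^0_{\varphi,w}$\<close>

definition I_of :: "ereal \<Rightarrow> real set" where
  "I_of \<gamma> = {t. 0 \<le> t \<and> ereal t < \<gamma>}"

definition Orlicz_function :: "(real \<Rightarrow> real) \<Rightarrow> bool" where
  "Orlicz_function \<phi> \<longleftrightarrow>
     convex_on {0..} \<phi> \<and> (\<forall>u\<ge>0. 0 \<le> \<phi> u) \<and> \<phi> 0 = 0 \<and> (\<exists>u\<ge>0. \<phi> u \<noteq> 0)"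

definition N_function_at_infinity :: "(real \<Rightarrow> real) \<Rightarrow> bool" where
  "N_function_at_infinity \<phi> \<longleftrightarrow> filterlim (\<lambda>u. \<phi> u / u) at_top at_top"

text \<open>
  Positivity and monotonicity of weights are required on the open interval \<open>(0, \<gamma>)\<close>, so that weights
  unbounded near \<open>0\<close>, such as \<open>1 / sqrt t\<close>, are included; their value at \<open>0\<close> is irrelevant.
\<close>

definition positive_decreasing :: "ereal \<Rightarrow> (real \<Rightarrow> real) \<Rightarrow> bool" where
  "positive_decreasing \<gamma> v \<longleftrightarrow> (\<forall>t\<in>I_of \<gamma> - {0}. 0 < v t) \<and> antimono_on (I_of \<gamma> - {0}) v"

definition weight_function :: "ereal \<Rightarrow> (real \<Rightarrow> real) \<Rightarrow> bool" where
  "weight_function \<gamma> w \<longleftrightarrow>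
     positive_decreasing \<gamma> w \<and>
     (\<forall>t\<in>I_of \<gamma>. (\<integral>\<^sup>+ s\<in>{0..t}. ennreal (w s) \<partial>lebesgue) < \<infinity>) \<and>
     (\<gamma> = \<infinity> \<longrightarrow> (\<integral>\<^sup>+ s\<in>{0..}. ennreal (w s) \<partial>lebesgue) = \<infinity>)"

definition distribution_function :: "ereal \<Rightarrow> (real \<Rightarrow> real) \<Rightarrow> real \<Rightarrow> ennreal" where
  "distribution_function \<gamma> f l = emeasure lebesgue {t \<in> I_of \<gamma>. l < \<bar>f t\<bar>}"

text \<open>Extended-valued, since the infimum may be over the empty set when \<open>\<gamma> = \<infinity>\<close>.\<close>

definition rearrangement :: "ereal \<Rightarrow> (real \<Rightarrow> real) \<Rightarrow> real \<Rightarrow> ennreal" where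
  "rearrangement \<gamma> f t = Inf {ennreal l | l. 0 < l \<and> distribution_function \<gamma> f l \<le> ennreal t}"

definition submajorized :: "ereal \<Rightarrow> (real \<Rightarrow> real) \<Rightarrow> (real \<Rightarrow> real) \<Rightarrow> bool" where
  "submajorized \<gamma> v w \<longleftrightarrow>
     (\<forall>t>0. (\<integral>\<^sup>+ s\<in>{0..t}. rearrangement \<gamma> v s \<partial>lebesgue)
             \<le> (\<integral>\<^sup>+ s\<in>{0..t}. rearrangement \<gamma> w s \<partial>lebesgue))"

definition Orlicz_ext :: "(real \<Rightarrow> real) \<Rightarrow> ennreal \<Rightarrow> ennreal" where
  "Orlicz_ext \<phi> x = (if x = \<infinity> then \<infinity> else ennreal (\<phi> (enn2real x)))"

definition P_fun :: "ereal \<Rightarrow> (real \<Rightarrow> real) \<Rightarrow> (real \<Rightarrow> real) \<Rightarrow> (real \<Rightarrow> real) \<Rightarrow> ennreal" where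
  "P_fun \<gamma> \<phi> w f =
     (INF v\<in>{v. submajorized \<gamma> v w \<and> positive_decreasing \<gamma> v}.
        \<integral>\<^sup>+ t\<in>I_of \<gamma>. Orlicz_ext \<phi> (rearrangement \<gamma> f t / ennreal (v t)) * ennreal (v t) \<partial>lebesgue)"

lemma I_of_sets: "I_of \<gamma> \<in> sets lebesgue"
proof -
  have "I_of \<gamma> = {0..} \<inter> {t. ereal t < \<gamma>}"
    by (auto simp: I_of_def)
  moreover have "{t. ereal t < \<gamma>} \<in> sets borel"
    by measurable
  ultimately show ?thesis
    by auto
qed

lemma distribution_function_cong_AE:
  assumes "f \<in> borel_measurable lebesgue" "g \<in> borel_measurable lebesgue"
    and "AE x in lebesgue. f x = g x"
  shows "distribution_function \<gamma> f = distribution_function \<gamma> g"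
proof
  fix l
  have "{t \<in> I_of \<gamma>. l < \<bar>h t\<bar>} \<in> sets lebesgue" if "h \<in> borel_measurable lebesgue" for h :: "real \<Rightarrow> real"
  proof -
    have "{t \<in> I_of \<gamma>. l < \<bar>h t\<bar>} = I_of \<gamma> \<inter> {t \<in> space lebesgue. l < \<bar>h t\<bar>}"
      by auto
    moreover have "{t \<in> space lebesgue. l < \<bar>h t\<bar>} \<in> sets lebesgue"
      using that by measurable
    ultimately show ?thesis
      using I_of_sets by auto
  qed
  then show "distribution_function \<gamma> f l = distribution_function \<gamma> g l"
    unfolding distribution_function_def
    using assms by (intro emeasure_eq_AE) auto
qed

lift_definition P_functional :: "ereal \<Rightarrow> (real \<Rightarrow> real) \<Rightarrow> (real \<Rightarrow> real) \<Rightarrow> L0 \<Rightarrow> ennreal" is P_fun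
proof -
  fix \<gamma> :: ereal and \<phi> w f g :: "real \<Rightarrow> real"
  assume "f \<in> borel_measurable lebesgue \<and> g \<in> borel_measurable lebesgue \<and>
            (AE x in lebesgue. f x = g x)"
  then have "distribution_function \<gamma> f = distribution_function \<gamma> g"
    by (intro distribution_function_cong_AE) auto
  then show "P_fun \<gamma> \<phi> w f = P_fun \<gamma> \<phi> w g"
    by (simp only: P_fun_def rearrangement_def)
qed

text \<open>Functions on \<open>I\<close> are identified with functions on the real line vanishing outside \<open>I\<close>.\<close>

lift_definition supported_on_I :: "ereal \<Rightarrow> L0 \<Rightarrow> bool" is
  "\<lambda>\<gamma> f. AE x in lebesgue. x \<notin> I_of \<gamma> \<longrightarrow> f x = 0"
  by (auto elim: eventually_elim2)

definition M_space :: "ereal \<Rightarrow> (real \<Rightarrow> real) \<Rightarrow> (real \<Rightarrow> real) \<Rightarrow> L0 set" where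
  "M_space \<gamma> \<phi> w = {f. supported_on_I \<gamma> f \<and> (\<exists>k>0. P_functional \<gamma> \<phi> w (k *\<^sub>R f) < \<infinity>)}"

definition M_Orlicz_norm :: "ereal \<Rightarrow> (real \<Rightarrow> real) \<Rightarrow> (real \<Rightarrow> real) \<Rightarrow> L0 \<Rightarrow> real" where
  "M_Orlicz_norm \<gamma> \<phi> w f =
     enn2real (INF k\<in>{0<..}. ennreal (1 / k) * (1 + P_functional \<gamma> \<phi> w (k *\<^sub>R f)))"

end

theory Submission
  imports Defs
begin

text \<open>
  Put \<open>\<psi>(x, y) = y \<phi>(x / y)\<close>.  The modular of the space minimises \<open>\<integral> \<psi>(f\<^sup>*, v)\<close> over decreasing
  \<open>v \<prec> w\<close>.  The same norm results from minimising \<open>\<integral> \<psi>(\<bar>f\<bar>, u)\<close> over all weights \<open>u\<close> with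
  \<open>\<integral>\<^sub>E u \<le> \<integral>\<^sub>0\<^sup>|\<^sup>E\<^sup>| w\<^sup>*\<close> for every \<open>E\<close>; this needs no rearrangement and is jointly convex, so the triangle
  inequality is immediate.  To pass from \<open>v\<close> to \<open>u\<close>, transport \<open>v\<close> along a map that arranges \<open>\<bar>f\<bar>\<close> in
  decreasing order; to pass back, rearrange \<open>u\<close>.  Both steps compare distribution functions, because
  \<open>\<psi>\<close> is a superposition of the functions \<open>(x - s y)\<^sub>+\<close>.

  Choose \<open>s\<close> large and \<open>a\<close> with \<open>\<phi>\<^sub>*(s) \<integral>\<^sub>0\<^sup>a w = 1\<close>.  By Young's inequality \<open>f \<mapsto> s \<integral>\<^sub>0\<^sup>a f\<close> has norm one, and
  it attains its norm at a multiple of \<open>w\<close> restricted to \<open>[0, a]\<close>.  If it is almost one at an \<open>f\<close> in the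
  unit ball, then the scaling \<open>k\<close> in the norm of \<open>f\<close> is bounded since \<open>\<phi>\<close> is superlinear, and almost
  equality in Young's inequality forces \<open>f \<ge> \<theta>\<close> and \<open>k f \<ge> c u\<close> on two thirds of \<open>[0, a]\<close>, where
  \<open>\<phi> c > 0\<close>.  Hence \<open>f\<close> and \<open>g\<close> in a small slice share such a set \<open>B\<close> with \<open>|B| \<ge> a / 3\<close>.  Lowering either
  function by \<open>\<theta>\<close> on \<open>B\<close> lowers its norm by a fixed amount, and
  \<open>f - g = (f - \<theta> 1\<^sub>B) - (g - \<theta> 1\<^sub>B)\<close>, so the slice has diameter less than two.
\<close>

section \<open>Layer-cake comparison of modulars\<close>

text \<open>The scaling \<open>k\<close> and the weight \<open>u\<close> in the norm of a function
  are only near-minimisers, and nothing is known of how they depend on the function, so the gain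
  must be uniform in both. Young's inequality at the doubled slope bounds \<open>k\<close>. The
  constraint on \<open>u\<close> keeps it from concentrating: almost equality makes its mass on
  [0, a] nearly maximal, and that much mass does not fit on a set of measure below 2a/3. Any
  fraction above one half would serve to make two such sets meet. Lowering a function need not lower
  its modular, because \<phi> may vanish near 0. Hence the ratio bound c, called \<open>u3\<close>
  below, with \<phi> positive there; the slope is large so that Young's inequality is strict at
  ratios up to c. In the change between v and u, exact correspondence fails: on an infinite interval
  a point may have infinite mass above it, and decreasing weights must be positive while u may
  vanish. So only inequalities between joint level sets are proved, the limit of v at infinity
  serves infinite ranks, and a factor 1 - e is lost and recovered in the limit.\<close>

abbreviation "\<mu> \<equiv> emeasure (lebesgue :: real measure)"
abbreviation "\<L> \<equiv> sets (lebesgue :: real measure)"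
abbreviation "\<M> \<equiv> borel_measurable (lebesgue :: real measure)"
abbreviation "\<D> \<equiv> distribution_function"

abbreviation nint :: "real set \<Rightarrow> (real \<Rightarrow> real) \<Rightarrow> ennreal" where
  "nint E u \<equiv> \<integral>\<^sup>+t\<in>E. ennreal (u t) \<partial>lebesgue"

abbreviation level :: "ereal \<Rightarrow> (real \<Rightarrow> real) \<Rightarrow> real \<Rightarrow> real set" where
  "level \<gamma> f l \<equiv> {x \<in> I_of \<gamma>. l < \<bar>f x\<bar>}"

lemma sigma_finite_lebesgue: "sigma_finite_measure (lebesgue :: real measure)"
proof
  show "\<exists>A::real set set. countable A \<and> A \<subseteq> \<L> \<and> \<Union>A = space lebesgue \<and>
      (\<forall>a\<in>A. \<mu> a \<noteq> \<infinity>)"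
  proof (intro exI[of _ "range (\<lambda>n::nat. {- real n .. real n})"] conjI)
    show "\<Union>(range (\<lambda>n::nat. {- real n .. real n})) = space lebesgue"
    proof -
      have "\<exists>n::nat. - real n \<le> x \<and> x \<le> real n" for x
        using real_arch_simple[of "\<bar>x\<bar>"] by (simp add: abs_le_iff minus_le_iff conj_commute)
      then show ?thesis by auto
    qed
  qed auto
qed

interpretation lebesgue: sigma_finite_measure "lebesgue :: real measure"
  by (rule sigma_finite_lebesgue)

interpretation lebesgue_lborel: pair_sigma_finite "lebesgue :: real measure" "lborel :: real measure"
  by standard

lemma emeasure_lborel_Ici: "emeasure lborel {c::real..} = \<infinity>"
proof -
  have le: "ennreal (real n) \<le> emeasure lborel {c..}" for n :: nat
  proof -
    have "ennreal (real n) = emeasure lborel {c..c + real n}" by simp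
    also have "\<dots> \<le> emeasure lborel {c..}" by (rule emeasure_mono) auto
    finally show ?thesis .
  qed
  show ?thesis
  proof (cases "emeasure lborel {c..}")
    case (real r)
    obtain n :: nat where "r < real n" using reals_Archimedean2 by blast
    with le[of n] real show ?thesis by simp
  qed simp
qed

lemma emeasure_interval_diff:
  fixes c :: real
  assumes "0 \<le> c"
  shows "emeasure lborel {l. c \<le> l \<and> ennreal l < x} = x - ennreal c"
    and "emeasure lborel {l. c < l \<and> ennreal l < x} = x - ennreal c"
proof -
  have "emeasure lborel {l. c \<le> l \<and> ennreal l < x} = x - ennreal c \<and>
        emeasure lborel {l. c < l \<and> ennreal l < x} = x - ennreal c"
  proof (cases x)
    case (real r)
    have 1: "{l. c \<le> l \<and> ennreal l < x} = {c..<r}"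
      using assms real by (auto simp: ennreal_less_iff)
    have 2: "{l. c < l \<and> ennreal l < x} = {c<..<r}"
      using assms real by (auto simp: ennreal_less_iff)
    show ?thesis
      unfolding 1 2 using real assms
      by (cases "c \<le> r") (auto simp: ennreal_minus ennreal_neg)
  next
    case top
    have 1: "{l. c \<le> l \<and> ennreal l < x} = {c..}"
      using top by auto
    have 2: "{l. c < l \<and> ennreal l < x} = {c<..}"
      using top by auto
    have "emeasure lborel {c<..} = \<infinity>"
    proof -
      have "emeasure lborel {c..} \<le> emeasure lborel ({c} \<union> {c<..})"
        by (rule emeasure_mono) auto
      also have "\<dots> \<le> emeasure lborel {c} + emeasure lborel {c<..}"
        by (rule emeasure_subadditive) auto
      finally show ?thesis by (simp add: emeasure_lborel_Ici top_unique)
    qed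
    then show ?thesis
      unfolding 1 2 using top by (simp add: emeasure_lborel_Ici)
  qed
  then show "emeasure lborel {l. c \<le> l \<and> ennreal l < x} = x - ennreal c"
    and "emeasure lborel {l. c < l \<and> ennreal l < x} = x - ennreal c" by auto
qed

text \<open>Fubini for the region between two graphs; truncated subtraction in
  \<open>ennreal\<close> makes the integrand the positive part of f - g. Including or excluding the
  lower boundary changes each fibre only by a point. Both forms are wanted: the comparison of
  modulars puts the strict one on its smaller side and the weak one on its larger side.\<close>

lemma nn_integral_diff_layers:
  fixes f :: "real \<Rightarrow> ennreal" and g :: "real \<Rightarrow> real"
  assumes [measurable]: "f \<in> \<M>" "g \<in> \<M>"
    and g: "\<And>x. 0 \<le> g x"
  shows "(\<integral>\<^sup>+x. f x - ennreal (g x) \<partial>lebesgue) =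
           (\<integral>\<^sup>+l. \<mu> {x. g x \<le> l \<and> ennreal l < f x} \<partial>lborel)"
    and "(\<integral>\<^sup>+x. f x - ennreal (g x) \<partial>lebesgue) =
           (\<integral>\<^sup>+l. \<mu> {x. g x < l \<and> ennreal l < f x} \<partial>lborel)"
proof -
  have layers: "(\<integral>\<^sup>+x. f x - ennreal (g x) \<partial>lebesgue) = (\<integral>\<^sup>+l. \<mu> {x. P x l} \<partial>lborel)"
    if P: "\<And>x. emeasure lborel {l. P x l} = f x - ennreal (g x)" "\<And>x. {l. P x l} \<in> sets borel"
      "\<And>l. {x \<in> space lebesgue. P x l} \<in> \<L>"
      "(\<lambda>(x, l). indicator {l. P x l} l :: ennreal) \<in> borel_measurable (lebesgue \<Otimes>\<^sub>M lborel)"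
    for P :: "real \<Rightarrow> real \<Rightarrow> bool"
  proof -
    have "(\<integral>\<^sup>+x. f x - ennreal (g x) \<partial>lebesgue) =
        (\<integral>\<^sup>+x. \<integral>\<^sup>+l. indicator {l. P x l} l \<partial>lborel \<partial>lebesgue)"
      using P(1,2) by (intro nn_integral_cong) simp
    also have "\<dots> = (\<integral>\<^sup>+l. \<integral>\<^sup>+x. indicator {l. P x l} l \<partial>lebesgue \<partial>lborel)"
      by (rule lebesgue_lborel.Fubini'[symmetric, OF P(4)])
    also have "\<dots> = (\<integral>\<^sup>+l. \<integral>\<^sup>+x. indicator {x. P x l} x \<partial>lebesgue \<partial>lborel)"
      by (intro nn_integral_cong) (auto simp: indicator_def)
    also have "\<dots> = (\<integral>\<^sup>+l. \<mu> {x. P x l} \<partial>lborel)"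
      using P(3) by (intro nn_integral_cong nn_integral_indicator) simp
    finally show ?thesis .
  qed
  show "(\<integral>\<^sup>+x. f x - ennreal (g x) \<partial>lebesgue) = (\<integral>\<^sup>+l. \<mu> {x. g x \<le> l \<and> ennreal l < f x} \<partial>lborel)"
    by (rule layers, rule emeasure_interval_diff[OF g]) measurable
  show "(\<integral>\<^sup>+x. f x - ennreal (g x) \<partial>lebesgue) = (\<integral>\<^sup>+l. \<mu> {x. g x < l \<and> ennreal l < f x} \<partial>lborel)"
    by (rule layers, rule emeasure_interval_diff[OF g]) measurable
qed

lemma nn_integral_layers:
  fixes f :: "real \<Rightarrow> ennreal"
  assumes [measurable]: "f \<in> \<M>"
  shows "(\<integral>\<^sup>+x. f x \<partial>lebesgue) =
           (\<integral>\<^sup>+l\<in>{0..}. \<mu> {x. ennreal l < f x} \<partial>lborel)"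
proof -
  have "(\<integral>\<^sup>+x. f x \<partial>lebesgue) = (\<integral>\<^sup>+x. f x - ennreal 0 \<partial>lebesgue)"
    by simp
  also have "\<dots> = (\<integral>\<^sup>+l. \<mu> {x. 0 \<le> l \<and> ennreal l < f x} \<partial>lborel)"
    by (rule nn_integral_diff_layers) auto
  also have "\<dots> = (\<integral>\<^sup>+l\<in>{0..}. \<mu> {x. ennreal l < f x} \<partial>lborel)"
  proof (rule nn_integral_cong)
    fix l :: real
    show "\<mu> {x. 0 \<le> l \<and> ennreal l < f x} =
        \<mu> {x. ennreal l < f x} * indicator {0..} l"
      by (cases "0 \<le> l") simp_all
  qed
  finally show ?thesis .
qed

text \<open>
  The perspective \<open>y \<phi> (x / y)\<close> of \<open>\<phi> x = \<integral>\<^sub>0\<^sup>\<infinity> (x - s r)\<^sub>+ dr\<close>; unlike the quotient, the integral has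
  the right values \<open>0\<close> and \<open>\<infinity>\<close> at \<open>y = 0\<close>, and it is visibly sublinear in \<open>(x, y)\<close>.
\<close>

definition perspective :: "(real \<Rightarrow> real) \<Rightarrow> ennreal \<Rightarrow> real \<Rightarrow> ennreal" where
  "perspective s x y = (\<integral>\<^sup>+r\<in>{0..}. (x - ennreal (s r * y)) \<partial>lborel)"

text \<open>For fixed \<open>r\<close> the integral of the positive part of
  \<open>f - s r * u\<close> is a layer integral over the sets where \<open>f\<close> exceeds
  \<open>l\<close> and \<open>u\<close> is below \<open>l / s r\<close>. Inequalities between the
  measures of such joint level sets therefore suffice. The assumption \<open>le\<close> covers
  \<open>s r = 0\<close>, where the condition on the weight disappears.\<close>

lemma nn_integral_perspective_le:
  fixes f1 f2 :: "real \<Rightarrow> ennreal" and u1 u2 :: "real \<Rightarrow> real"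
  assumes [measurable]: "f1 \<in> \<M>" "f2 \<in> \<M>"
      "u1 \<in> \<M>" "u2 \<in> \<M>" "s \<in> borel_measurable borel"
    and u1: "\<And>x. 0 \<le> u1 x" and u2: "\<And>x. 0 \<le> u2 x" and s: "\<And>r. 0 \<le> s r"
    and le: "\<And>l. 0 < l \<Longrightarrow>
      \<mu> {x. ennreal l < f1 x} \<le> \<mu> {x. ennreal l < f2 x}"
    and le': "\<And>l c. 0 < l \<Longrightarrow> 0 < c \<Longrightarrow>
      \<mu> {x. u1 x < c \<and> ennreal l < f1 x} \<le> \<mu> {x. u2 x \<le> c \<and> ennreal l < f2 x}"
  shows "(\<integral>\<^sup>+x. perspective s (f1 x) (u1 x) \<partial>lebesgue) \<le> (\<integral>\<^sup>+x. perspective s (f2 x) (u2 x) \<partial>lebesgue)"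
proof -
  have swap: "(\<integral>\<^sup>+x. perspective s (f x) (u x) \<partial>lebesgue) =
      (\<integral>\<^sup>+r\<in>{0..}. (\<integral>\<^sup>+x. f x - ennreal (s r * u x) \<partial>lebesgue) \<partial>lborel)"
    if [measurable]: "f \<in> \<M>" "u \<in> \<M>"
    for f :: "real \<Rightarrow> ennreal" and u :: "real \<Rightarrow> real"
  proof -
    have "(\<integral>\<^sup>+x. perspective s (f x) (u x) \<partial>lebesgue) =
        (\<integral>\<^sup>+r. (\<integral>\<^sup>+x. (f x - ennreal (s r * u x)) * indicator {0..} r \<partial>lebesgue) \<partial>lborel)"
      unfolding perspective_def by (rule lebesgue_lborel.Fubini'[symmetric]) measurable
    also have "\<dots> = (\<integral>\<^sup>+r\<in>{0..}. (\<integral>\<^sup>+x. f x - ennreal (s r * u x) \<partial>lebesgue) \<partial>lborel)"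
      by (intro nn_integral_cong) (auto simp: indicator_def)
    finally show ?thesis .
  qed
  have "(\<integral>\<^sup>+x. f1 x - ennreal (s r * u1 x) \<partial>lebesgue) \<le> (\<integral>\<^sup>+x. f2 x - ennreal (s r * u2 x) \<partial>lebesgue)" for r
  proof -
    have "(\<integral>\<^sup>+x. f1 x - ennreal (s r * u1 x) \<partial>lebesgue) =
        (\<integral>\<^sup>+l. \<mu> {x. s r * u1 x < l \<and> ennreal l < f1 x} \<partial>lborel)"
      using s u1 by (intro nn_integral_diff_layers) auto
    also have "\<dots> \<le> (\<integral>\<^sup>+l. \<mu> {x. s r * u2 x \<le> l \<and> ennreal l < f2 x} \<partial>lborel)"
    proof (rule nn_integral_mono)
      fix l :: real
      show "\<mu> {x. s r * u1 x < l \<and> ennreal l < f1 x} \<le>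
          \<mu> {x. s r * u2 x \<le> l \<and> ennreal l < f2 x}"
      proof (cases "0 < l")
        case False
        then have "{x. s r * u1 x < l \<and> ennreal l < f1 x} = {}"
          using mult_nonneg_nonneg[OF s u1] by (smt (verit) Collect_empty_eq)
        then show ?thesis by (simp only: emeasure_empty zero_le)
      next
        case True
        show ?thesis
        proof (cases "s r = 0")
          case True
          then show ?thesis using le[OF \<open>0 < l\<close>] \<open>0 < l\<close> by simp
        next
          case False
          then have pos: "0 < s r" using s[of r] by simp
          have "{x. s r * u1 x < l \<and> ennreal l < f1 x} = {x. u1 x < l / s r \<and> ennreal l < f1 x}"
            using pos by (simp add: field_simps)
          moreover have "{x. s r * u2 x \<le> l \<and> ennreal l < f2 x} = {x. u2 x \<le> l / s r \<and> ennreal l < f2 x}"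
            using pos by (simp add: field_simps)
          ultimately show ?thesis using le'[of l "l / s r"] pos \<open>0 < l\<close> by simp
        qed
      qed
    qed
    also have "\<dots> = (\<integral>\<^sup>+x. f2 x - ennreal (s r * u2 x) \<partial>lebesgue)"
      using s u2 by (intro nn_integral_diff_layers[symmetric]) auto
    finally show ?thesis .
  qed
  then have "(\<integral>\<^sup>+x. f1 x - ennreal (s r * u1 x) \<partial>lebesgue) * indicator {0..} r \<le>
      (\<integral>\<^sup>+x. f2 x - ennreal (s r * u2 x) \<partial>lebesgue) * indicator {0..} r" for r
    by (rule mult_right_mono) simp
  then show ?thesis
    unfolding swap[OF assms(1,3)] swap[OF assms(2,4)] by (rule nn_integral_mono)
qed

lemma perspective_mono: "x \<le> x' \<Longrightarrow> (\<And>r. 0 \<le> s r) \<Longrightarrow> y' \<le> y \<Longrightarrow> perspective s x y \<le> perspective s x' y'"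
  unfolding perspective_def
  by (intro nn_integral_mono mult_right_mono[OF ennreal_minus_mono] ennreal_leI mult_left_mono) auto

text \<open>The positive part of a linear form is subadditive; integration over \<open>r\<close>
  keeps this. With homogeneity it gives joint convexity without any division.\<close>

lemma perspective_add:
  assumes [measurable]: "s \<in> borel_measurable borel" and "\<And>r. 0 \<le> s r" "0 \<le> y1" "0 \<le> y2"
  shows "perspective s (x1 + x2) (y1 + y2) \<le> perspective s x1 y1 + perspective s x2 y2"
proof -
  have sub: "x1 + x2 - (a + b) \<le> (x1 - a) + (x2 - b)" for a b :: ennreal
  proof (cases "a = top \<or> b = top")
    case True
    then show ?thesis by (auto simp: minus_top_ennreal)
  next
    case False
    have le: "x \<le> (x - c) + c" for x c :: ennreal
      by (auto simp: diff_add_self_ennreal)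
    have "x1 + x2 \<le> ((x1 - a) + a) + ((x2 - b) + b)"
      by (intro add_mono le)
    then have "x1 + x2 \<le> (a + b) + ((x1 - a) + (x2 - b))"
      by (simp add: ac_simps)
    then show ?thesis using False by (simp add: ennreal_minus_le_iff)
  qed
  have "perspective s (x1 + x2) (y1 + y2) \<le>
      (\<integral>\<^sup>+r. (x1 - ennreal (s r * y1)) * indicator {0..} r + (x2 - ennreal (s r * y2)) * indicator {0..} r \<partial>lborel)"
    unfolding perspective_def
  proof (rule nn_integral_mono)
    fix r
    have "ennreal (s r * (y1 + y2)) = ennreal (s r * y1) + ennreal (s r * y2)"
      using assms by (simp add: distrib_left)
    then show "(x1 + x2 - ennreal (s r * (y1 + y2))) * indicator {0..} r \<le>
       (x1 - ennreal (s r * y1)) * indicator {0..} r + (x2 - ennreal (s r * y2)) * indicator {0..} r"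
      using sub by (auto simp: indicator_def)
  qed
  also have "\<dots> = perspective s x1 y1 + perspective s x2 y2"
    unfolding perspective_def by (intro nn_integral_add) auto
  finally show ?thesis .
qed

lemma perspective_scale:
  assumes [measurable]: "s \<in> borel_measurable borel" and "\<And>r. 0 \<le> s r" "0 \<le> y" "0 < c"
  shows "perspective s (ennreal c * x) (c * y) = ennreal c * perspective s x y"
proof -
  have "perspective s (ennreal c * x) (c * y) =
     (\<integral>\<^sup>+r. ennreal c * ((x - ennreal (s r * y)) * indicator {0..} r) \<partial>lborel)"
    unfolding perspective_def
  proof (rule nn_integral_cong)
    fix r
    have "ennreal (s r * (c * y)) = ennreal c * ennreal (s r * y)"
      using assms by (simp add: ennreal_mult[symmetric] mult_ac)
    moreover have "ennreal c * (x - z) = ennreal c * x - ennreal c * z" for z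
      by (simp add: ennreal_right_diff_distrib)
    ultimately show "(ennreal c * x - ennreal (s r * (c * y))) * indicator {0..} r =
        ennreal c * ((x - ennreal (s r * y)) * indicator {0..} r)"
      by (auto simp: indicator_def)
  qed
  also have "\<dots> = ennreal c * perspective s x y"
    unfolding perspective_def by (intro nn_integral_cmult) auto
  finally show ?thesis .
qed

lemma perspective_0_left [simp]: "perspective s 0 y = 0"
  by (simp add: perspective_def)

lemma perspective_0_right: "0 < x \<Longrightarrow> perspective s x 0 = \<infinity>"
  by (simp add: perspective_def nn_integral_cmult_indicator emeasure_lborel_Ici ennreal_mult_top)

section \<open>Orlicz functions as superpositions of positive parts\<close>

text \<open>On a partition of [0, x] into n equal pieces the increments of \<open>F\<close> and
  \<open>G\<close> differ by at most x / n times the increment of \<open>p\<close>, and these errors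
  telescope to \<open>x / real n * (p x - p 0)\<close>. This takes the place of differentiation,
  since the slope \<open>p\<close> may jump.\<close>

lemma increment_bounds_unique:
  fixes F G p :: "real \<Rightarrow> real"
  assumes F: "\<And>a b. 0 \<le> a \<Longrightarrow> a < b \<Longrightarrow> p a * (b - a) \<le> F b - F a \<and> F b - F a \<le> p b * (b - a)"
    and G: "\<And>a b. 0 \<le> a \<Longrightarrow> a < b \<Longrightarrow> p a * (b - a) \<le> G b - G a \<and> G b - G a \<le> p b * (b - a)"
    and "F 0 = G 0" "0 \<le> x"
  shows "F x = G x"
proof (cases "x = 0")
  case False
  with \<open>0 \<le> x\<close> have x: "0 < x" by simp
  have *: "\<bar>F x - G x\<bar> \<le> x / real n * (p x - p 0)" if n: "0 < n" for n :: nat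
  proof -
    define t where "t i = x * real i / real n" for i :: nat
    have t: "t (Suc i) - t i = x / real n" "0 \<le> t i" "t i < t (Suc i)" for i
      using x n by (auto simp: t_def field_simps)
    have "\<bar>F (t m) - G (t m)\<bar> \<le> x / real n * (p (t m) - p 0)" for m
    proof (induction m)
      case 0
      then show ?case using \<open>F 0 = G 0\<close> by (simp add: t_def)
    next
      case (Suc m)
      have "\<bar>(F (t (Suc m)) - F (t m)) - (G (t (Suc m)) - G (t m))\<bar> \<le>
          p (t (Suc m)) * (t (Suc m) - t m) - p (t m) * (t (Suc m) - t m)"
        using F[OF t(2,3)[of m]] G[OF t(2,3)[of m]] by linarith
      also have "\<dots> = x / real n * (p (t (Suc m)) - p (t m))"
        unfolding t by (simp add: algebra_simps)
      finally show ?case using Suc.IH by (simp add: algebra_simps)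
    qed
    from this[of n] show ?thesis using n by (simp add: t_def)
  qed
  have "(\<lambda>n. x * (p x - p 0) * inverse (real n)) \<longlonglongrightarrow> x * (p x - p 0) * 0"
    by (intro tendsto_intros lim_inverse_n)
  then have "(\<lambda>n. x / real n * (p x - p 0)) \<longlonglongrightarrow> 0"
    by (simp add: field_simps)
  then have "\<bar>F x - G x\<bar> \<le> 0"
  proof (rule tendsto_lowerbound)
    show "\<forall>\<^sub>F n in sequentially. \<bar>F x - G x\<bar> \<le> x / real n * (p x - p 0)"
      by (rule eventually_sequentiallyI[of 1]) (rule *, simp)
  qed simp
  then show ?thesis by simp
qed (use assms in simp)

text \<open>The right derivative: secant slopes from \<open>a\<close> increase with the other
  endpoint, so the limit is an infimum.\<close>

definition right_slope :: "(real \<Rightarrow> real) \<Rightarrow> real \<Rightarrow> real" where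
  "right_slope \<phi> a = (INF b\<in>{a<..}. (\<phi> b - \<phi> a) / (b - a))"

text \<open>The generalised inverse of the right derivative, for r \<ge> 0 the right derivative of
  the conjugate function. Superlinearity makes the set nonempty for every \<open>r\<close>.\<close>

definition slope_inverse :: "(real \<Rightarrow> real) \<Rightarrow> real \<Rightarrow> real" where
  "slope_inverse \<phi> r = Inf {a. 0 \<le> a \<and> r < right_slope \<phi> a}"

locale orlicz =
  fixes \<phi> :: "real \<Rightarrow> real"
  assumes orlicz: "Orlicz_function \<phi>" and N_function: "N_function_at_infinity \<phi>"
begin

lemma convex_phi: "convex_on {0..} \<phi>" and phi_nonneg: "0 \<le> u \<Longrightarrow> 0 \<le> \<phi> u"
    and phi_0 [simp]: "\<phi> 0 = 0" and phi_nontrivial: "\<exists>u\<ge>0. \<phi> u \<noteq> 0"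
  using orlicz by (auto simp: Orlicz_function_def)

lemma phi_scale_le: "0 \<le> c \<Longrightarrow> c \<le> 1 \<Longrightarrow> 0 \<le> u \<Longrightarrow> \<phi> (c * u) \<le> c * \<phi> u"
  using convex_onD[OF convex_phi, of c 0 u] by simp

lemma phi_mono: "0 \<le> u \<Longrightarrow> u \<le> v \<Longrightarrow> \<phi> u \<le> \<phi> v"
proof (cases "v = 0")
  case False
  assume "0 \<le> u" "u \<le> v"
  with False have v: "0 < v" by simp
  have "\<phi> u \<le> u / v * \<phi> v"
    using phi_scale_le[of "u / v" v] v \<open>0 \<le> u\<close> \<open>u \<le> v\<close> by simp
  also have "\<dots> \<le> 1 * \<phi> v"
    using v \<open>0 \<le> u\<close> \<open>u \<le> v\<close> phi_nonneg[of v] by (intro mult_right_mono) auto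
  finally show ?thesis by simp
qed auto

lemma slopes_le:
  assumes "0 \<le> a" "a < b" "b < c"
  shows "(\<phi> b - \<phi> a) / (b - a) \<le> (\<phi> c - \<phi> b) / (c - b)"
    and "(\<phi> b - \<phi> a) / (b - a) \<le> (\<phi> c - \<phi> a) / (c - a)"
proof -
  define t where "t = (b - a) / (c - a)"
  have t: "0 \<le> t" "t \<le> 1" "(c - a) * t = b - a"
    using assms by (auto simp: t_def)
  have "(1 - t) * a + t * c = a + (c - a) * t" by (simp add: algebra_simps)
  then have b: "(1 - t) * a + t * c = b" using t by simp
  have "\<phi> ((1 - t) * a + t * c) \<le> (1 - t) * \<phi> a + t * \<phi> c"
    using convex_onD[OF convex_phi t(1,2), of a c] assms unfolding real_scaleR_def by auto
  then have "\<phi> b \<le> (1 - t) * \<phi> a + t * \<phi> c" unfolding b .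
  then have "(c - a) * \<phi> b \<le> (c - a) * ((1 - t) * \<phi> a + t * \<phi> c)"
    using assms by (intro mult_left_mono) auto
  also have "\<dots> = (c - a) * \<phi> a + ((c - a) * t) * (\<phi> c - \<phi> a)"
    by (simp add: algebra_simps)
  also have "(c - a) * t = b - a" by (rule t)
  finally have *: "(c - a) * \<phi> b \<le> (c - a) * \<phi> a + (b - a) * (\<phi> c - \<phi> a)" .
  show "(\<phi> b - \<phi> a) / (b - a) \<le> (\<phi> c - \<phi> b) / (c - b)"
    and "(\<phi> b - \<phi> a) / (b - a) \<le> (\<phi> c - \<phi> a) / (c - a)"
    using * assms by (auto simp: field_simps)
qed

lemma slopes_bdd_below: "0 \<le> a \<Longrightarrow> bdd_below ((\<lambda>b. (\<phi> b - \<phi> a) / (b - a)) ` {a<..})"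
  by (rule bdd_belowI[of _ 0]) (auto intro!: divide_nonneg_nonneg phi_mono)

lemma right_slope_bounds:
  assumes "0 \<le> a" "a < b"
  shows "right_slope \<phi> a * (b - a) \<le> \<phi> b - \<phi> a" "\<phi> b - \<phi> a \<le> right_slope \<phi> b * (b - a)"
proof -
  have "right_slope \<phi> a \<le> (\<phi> b - \<phi> a) / (b - a)"
    unfolding right_slope_def using assms by (intro cINF_lower slopes_bdd_below) auto
  then show "right_slope \<phi> a * (b - a) \<le> \<phi> b - \<phi> a"
    using assms by (simp add: field_simps)
  have "(\<phi> b - \<phi> a) / (b - a) \<le> right_slope \<phi> b"
    unfolding right_slope_def using assms by (intro cINF_greatest slopes_le) auto
  then show "\<phi> b - \<phi> a \<le> right_slope \<phi> b * (b - a)"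
    using assms by (simp add: field_simps)
qed

lemma right_slope_mono: "0 \<le> a \<Longrightarrow> a \<le> b \<Longrightarrow> right_slope \<phi> a \<le> right_slope \<phi> b"
proof (cases "a = b")
  case False
  assume "0 \<le> a" "a \<le> b"
  with False have ab: "0 \<le> a" "a < b" by auto
  have "right_slope \<phi> a * (b - a) \<le> right_slope \<phi> b * (b - a)"
    using right_slope_bounds[OF ab] by linarith
  then show ?thesis using ab by (simp add: mult_le_cancel_right)
qed auto

lemma phi_superlinear: "\<exists>u>0. \<forall>v\<ge>u. K * v < \<phi> v"
proof -
  have "eventually (\<lambda>u. K < \<phi> u / u) at_top"
    using N_function unfolding N_function_at_infinity_def filterlim_at_top_dense by blast
  then obtain N where N: "\<And>u. N \<le> u \<Longrightarrow> K < \<phi> u / u"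
    by (auto simp: eventually_at_top_linorder)
  have "K * v < \<phi> v" if "max N 1 \<le> v" for v
    using N[of v] that by (simp add: field_simps)
  then show ?thesis by (intro exI[of _ "max N 1"]) auto
qed

lemma right_slope_unbounded: "\<exists>a\<ge>0. r < right_slope \<phi> a"
proof -
  obtain u where u: "0 < u" "r * u < \<phi> u" using phi_superlinear[of r] by auto
  have "\<phi> u \<le> right_slope \<phi> u * u" using right_slope_bounds(2)[of 0 u] u by simp
  with u have "r * u < right_slope \<phi> u * u" by linarith
  then show ?thesis using u by (intro exI[of _ u]) (auto simp: mult_less_cancel_right)
qed

lemma slope_inverse_nonneg: "0 \<le> slope_inverse \<phi> r"
  unfolding slope_inverse_def using right_slope_unbounded[of r] by (intro cInf_greatest) auto

lemma slope_inverse_le: "0 \<le> a \<Longrightarrow> r < right_slope \<phi> a \<Longrightarrow> slope_inverse \<phi> r \<le> a"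
  unfolding slope_inverse_def by (intro cInf_lower bdd_belowI[of _ 0]) auto

lemma slope_inverse_lessD:
  assumes "slope_inverse \<phi> r < b" shows "r \<le> right_slope \<phi> b"
proof -
  obtain a where a: "0 \<le> a" "r < right_slope \<phi> a" "a < b"
    using assms right_slope_unbounded[of r] unfolding slope_inverse_def
    by (subst (asm) cInf_less_iff) (auto intro: bdd_belowI[of _ 0])
  with right_slope_mono[of a b] show ?thesis by linarith
qed

lemma slope_inverse_mono: "mono (slope_inverse \<phi>)"
proof (rule monoI)
  fix r r' :: real assume "r \<le> r'"
  show "slope_inverse \<phi> r \<le> slope_inverse \<phi> r'"
    unfolding slope_inverse_def[of _ r'] using right_slope_unbounded[of r'] \<open>r \<le> r'\<close>
    by (intro cInf_greatest) (auto intro!: slope_inverse_le)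
qed

lemma slope_inverse_measurable [measurable]: "slope_inverse \<phi> \<in> borel_measurable borel"
  by (rule borel_measurable_mono[OF slope_inverse_mono])

text \<open>Both sides measure the region under the graph of the right slope over [0, x], the
  right-hand one by horizontal sections. Passing from \<open>a\<close> to \<open>b\<close> adds the
  full \<open>b - a\<close> for \<open>r\<close> below the slope at \<open>a\<close> and nothing for
  \<open>r\<close> above the slope at \<open>b\<close>; these are the increment bounds that \<phi>
  satisfies too.\<close>

lemma phi_eq_integral:
  assumes "0 \<le> x"
  shows "ennreal (\<phi> x) = perspective (slope_inverse \<phi>) (ennreal x) 1"
proof -
  define F where "F b = perspective (slope_inverse \<phi>) (ennreal b) 1" for b
  let ?p = "right_slope \<phi>" and ?s = "slope_inverse \<phi>"
  have p0: "0 \<le> ?p a" if "0 \<le> a" for a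
    unfolding right_slope_def using that
    by (intro cINF_greatest divide_nonneg_nonneg) (auto intro!: phi_mono)
  have lower: "ennreal (?p a * (b - a)) + F a \<le> F b"
    and upper: "F b \<le> ennreal (?p b * (b - a)) + F a" if ab: "0 \<le> a" "a < b" for a b
  proof -
    \<comment> \<open>The half-open interval serves the lower bound, the closed one in
      \<open>eq'\<close> the upper bound: \<open>slope_inverse_le\<close> needs \<open>r\<close>
      strictly below the slope, whereas \<open>slope_inverse_lessD\<close> excludes only
      \<open>r\<close> strictly above it.\<close>
    have eq: "ennreal (?p c * (b - a)) + F a =
        (\<integral>\<^sup>+r. ennreal (b - a) * indicator {0..<?p c} r + (ennreal a - ennreal (?s r * 1)) * indicator {0..} r \<partial>lborel)"
      if "0 \<le> c" for c
      unfolding F_def perspective_def using p0[OF that] ab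
      by (subst nn_integral_add) (auto simp: nn_integral_cmult_indicator ennreal_mult mult.commute)
    have eq': "ennreal (?p c * (b - a)) + F a =
        (\<integral>\<^sup>+r. ennreal (b - a) * indicator {0..?p c} r + (ennreal a - ennreal (?s r * 1)) * indicator {0..} r \<partial>lborel)"
      if "0 \<le> c" for c
      unfolding F_def perspective_def using p0[OF that] ab
      by (subst nn_integral_add) (auto simp: nn_integral_cmult_indicator ennreal_mult mult.commute)
    show "ennreal (?p a * (b - a)) + F a \<le> F b"
      unfolding eq[OF ab(1)] unfolding F_def perspective_def
    proof (rule nn_integral_mono)
      fix r
      show "ennreal (b - a) * indicator {0..<?p a} r + (ennreal a - ennreal (?s r * 1)) * indicator {0..} r
         \<le> (ennreal b - ennreal (?s r * 1)) * indicator {0..} r"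
      proof (cases "0 \<le> r \<and> r < ?p a")
        case True
        then have "?s r \<le> a" using ab slope_inverse_le by auto
        then show ?thesis using True ab slope_inverse_nonneg[of r]
          by (simp add: ennreal_minus flip: ennreal_plus)
      next
        case False
        then show ?thesis using ab
          by (auto simp: indicator_def intro!: ennreal_minus_mono ennreal_leI)
      qed
    qed
    have "0 \<le> b" using ab by simp
    show "F b \<le> ennreal (?p b * (b - a)) + F a"
      unfolding eq'[OF \<open>0 \<le> b\<close>] unfolding F_def perspective_def
    proof (rule nn_integral_mono)
      fix r
      show "(ennreal b - ennreal (?s r * 1)) * indicator {0..} r \<le>
        ennreal (b - a) * indicator {0..?p b} r + (ennreal a - ennreal (?s r * 1)) * indicator {0..} r"
      proof (cases "0 \<le> r \<and> r \<le> ?p b")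
        case True
        have "ennreal (b - ?s r) \<le> ennreal (b - a) + ennreal (a - ?s r)"
          using ab by (cases "a \<le> ?s r") (auto simp: ennreal_neg intro!: ennreal_leI simp flip: ennreal_plus)
        then show ?thesis using True ab slope_inverse_nonneg[of r]
          by (simp add: ennreal_minus)
      next
        case False
        then have "r < 0 \<or> b \<le> ?s r" using slope_inverse_lessD[of r b] by auto
        then show ?thesis using False slope_inverse_nonneg[of r] ab
          by (auto simp: indicator_def ennreal_minus ennreal_neg)
      qed
    qed
  qed
  have F0: "F 0 = 0" by (simp add: F_def)
  have fin: "F b < \<infinity>" if "0 \<le> b" for b
    using upper[of 0 b] that F0 by (cases "b = 0") (auto intro: order.strict_trans1)
  have "enn2real (F x) = \<phi> x"
  proof (rule increment_bounds_unique[where p = ?p and F = "\<lambda>x. enn2real (F x)" and G = \<phi>])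
    fix a b :: real assume ab: "0 \<le> a" "a < b"
    obtain c d where cd: "F a = ennreal c" "F b = ennreal d" "0 \<le> c" "0 \<le> d"
      using fin[of a] fin[of b] ab by (cases "F a"; cases "F b") auto
    have "0 \<le> ?p a * (b - a)" "0 \<le> ?p b * (b - a)"
      using p0[of a] p0[of b] ab by auto
    then show "?p a * (b - a) \<le> enn2real (F b) - enn2real (F a) \<and>
        enn2real (F b) - enn2real (F a) \<le> ?p b * (b - a)"
      using lower[OF ab] upper[OF ab] cd by (simp flip: ennreal_plus)
  qed (use assms right_slope_bounds F0 in auto)
  then show ?thesis using fin[OF assms] assms unfolding F_def
    by (metis ennreal_enn2real infinity_ennreal_def)
qed

lemma perspective_eq:
  assumes "0 \<le> x" "0 < y"
  shows "perspective (slope_inverse \<phi>) (ennreal x) y = ennreal (y * \<phi> (x / y))"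
proof -
  have "perspective (slope_inverse \<phi>) (ennreal y * ennreal (x / y)) (y * 1) =
      ennreal y * perspective (slope_inverse \<phi>) (ennreal (x / y)) 1"
    using assms slope_inverse_nonneg by (intro perspective_scale) auto
  also have "perspective (slope_inverse \<phi>) (ennreal (x / y)) 1 = ennreal (\<phi> (x / y))"
    using assms by (intro phi_eq_integral[symmetric]) auto
  also have "ennreal y * \<dots> = ennreal (y * \<phi> (x / y))"
    using assms phi_nonneg[of "x / y"] by (simp add: ennreal_mult)
  finally show ?thesis using assms by (simp flip: ennreal_mult)
qed

lemma perspective_top: "perspective (slope_inverse \<phi>) \<infinity> y = \<infinity>"
  by (simp add: perspective_def nn_integral_cmult_indicator emeasure_lborel_Ici ennreal_mult_top)

lemma Orlicz_ext_perspective: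
  assumes "0 < y"
  shows "Orlicz_ext \<phi> (x / ennreal y) * ennreal y = perspective (slope_inverse \<phi>) x y"
proof (cases x)
  case (real r)
  then have "x / ennreal y = ennreal (r / y)" using assms by (simp add: divide_ennreal)
  then show ?thesis
    using assms real phi_nonneg[of "r / y"]
    by (simp add: Orlicz_ext_def perspective_eq ennreal_mult mult.commute)
next
  case top
  then show ?thesis using assms perspective_top[of y]
    by (simp add: Orlicz_ext_def ennreal_top_divide ennreal_top_mult)
qed

end

section \<open>Rearrangements and distribution functions\<close>

lemma I_of_nonneg: "t \<in> I_of \<gamma> \<Longrightarrow> 0 \<le> t"
  by (simp add: I_of_def)

lemma I_of_downward: "t \<in> I_of \<gamma> \<Longrightarrow> 0 \<le> s \<Longrightarrow> s \<le> t \<Longrightarrow> s \<in> I_of \<gamma>"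
  by (auto simp: I_of_def intro: order.strict_trans1[of "ereal s" "ereal t"])

text \<open>In this form finite and infinite \<gamma> need no separate treatment later.\<close>

lemma mem_I_of_iff:
  assumes "0 \<le> t"
  shows "t \<in> I_of \<gamma> \<longleftrightarrow> ennreal t < \<mu> (I_of \<gamma>)"
proof
  assume "t \<in> I_of \<gamma>"
  then obtain q where q: "ereal t < q" "q < \<gamma>"
    using dense[of "ereal t" \<gamma>] by (auto simp: I_of_def)
  then obtain r where r: "q = ereal r" by (cases q) auto
  have "ennreal t < ennreal r" using q r assms by (simp add: ennreal_less_iff)
  also have "ennreal r = \<mu> {0..r}" using q r assms by simp
  also have "\<dots> \<le> \<mu> (I_of \<gamma>)"
    using q r by (intro emeasure_mono I_of_sets) (auto simp: I_of_def intro: order.strict_trans1[of _ "ereal r"])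
  finally show "ennreal t < \<mu> (I_of \<gamma>)" .
next
  assume *: "ennreal t < \<mu> (I_of \<gamma>)"
  show "t \<in> I_of \<gamma>"
  proof (rule ccontr)
    assume "t \<notin> I_of \<gamma>"
    then have "I_of \<gamma> \<subseteq> {0..t}"
      using assms I_of_downward[of _ \<gamma> t] I_of_nonneg[of _ \<gamma>] by (fastforce simp: not_le)
    then have "\<mu> (I_of \<gamma>) \<le> \<mu> {0..t}"
      by (intro emeasure_mono) auto
    with * assms show False by simp
  qed
qed

section \<open>Distribution functions and decreasing rearrangements\<close>

lemma level_set_measurable:
  fixes f :: "real \<Rightarrow> real"
  assumes [measurable]: "f \<in> \<M>"
  shows "level \<gamma> f l \<in> \<L>" "{t \<in> I_of \<gamma>. \<bar>f t\<bar> = l} \<in> \<L>"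
proof -
  have "{t \<in> space lebesgue. l < \<bar>f t\<bar>} \<in> \<L>" by measurable
  moreover have "{t \<in> space lebesgue. \<bar>f t\<bar> = l} \<in> \<L>" by measurable
  moreover have "level \<gamma> f l = I_of \<gamma> \<inter> {t \<in> space lebesgue. l < \<bar>f t\<bar>}"
    "{t \<in> I_of \<gamma>. \<bar>f t\<bar> = l} = I_of \<gamma> \<inter> {t \<in> space lebesgue. \<bar>f t\<bar> = l}" by auto
  ultimately show "level \<gamma> f l \<in> \<L>" "{t \<in> I_of \<gamma>. \<bar>f t\<bar> = l} \<in> \<L>"
    using I_of_sets[of \<gamma>] by auto
qed

lemma distribution_function_antimono:
  assumes "f \<in> \<M>" "l \<le> l'"
  shows "\<D> \<gamma> f l' \<le> \<D> \<gamma> f l"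
  unfolding distribution_function_def using assms
  by (intro emeasure_mono level_set_measurable) auto

lemma distribution_function_le_I: "\<D> \<gamma> f l \<le> \<mu> (I_of \<gamma>)"
  unfolding distribution_function_def by (intro emeasure_mono I_of_sets) auto

text \<open>A Galois connection. The direction from right to left is right continuity of the
  distribution function, obtained by exhausting the level set at \<open>l\<close> from the levels
  \<open>l + 1 / real (Suc n)\<close>.\<close>

lemma less_rearrangement_iff:
  assumes f: "f \<in> \<M>" and "0 \<le> l"
  shows "ennreal l < rearrangement \<gamma> f t \<longleftrightarrow> ennreal t < \<D> \<gamma> f l"
proof
  assume *: "ennreal l < rearrangement \<gamma> f t"
  show "ennreal t < \<D> \<gamma> f l"
  proof (rule ccontr)
    assume "\<not> ennreal t < \<D> \<gamma> f l"
    then have le: "\<D> \<gamma> f l \<le> ennreal t" by simp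
    obtain q where q: "ennreal l < q" "q < rearrangement \<gamma> f t" using dense[OF *] by blast
    then obtain r where r: "q = ennreal r" "0 \<le> r" by (cases q) auto
    then have "l < r" using q \<open>0 \<le> l\<close> by (simp add: ennreal_less_iff)
    then have "rearrangement \<gamma> f t \<le> ennreal r"
      unfolding rearrangement_def using le \<open>0 \<le> l\<close> distribution_function_antimono[OF f, of l r \<gamma>]
      by (intro Inf_lower) (auto intro!: exI[of _ r] intro: order_trans)
    with q r show False by simp
  qed
next
  assume *: "ennreal t < \<D> \<gamma> f l"
  define A where "A n = level \<gamma> f (l + 1 / real (Suc n))" for n
  have "incseq A"
  proof (rule incseq_SucI)
    fix n
    have "1 / real (Suc (Suc n)) \<le> 1 / real (Suc n)" by (simp add: frac_le)
    then show "A n \<subseteq> A (Suc n)" unfolding A_def by auto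
  qed
  then have "(SUP n. \<mu> (A n)) = \<mu> (\<Union>n. A n)"
    by (intro SUP_emeasure_incseq) (unfold A_def, use level_set_measurable(1)[OF f] in blast)
  also have "(\<Union>n. A n) = level \<gamma> f l"
  proof (safe)
    fix x assume x: "x \<in> I_of \<gamma>" "l < \<bar>f x\<bar>"
    then obtain n where "1 / real (Suc n) < \<bar>f x\<bar> - l"
      using nat_approx_posE[of "\<bar>f x\<bar> - l"] by auto
    then show "x \<in> (\<Union>n. A n)" using x by (auto simp: A_def intro!: exI[of _ n])
  next
    fix x n assume "x \<in> A n"
    moreover have "0 < 1 / real (Suc n)" by simp
    ultimately show "x \<in> I_of \<gamma>" "l < \<bar>f x\<bar>"
      unfolding A_def mem_Collect_eq by linarith+
  qed
  finally have "ennreal t < (SUP n. \<mu> (A n))"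
    using * by (simp add: distribution_function_def)
  then obtain n where n: "ennreal t < \<mu> (A n)" by (auto simp: less_SUP_iff)
  have "ennreal l < ennreal (l + 1 / real (Suc n))"
    using \<open>0 \<le> l\<close> by (simp add: ennreal_less_iff)
  also have "\<dots> \<le> rearrangement \<gamma> f t"
    unfolding rearrangement_def
  proof (rule Inf_greatest, safe)
    fix l' :: real assume l': "0 < l'" "\<D> \<gamma> f l' \<le> ennreal t"
    show "ennreal (l + 1 / real (Suc n)) \<le> ennreal l'"
    proof (rule ennreal_leI, rule ccontr)
      assume "\<not> l + 1 / real (Suc n) \<le> l'"
      then have "\<D> \<gamma> f (l + 1 / real (Suc n)) \<le> \<D> \<gamma> f l'"
        by (intro distribution_function_antimono f) simp
      with l' n show False by (simp add: A_def distribution_function_def)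
    qed
  qed
  finally show "ennreal l < rearrangement \<gamma> f t" .
qed

lemma rearrangement_measurable:
  assumes f: "f \<in> \<M>" and S: "S \<in> \<L>"
  shows "(\<lambda>t. rearrangement \<gamma> f t * indicator S t) \<in> \<M>"
proof (rule borel_measurableI_greater)
  fix y :: ennreal
  show "{t \<in> space lebesgue. y < rearrangement \<gamma> f t * indicator S t} \<in> \<L>"
  proof (cases y)
    case (real l)
    have "{t. ennreal t < \<D> \<gamma> f l} \<in> sets borel" by measurable
    then have "S \<inter> {t. ennreal t < \<D> \<gamma> f l} \<in> \<L>"
      using S by auto
    also have "S \<inter> {t. ennreal t < \<D> \<gamma> f l} =
        {t \<in> space lebesgue. y < rearrangement \<gamma> f t * indicator S t}"
      using real by (auto simp: indicator_def less_rearrangement_iff[OF f])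
    finally show ?thesis .
  qed simp
qed

section \<open>Integrals of rearrangements over initial intervals\<close>

lemma emeasure_lebesgue_interval_diff:
  fixes c :: real
  assumes "0 \<le> c"
  shows "\<mu> {l. c \<le> l \<and> ennreal l < x} = x - ennreal c"
    and "\<mu> {l. c < l \<and> ennreal l < x} = x - ennreal c"
proof -
  have "{l. c \<le> l \<and> ennreal l < x} \<in> sets borel" "{l. c < l \<and> ennreal l < x} \<in> sets borel"
    by measurable
  then show "\<mu> {l. c \<le> l \<and> ennreal l < x} = x - ennreal c"
    and "\<mu> {l. c < l \<and> ennreal l < x} = x - ennreal c"
    using emeasure_interval_diff[OF assms, of x] by (simp_all add: emeasure_completion)
qed

text \<open>The layer-cake form of \<open>\<integral>\<^sub>0\<^sup>T f\<^sup>*\<close>, which also makes sense for \<open>T = \<infinity>\<close>.\<close>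

definition rearrangement_integral :: "ereal \<Rightarrow> (real \<Rightarrow> real) \<Rightarrow> ennreal \<Rightarrow> ennreal" where
  "rearrangement_integral \<gamma> f T = (\<integral>\<^sup>+l\<in>{0..}. min T (\<D> \<gamma> f l) \<partial>lborel)"

lemma rearrangement_integral_mono: "S \<le> T \<Longrightarrow> rearrangement_integral \<gamma> f S \<le> rearrangement_integral \<gamma> f T"
  unfolding rearrangement_integral_def
  by (intro nn_integral_mono mult_right_mono) (auto intro: min.coboundedI1)

lemma nn_integral_rearrangement:
  assumes f: "f \<in> \<M>" and "0 \<le> T"
  shows "(\<integral>\<^sup>+ s\<in>{0..T}. rearrangement \<gamma> f s \<partial>lebesgue) = rearrangement_integral \<gamma> f (ennreal T)"
proof -
  have "(\<integral>\<^sup>+ s\<in>{0..T}. rearrangement \<gamma> f s \<partial>lebesgue) =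
     (\<integral>\<^sup>+l\<in>{0..}. \<mu> {s. ennreal l < rearrangement \<gamma> f s * indicator {0..T} s} \<partial>lborel)"
    by (intro nn_integral_layers rearrangement_measurable f) auto
  also have "\<dots> = rearrangement_integral \<gamma> f (ennreal T)"
    unfolding rearrangement_integral_def
  proof (rule nn_integral_cong)
    fix l :: real
    show "\<mu> {s. ennreal l < rearrangement \<gamma> f s * indicator {0..T} s} * indicator {0..} l =
        min (ennreal T) (\<D> \<gamma> f l) * indicator {0..} l"
    proof (cases "0 \<le> l")
      case True
      let ?D = "\<D> \<gamma> f l"
      have eq: "{s. ennreal l < rearrangement \<gamma> f s * indicator {0..T} s} = {s \<in> {0..T}. ennreal s < ?D}"
        using True by (auto simp: indicator_def less_rearrangement_iff[OF f])
      have "\<mu> {s \<in> {0..T}. ennreal s < ?D} = min (ennreal T) ?D"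
      proof (cases "ennreal T < ?D")
        case True
        then have "{s \<in> {0..T}. ennreal s < ?D} = {0..T}"
          by (auto intro: le_less_trans[OF ennreal_leI])
        moreover have "min (ennreal T) ?D = ennreal T"
          using True by (intro min_absorb1 less_imp_le)
        ultimately show ?thesis using \<open>0 \<le> T\<close> by simp
      next
        case False
        then have "{s \<in> {0..T}. ennreal s < ?D} = {s. 0 \<le> s \<and> ennreal s < ?D}"
        proof (intro Collect_cong iffI conjI)
          fix s assume "0 \<le> s \<and> ennreal s < ?D"
          then have "0 \<le> s" "ennreal s < ennreal T" using False by (auto intro: order.strict_trans2)
          then show "s \<in> {0..T}" by (simp add: ennreal_less_iff)
        qed auto
        moreover have "min (ennreal T) ?D = ?D"
          using False by (intro min_absorb2) simp
        ultimately show ?thesis using emeasure_lebesgue_interval_diff(1)[of 0 ?D] by simp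
      qed
      then show ?thesis by (simp add: eq)
    qed simp
  qed
  finally show ?thesis .
qed

lemma nn_integral_set_layers:
  fixes u :: "real \<Rightarrow> real"
  assumes [measurable]: "u \<in> \<M>" "E \<in> \<L>"
  shows "nint E u =
           (\<integral>\<^sup>+l\<in>{0..}. \<mu> {x \<in> E. l < u x} \<partial>lborel)"
proof -
  have "nint E u =
     (\<integral>\<^sup>+l\<in>{0..}. \<mu> {x. ennreal l < ennreal (u x) * indicator E x} \<partial>lborel)"
    by (intro nn_integral_layers) measurable
  also have "\<dots> = (\<integral>\<^sup>+l\<in>{0..}. \<mu> {x \<in> E. l < u x} \<partial>lborel)"
  proof (rule nn_integral_cong)
    fix l :: real
    show "\<mu> {x. ennreal l < ennreal (u x) * indicator E x} * indicator {0..} l =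
      \<mu> {x \<in> E. l < u x} * indicator {0..} l"
    proof (cases "0 \<le> l")
      case True
      then have "{x. ennreal l < ennreal (u x) * indicator E x} = {x \<in> E. l < u x}"
        by (auto simp: indicator_def ennreal_less_iff)
      then show ?thesis by simp
    qed simp
  qed
  finally show ?thesis .
qed

text \<open>One half of the Hardy-Littlewood principle: a level set inside \<open>E\<close> is no
  larger than \<open>E\<close> and no larger than the full level set.\<close>

lemma nn_integral_le_rearrangement_integral:
  assumes [measurable]: "u \<in> \<M>" "E \<in> \<L>" and E: "E \<subseteq> I_of \<gamma>"
  shows "nint E u \<le> rearrangement_integral \<gamma> u (\<mu> E)"
proof -
  have "\<mu> {x \<in> E. l < u x} \<le> min (\<mu> E) (\<D> \<gamma> u l)" for l
  proof (rule min.boundedI)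
    show "\<mu> {x \<in> E. l < u x} \<le> \<mu> E"
      by (rule emeasure_mono) auto
    show "\<mu> {x \<in> E. l < u x} \<le> \<D> \<gamma> u l"
      unfolding distribution_function_def
      by (rule emeasure_mono[OF _ level_set_measurable(1)[OF assms(1)]]) (use E in auto)
  qed
  then show ?thesis
    unfolding rearrangement_integral_def nn_integral_set_layers[OF assms(1,2)]
    by (intro nn_integral_mono mult_right_mono zero_le) blast
qed

text \<open>The measure of \<open>S\<close> to the left of \<open>x\<close> is increasing and
  1-Lipschitz in \<open>x\<close>, so it attains the value \<open>r\<close> as soon as it exceeds it
  somewhere. This serves both to break ties on plateaus and to find sets of prescribed
  measure.\<close>

lemma emeasure_initial_part:
  fixes S :: "real set" and r :: ennreal
  assumes S [measurable]: "S \<in> \<L>" and nn: "S \<subseteq> {0..}" and r: "r < \<infinity>"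
  defines "A \<equiv> {x \<in> S. \<mu> (S \<inter> {0..x}) \<le> r}"
  shows "A \<in> \<L>" "\<mu> A = min r (\<mu> S)"
proof -
  define G where "G x = measure lebesgue (S \<inter> {0..x})" for x
  have Sx: "S \<inter> {0..x} \<in> \<L>" for x using S by (intro sets.Int) auto
  have fin: "\<mu> (S \<inter> {0..x}) < \<infinity>" for x
    by (rule order.strict_trans1[OF emeasure_mono[of _ "{0..x}"]]) (auto simp: emeasure_lborel_Icc_eq)
  then have em: "\<mu> (S \<inter> {0..x}) = ennreal (G x)" for x
    unfolding G_def using fin[of x] by (intro emeasure_eq_ennreal_measure) (simp add: less_top)
  have G_mono: "G x \<le> G y" if "x \<le> y" for x y
  proof -
    have "\<mu> (S \<inter> {0..x}) \<le> \<mu> (S \<inter> {0..y})"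
      using that by (intro emeasure_mono Sx) auto
    moreover have "0 \<le> G y" by (simp add: G_def)
    ultimately show ?thesis unfolding em by (simp add: ennreal_le_iff)
  qed
  have lip: "G y \<le> G x + (y - x)" if "x \<le> y" for x y
  proof -
    have "\<mu> (S \<inter> {0..y}) \<le> \<mu> ((S \<inter> {0..x}) \<union> {x..y})"
      by (intro emeasure_mono sets.Un Sx) auto
    also have "\<dots> \<le> \<mu> (S \<inter> {0..x}) + \<mu> {x..y}"
      by (intro emeasure_subadditive Sx) auto
    finally have "ennreal (G y) \<le> ennreal (G x) + ennreal (y - x)"
      unfolding em using that by simp
    then show ?thesis using that by (simp add: G_def flip: ennreal_plus)
  qed
  have contG: "continuous_on UNIV G"
  proof (rule continuous_onI)
    fix x e :: real assume "0 < e"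
    have "dist (G x') (G x) \<le> e" if "dist x' x < e" for x'
      using lip[of x x'] lip[of x' x] G_mono[of x x'] G_mono[of x' x] that
      by (cases "x \<le> x'") (auto simp: dist_real_def)
    then show "\<exists>d>0. \<forall>x'\<in>UNIV. dist x' x < d \<longrightarrow> dist (G x') (G x) \<le> e"
      using \<open>0 < e\<close> by auto
  qed
  have G0: "G x = 0" if "x \<le> 0" for x
  proof -
    have "\<mu> (S \<inter> {0..x}) \<le> \<mu> {0::real}"
      using that by (intro emeasure_mono) auto
    then show ?thesis by (simp add: em G_def)
  qed
  obtain \<rho> where \<rho>: "r = ennreal \<rho>" "0 \<le> \<rho>" using r by (cases r) auto
  have A: "A = {x \<in> S. G x \<le> \<rho>}"
    unfolding A_def em \<rho> using \<rho> by simp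
  have "A \<in> \<L> \<and> \<mu> A = min r (\<mu> S)"
  proof (cases "\<exists>x. \<rho> < G x")
    case False
    then have AS: "A = S" by (auto simp: A not_less)
    have "(SUP n. \<mu> (S \<inter> {0..real n})) = \<mu> (\<Union>n. S \<inter> {0..real n})"
      by (intro SUP_emeasure_incseq) (use Sx in \<open>auto simp: incseq_def\<close>)
    also have "(\<Union>n. S \<inter> {0..real n}) = S"
      using subsetD[OF nn] real_arch_simple by auto
    finally have "\<mu> S \<le> r"
      using False by (metis (mono_tags, lifting) SUP_least em \<rho> not_le ennreal_leI)
    then show ?thesis using AS S by (simp add: min_def)
  next
    case True
    then obtain y where y: "\<rho> < G y" by blast
    have "0 \<le> y" using y \<rho> G0[of y] by (cases "0 \<le> y") auto
    \<comment> \<open>Its largest element \<open>z\<close> is the last point whose left mass is at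
      most \<open>\<rho>\<close>; by the Lipschitz bound the mass there is exactly
      \<open>\<rho>\<close>.\<close>
    define X where "X = {x \<in> {0..y}. G x \<le> \<rho>}"
    have "compact X"
    proof -
      have "closed (G -` {..\<rho>} \<inter> {0..y})"
        using contG by (intro closed_Int closed_vimage) auto
      moreover have "G -` {..\<rho>} \<inter> {0..y} = X" by (auto simp: X_def)
      ultimately have "closed X" by simp
      moreover have "bounded X" by (rule bounded_subset[of "{0..y}"]) (auto simp: X_def)
      ultimately show ?thesis by (simp add: compact_eq_bounded_closed)
    qed
    moreover have "0 \<in> X" using \<open>0 \<le> y\<close> G0[of 0] \<rho> by (simp add: X_def)
    ultimately obtain z where z: "z \<in> X" "\<And>x. x \<in> X \<Longrightarrow> x \<le> z"
      using compact_attains_sup[of X] by auto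
    have "z < y" using z y by (cases "z = y") (auto simp: X_def)
    have "G z = \<rho>"
    proof (rule ccontr)
      assume "G z \<noteq> \<rho>"
      then have "G z < \<rho>" using z by (simp add: X_def)
      then have "min y (z + (\<rho> - G z)) \<in> X"
        using lip[of z "min y (z + (\<rho> - G z))"] z \<open>z < y\<close> by (auto simp: X_def min_def split: if_splits)
      from z(2)[OF this] \<open>G z < \<rho>\<close> \<open>z < y\<close> show False by (auto simp: min_def split: if_splits)
    qed
    have "A = S \<inter> {0..z}"
    proof (safe)
      fix x assume "x \<in> A"
      then have x: "x \<in> S" "G x \<le> \<rho>" "0 \<le> x" using nn by (auto simp: A)
      have "x \<le> y" using G_mono[of y x] x y by linarith
      then show "x \<in> {0..z}" using z(2)[of x] x by (simp add: X_def)
    next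
      fix x assume "x \<in> S" "x \<in> {0..z}"
      then show "x \<in> A" using G_mono[of x z] \<open>G z = \<rho>\<close> by (simp add: A)
    qed (simp add: A)
    moreover have "r \<le> \<mu> S"
      using emeasure_mono[of "S \<inter> {0..z}" S lebesgue] by (simp add: em \<open>G z = \<rho>\<close> \<rho>)
    ultimately show ?thesis using Sx[of z] by (simp only: em \<open>G z = \<rho>\<close> \<rho> min_absorb1)
  qed
  then show "A \<in> \<L>" "\<mu> A = min r (\<mu> S)" by auto
qed

text \<open>A weight is unconstrained at 0 and outside the interval. Setting it to zero there makes
  it measurable and nonnegative on the whole line without changing its rearrangement.\<close>

definition cut :: "ereal \<Rightarrow> (real \<Rightarrow> real) \<Rightarrow> real \<Rightarrow> real" where
  "cut \<gamma> v t = (if t \<in> I_of \<gamma> - {0} then v t else 0)"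

lemma I_of_borel: "I_of \<gamma> \<in> sets borel"
proof -
  have "I_of \<gamma> = {0..} \<inter> {t. ereal t < \<gamma>}" by (auto simp: I_of_def)
  moreover have "{t. ereal t < \<gamma>} \<in> sets borel" by measurable
  ultimately show ?thesis by auto
qed

lemma cut_nonneg: "positive_decreasing \<gamma> v \<Longrightarrow> 0 \<le> cut \<gamma> v t"
  by (auto simp: cut_def positive_decreasing_def intro: less_imp_le)

lemma cut_borel_measurable:
  assumes "positive_decreasing \<gamma> v"
  shows "cut \<gamma> v \<in> borel_measurable borel"
proof -
  let ?A = "I_of \<gamma> - {0}"
  have A: "?A \<in> sets borel" using I_of_borel by auto
  have "mono_on ?A (\<lambda>t. - v t)"
    using assms by (auto simp: positive_decreasing_def monotone_on_def)
  then have "(\<lambda>t. - v t) \<in> borel_measurable (restrict_space borel ?A)"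
    by (rule borel_measurable_mono_on_fnc)
  then have "(\<lambda>t. indicator ?A t *\<^sub>R - v t) \<in> borel_measurable borel"
    using A by (subst (asm) borel_measurable_restrict_space_iff) auto
  then have "(\<lambda>t. - (indicator ?A t *\<^sub>R - v t)) \<in> borel_measurable borel"
    by measurable
  also have "(\<lambda>t. - (indicator ?A t *\<^sub>R - v t)) = cut \<gamma> v"
    by (auto simp: cut_def indicator_def)
  finally show ?thesis .
qed

lemma cut_measurable: "positive_decreasing \<gamma> v \<Longrightarrow> cut \<gamma> v \<in> \<M>"
  by (rule measurable_completion) (simp add: cut_borel_measurable)

lemma distribution_function_cut:
  assumes v: "positive_decreasing \<gamma> v" and "0 \<le> l"
  shows "\<D> \<gamma> (cut \<gamma> v) l = \<D> \<gamma> v l"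
proof -
  let ?A = "{t \<in> I_of \<gamma>. l < \<bar>cut \<gamma> v t\<bar>}" and ?B = "level \<gamma> v l"
  have A: "?A \<in> \<L>" by (rule level_set_measurable cut_measurable v)+
  have "?B = ?A \<or> ?B = ?A \<union> {0}"
    using \<open>0 \<le> l\<close> by (auto simp: cut_def split: if_splits)
  moreover have "\<mu> (?A \<union> {0}) = \<mu> ?A"
    by (rule emeasure_Un_null_set[OF A]) simp
  ultimately show ?thesis unfolding distribution_function_def by auto
qed

lemma rearrangement_cong:
  assumes "\<And>l. 0 < l \<Longrightarrow> \<D> \<gamma> f l = \<D> \<gamma> g l"
  shows "rearrangement \<gamma> f = rearrangement \<gamma> g"
proof
  fix t
  have "{ennreal l | l. 0 < l \<and> \<D> \<gamma> f l \<le> ennreal t} =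
      {ennreal l | l. 0 < l \<and> \<D> \<gamma> g l \<le> ennreal t}"
    using assms by auto
  then show "rearrangement \<gamma> f t = rearrangement \<gamma> g t" by (simp add: rearrangement_def)
qed

lemma rearrangement_cut:
  "positive_decreasing \<gamma> v \<Longrightarrow> rearrangement \<gamma> (cut \<gamma> v) = rearrangement \<gamma> v"
  by (rule rearrangement_cong) (simp add: distribution_function_cut)

lemma submajorized_iff:
  assumes v: "positive_decreasing \<gamma> v" and w: "positive_decreasing \<gamma> w"
  shows "submajorized \<gamma> v w \<longleftrightarrow>
    (\<forall>t>0. rearrangement_integral \<gamma> (cut \<gamma> v) (ennreal t) \<le> rearrangement_integral \<gamma> (cut \<gamma> w) (ennreal t))"
proof -
  have "(\<integral>\<^sup>+ s\<in>{0..t}. rearrangement \<gamma> u s \<partial>lebesgue) = rearrangement_integral \<gamma> (cut \<gamma> u) (ennreal t)"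
    if "positive_decreasing \<gamma> u" "0 < t" for u t
    using nn_integral_rearrangement[OF cut_measurable[OF that(1)], of t \<gamma>] that
    by (simp add: rearrangement_cut)
  then show ?thesis using v w by (simp add: submajorized_def)
qed

text \<open>Up to the point 0 a level set of a decreasing weight is an initial interval whose right
  endpoint may or may not belong to it. Hence a weak inequality in one direction and a strict one in
  the other.\<close>

lemma distribution_function_decreasing:
  assumes v: "positive_decreasing \<gamma> v" and "0 < t" "0 \<le> c"
  shows "t \<in> I_of \<gamma> \<Longrightarrow> c < v t \<Longrightarrow> ennreal t \<le> \<D> \<gamma> (cut \<gamma> v) c"
    and "ennreal t < \<D> \<gamma> (cut \<gamma> v) c \<Longrightarrow> t \<in> I_of \<gamma> \<and> c < v t"
proof -
  have anti: "v t' \<le> v s'" if "s' \<in> I_of \<gamma>" "t' \<in> I_of \<gamma>" "0 < s'" "s' \<le> t'" for s' t'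
    using v that by (auto simp: positive_decreasing_def monotone_on_def)
  {
    assume t: "t \<in> I_of \<gamma>" "c < v t"
    have "{0<..t} \<subseteq> {s \<in> I_of \<gamma>. c < \<bar>cut \<gamma> v s\<bar>}"
    proof
      fix s assume s: "s \<in> {0<..t}"
      then have "s \<in> I_of \<gamma>" using t I_of_downward[of t \<gamma> s] by auto
      then show "s \<in> {s \<in> I_of \<gamma>. c < \<bar>cut \<gamma> v s\<bar>}"
        using s t anti[of s t] by (auto simp: cut_def)
    qed
    then have "\<mu> {0<..t} \<le> \<D> \<gamma> (cut \<gamma> v) c"
      unfolding distribution_function_def
      by (intro emeasure_mono level_set_measurable cut_measurable v)
    then show "ennreal t \<le> \<D> \<gamma> (cut \<gamma> v) c" using \<open>0 < t\<close> by simp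
  }
  assume D: "ennreal t < \<D> \<gamma> (cut \<gamma> v) c"
  also have "\<dots> \<le> \<mu> (I_of \<gamma>)" by (rule distribution_function_le_I)
  finally have t: "t \<in> I_of \<gamma>" using mem_I_of_iff[of t \<gamma>] \<open>0 < t\<close> by simp
  moreover have "c < v t"
  proof (rule ccontr)
    assume "\<not> c < v t"
    have "{s \<in> I_of \<gamma>. c < \<bar>cut \<gamma> v s\<bar>} \<subseteq> {0<..<t}"
    proof
      fix s assume "s \<in> {s \<in> I_of \<gamma>. c < \<bar>cut \<gamma> v s\<bar>}"
      then have s: "s \<in> I_of \<gamma>" "s \<noteq> 0" "c < v s"
        using cut_nonneg[OF v, of s] \<open>0 \<le> c\<close> by (auto simp: cut_def split: if_splits)
      moreover have "0 < s" using I_of_nonneg[OF s(1)] s(2) by simp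
      moreover have "\<not> t \<le> s"
        using anti[OF t s(1) \<open>0 < t\<close>] s(3) \<open>\<not> c < v t\<close> by auto
      ultimately show "s \<in> {0<..<t}" by simp
    qed
    then have "\<D> \<gamma> (cut \<gamma> v) c \<le> \<mu> {0<..<t}"
      unfolding distribution_function_def by (intro emeasure_mono) auto
    with D \<open>0 < t\<close> show False by simp
  qed
  ultimately show "t \<in> I_of \<gamma> \<and> c < v t" ..
qed

text \<open>
  The rank is a measure-preserving map that arranges \<open>\<bar>f\<bar>\<close> in decreasing order (Ryff); ties are
  broken from left to right.  It is infinite where infinitely much mass lies above \<open>\<bar>f x\<bar>\<close>.
\<close>

definition decreasing_rank :: "ereal \<Rightarrow> (real \<Rightarrow> real) \<Rightarrow> real \<Rightarrow> ennreal" where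
  "decreasing_rank \<gamma> f x = \<D> \<gamma> f \<bar>f x\<bar> +
     \<mu> ({y \<in> I_of \<gamma>. \<bar>f y\<bar> = \<bar>f x\<bar>} \<inter> {0..x})"

section \<open>Points of small rank\<close>

abbreviation low_rank :: "ereal \<Rightarrow> (real \<Rightarrow> real) \<Rightarrow> real \<Rightarrow> real set" where
  "low_rank \<gamma> f t \<equiv> {x \<in> I_of \<gamma>. decreasing_rank \<gamma> f x \<le> ennreal t}"

text \<open>Points with \<bar>f\<bar> above \<open>\<zeta>\<close> have rank at most
  \<open>t\<close> and points below it have larger rank. From the plateau at \<open>\<zeta>\<close>
  come the leftmost points, with the mass that is still missing to \<open>t\<close>.\<close>

lemma rank_le_eq:
  assumes f: "f \<in> \<M>" and "0 \<le> t" "0 \<le> \<zeta>"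
    and \<zeta>: "rearrangement \<gamma> f t = ennreal \<zeta>"
  defines "S \<equiv> {y \<in> I_of \<gamma>. \<bar>f y\<bar> = \<zeta>}"
  shows "low_rank \<gamma> f t = level \<gamma> f \<zeta> \<union>
    {x \<in> S. \<mu> (S \<inter> {0..x}) \<le> ennreal t - \<D> \<gamma> f \<zeta>}"
    and "\<D> \<gamma> f \<zeta> \<le> ennreal t"
proof -
  let ?D = "\<D> \<gamma> f"
  show D\<zeta>: "?D \<zeta> \<le> ennreal t"
    using less_rearrangement_iff[OF f \<open>0 \<le> \<zeta>\<close>, of \<gamma> t] \<zeta> by simp
  have 1: "decreasing_rank \<gamma> f x \<le> ennreal t" if "x \<in> I_of \<gamma>" "\<zeta> < \<bar>f x\<bar>" for x
  proof -
    have "decreasing_rank \<gamma> f x = \<mu>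
        ({y \<in> I_of \<gamma>. \<bar>f x\<bar> < \<bar>f y\<bar>} \<union> ({y \<in> I_of \<gamma>. \<bar>f y\<bar> = \<bar>f x\<bar>} \<inter> {0..x}))"
      unfolding decreasing_rank_def distribution_function_def
      by (intro plus_emeasure level_set_measurable f sets.Int) auto
    also have "\<dots> \<le> ?D \<zeta>"
      unfolding distribution_function_def using that
      by (intro emeasure_mono level_set_measurable f) auto
    finally show ?thesis using D\<zeta> by simp
  qed
  have 2: "ennreal t < decreasing_rank \<gamma> f x" if "\<bar>f x\<bar> < \<zeta>" for x
  proof -
    have "ennreal t < ?D \<bar>f x\<bar>"
      using less_rearrangement_iff[OF f, of "\<bar>f x\<bar>" \<gamma> t] \<zeta> that by (simp add: ennreal_less_iff)
    then show ?thesis unfolding decreasing_rank_def by (rule order.strict_trans2) simp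
  qed
  have 3: "decreasing_rank \<gamma> f x \<le> ennreal t \<longleftrightarrow> \<mu> (S \<inter> {0..x}) \<le> ennreal t - ?D \<zeta>"
    if "\<bar>f x\<bar> = \<zeta>" for x
  proof -
    have "?D \<zeta> < \<infinity>" using D\<zeta> by (rule order.strict_trans1) simp
    then show ?thesis
      using D\<zeta> that unfolding decreasing_rank_def S_def ennreal_le_minus_iff
      by (auto simp: add.commute)
  qed
  show "low_rank \<gamma> f t = level \<gamma> f \<zeta> \<union>
    {x \<in> S. \<mu> (S \<inter> {0..x}) \<le> ennreal t - ?D \<zeta>}"
    (is "?L = ?R")
  proof (intro set_eqI)
    fix x
    consider "\<bar>f x\<bar> < \<zeta>" | "\<bar>f x\<bar> = \<zeta>" | "\<zeta> < \<bar>f x\<bar>" by linarith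
    then show "x \<in> ?L \<longleftrightarrow> x \<in> ?R"
      using 1[of x] 2[of x] 3[of x] by cases (auto simp: S_def not_le[symmetric])
  qed
qed

text \<open>The minimum can be smaller than \<open>t\<close>: if \<bar>f\<bar> increases strictly to
  \<open>\<zeta>\<close> on an infinite interval without attaining it, every rank is
  infinite.\<close>

lemma emeasure_rank_le:
  assumes f: "f \<in> \<M>" and "0 \<le> t" "0 \<le> \<zeta>"
    and \<zeta>: "rearrangement \<gamma> f t = ennreal \<zeta>"
  shows "low_rank \<gamma> f t \<in> \<L>"
    and "\<mu> (low_rank \<gamma> f t) =
      min (ennreal t) (\<mu> {x \<in> I_of \<gamma>. \<zeta> \<le> \<bar>f x\<bar>})"
proof -
  define S where "S = {y \<in> I_of \<gamma>. \<bar>f y\<bar> = \<zeta>}"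
  define A where "A = {x \<in> S. \<mu> (S \<inter> {0..x}) \<le> ennreal t - \<D> \<gamma> f \<zeta>}"
  define B where "B = level \<gamma> f \<zeta>"
  have eq: "low_rank \<gamma> f t = B \<union> A"
    and D\<zeta>: "\<D> \<gamma> f \<zeta> \<le> ennreal t"
    using rank_le_eq[OF assms] by (simp_all add: S_def A_def B_def)
  have S: "S \<in> \<L>" "B \<in> \<L>"
    unfolding S_def B_def by (intro level_set_measurable f)+
  have r: "ennreal t - \<D> \<gamma> f \<zeta> < \<infinity>"
    by (simp add: less_top[symmetric])
  have "S \<subseteq> {0..}" by (auto simp: S_def I_of_nonneg)
  note A = emeasure_initial_part[OF S(1) this r, folded A_def]
  show "low_rank \<gamma> f t \<in> \<L>"
    unfolding eq using S A by auto
  have min_add: "c + min x y = min (c + x) (c + y)" for c x y :: ennreal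
    by (cases "x \<le> y") (simp_all add: min_absorb1 min_absorb2 add_left_mono)
  have "\<mu> (B \<union> A) = \<mu> B + \<mu> A"
    using S A by (intro plus_emeasure[symmetric]) (auto simp: A_def S_def B_def)
  also have "\<mu> B = \<D> \<gamma> f \<zeta>"
    by (simp add: B_def distribution_function_def)
  also have "\<dots> + \<mu> A = min (ennreal t) (\<D> \<gamma> f \<zeta> + \<mu> S)"
    unfolding A(2) by (simp only: min_add add_diff_inverse_ennreal[OF D\<zeta>])
  also have "\<D> \<gamma> f \<zeta> + \<mu> S = \<mu> (B \<union> S)"
    unfolding distribution_function_def B_def[symmetric]
    using S by (intro plus_emeasure) (auto simp: S_def B_def)
  also have "B \<union> S = {x \<in> I_of \<gamma>. \<zeta> \<le> \<bar>f x\<bar>}" by (auto simp: S_def B_def)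
  finally show "\<mu> (low_rank \<gamma> f t) =
      min (ennreal t) (\<mu> {x \<in> I_of \<gamma>. \<zeta> \<le> \<bar>f x\<bar>})" unfolding eq .
qed

lemma rank_le_empty:
  assumes f: "f \<in> \<M>" and "rearrangement \<gamma> f t = \<infinity>"
  shows "low_rank \<gamma> f t = {}"
proof -
  have "ennreal t < decreasing_rank \<gamma> f x" for x
  proof -
    have "ennreal t < \<D> \<gamma> f \<bar>f x\<bar>"
      using less_rearrangement_iff[OF f, of "\<bar>f x\<bar>" \<gamma> t] assms by simp
    then show ?thesis unfolding decreasing_rank_def by (rule order.strict_trans2) simp
  qed
  then show ?thesis by (auto simp: not_le)
qed

lemma rank_le_measurable:
  assumes f: "f \<in> \<M>" and "0 \<le> t"
  shows "low_rank \<gamma> f t \<in> \<L>"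
    and "\<mu> (low_rank \<gamma> f t) \<le> ennreal t"
proof -
  have "low_rank \<gamma> f t \<in> \<L> \<and>
      \<mu> (low_rank \<gamma> f t) \<le> ennreal t"
  proof (cases "rearrangement \<gamma> f t")
    case (real \<zeta>)
    show ?thesis
      unfolding emeasure_rank_le(2)[OF assms real(1,2)]
      by (intro conjI emeasure_rank_le(1)[OF assms real(1,2)] min.cobounded1)
  next
    case top
    then have "low_rank \<gamma> f t = {}"
      by (intro rank_le_empty f) simp
    then show ?thesis by (simp only: emeasure_empty sets.empty_sets zero_le simp_thms)
  qed
  then show "low_rank \<gamma> f t \<in> \<L>"
    and "\<mu> (low_rank \<gamma> f t) \<le> ennreal t" by auto
qed

text \<open>Finiteness of the level set restores continuity from above, so the mass deficit just
  described cannot occur. If the rearrangement at \<open>t\<close> exceeds \<open>l\<close>, all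
  levels slightly below its value have mass at least \<open>t\<close>, hence so has their
  intersection; otherwise the whole level set at \<open>l\<close> has rank at most
  \<open>t\<close>.\<close>

lemma emeasure_rank_le_level:
  assumes f: "f \<in> \<M>" and "0 \<le> t" "0 \<le> l"
    and t: "ennreal t \<le> \<D> \<gamma> f l" and fin: "\<D> \<gamma> f l < \<infinity>"
  shows "ennreal t \<le> \<mu> (level \<gamma> f l \<inter> low_rank \<gamma> f t)"
proof -
  let ?D = "\<D> \<gamma> f"
  have sets: "level \<gamma> f l \<inter> low_rank \<gamma> f t \<in> \<L>"
    by (rule sets.Int[OF level_set_measurable(1)[OF f] rank_le_measurable(1)[OF f \<open>0 \<le> t\<close>]])
  have decr: "\<mu> (\<Inter>n. level \<gamma> f (a n)) = (INF n. ?D (a n))"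
    if "incseq a" "\<And>n. l \<le> a n" for a :: "nat \<Rightarrow> real"
  proof -
    have "?D (a n) < \<infinity>" for n
      using distribution_function_antimono[OF f that(2)] fin by (rule order.strict_trans1)
    then show ?thesis
      unfolding distribution_function_def using that
      by (intro INF_emeasure_decseq[symmetric])
        (auto simp: decseq_def incseq_def less_top intro: level_set_measurable f le_less_trans)
  qed
  show ?thesis
  proof (cases "rearrangement \<gamma> f t")
    case top
    \<comment> \<open>An infinite rearrangement at \<open>t\<close> gives every level set mass at
      least \<open>t\<close>, but the levels \<open>l + real n\<close> decrease to the empty set, so
      \<open>t\<close> is zero.\<close>
    have "ennreal t \<le> (INF n. ?D (l + real n))"
      using less_rearrangement_iff[OF f, of _ \<gamma> t] top \<open>0 \<le> l\<close>
      by (intro INF_greatest less_imp_le) auto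
    also have "\<dots> = \<mu> (\<Inter>n. level \<gamma> f (l + real n))"
      by (rule decr[symmetric]) (auto simp: incseq_def)
    also have "(\<Inter>n. level \<gamma> f (l + real n)) = {}"
    proof -
      have "\<exists>n::nat. \<not> l + real n < \<bar>f x\<bar>" for x
        using real_arch_simple[of "\<bar>f x\<bar> - l"] by (auto simp: not_less algebra_simps)
      then show ?thesis by blast
    qed
    finally show ?thesis by simp
  next
    case (real \<zeta>)
    note R = emeasure_rank_le[OF f \<open>0 \<le> t\<close> real(1,2)]
    show ?thesis
    proof (cases "l < \<zeta>")
      case True
      define a where "a n = \<zeta> - (\<zeta> - l) / real (Suc n)" for n
      have a: "incseq a" "l \<le> a n" "a n < \<zeta>" for n
      proof -
        show "incseq a"
        proof (rule incseq_SucI)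
          fix n
          have "(\<zeta> - l) / real (Suc (Suc n)) \<le> (\<zeta> - l) / real (Suc n)"
            using True by (intro divide_left_mono) auto
          then show "a n \<le> a (Suc n)" by (simp add: a_def)
        qed
        have "(\<zeta> - l) / real (Suc n) \<le> (\<zeta> - l) / 1"
          using True by (intro divide_left_mono) auto
        then show "l \<le> a n" by (simp add: a_def)
        show "a n < \<zeta>" using True by (simp add: a_def)
      qed
      have "ennreal t \<le> (INF n. ?D (a n))"
      proof (rule INF_greatest)
        fix n
        have "ennreal (a n) < rearrangement \<gamma> f t"
          using a(2,3)[of n] real \<open>0 \<le> l\<close> by (simp add: ennreal_less_iff)
        then show "ennreal t \<le> ?D (a n)"
          using less_rearrangement_iff[OF f, of "a n" \<gamma> t] a(2)[of n] \<open>0 \<le> l\<close> by simp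
      qed
      also have "\<dots> = \<mu> (\<Inter>n. level \<gamma> f (a n))"
        by (rule decr[symmetric]) (use a in auto)
      also have "(\<Inter>n. level \<gamma> f (a n)) = {x \<in> I_of \<gamma>. \<zeta> \<le> \<bar>f x\<bar>}"
      proof (intro set_eqI iffI)
        fix x assume x: "x \<in> (\<Inter>n. level \<gamma> f (a n))"
        have "(\<lambda>n. \<zeta> - (\<zeta> - l) * inverse (real (Suc n))) \<longlonglongrightarrow> \<zeta> - (\<zeta> - l) * 0"
          by (intro tendsto_intros LIMSEQ_inverse_real_of_nat)
        then have "a \<longlonglongrightarrow> \<zeta>"
          unfolding a_def[abs_def] by (simp add: divide_inverse)
        then have "\<zeta> \<le> \<bar>f x\<bar>"
          by (rule LIMSEQ_le_const2) (use x in \<open>auto intro: less_imp_le\<close>)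
        then show "x \<in> {x \<in> I_of \<gamma>. \<zeta> \<le> \<bar>f x\<bar>}" using x by auto
      next
        fix x assume "x \<in> {x \<in> I_of \<gamma>. \<zeta> \<le> \<bar>f x\<bar>}"
        then show "x \<in> (\<Inter>n. level \<gamma> f (a n))"
          using a(3) by (auto intro: less_le_trans)
      qed
      finally have "\<mu> (low_rank \<gamma> f t) = ennreal t"
        unfolding R(2) by (rule min_absorb1)
      moreover have "low_rank \<gamma> f t \<subseteq>
          (level \<gamma> f l \<inter> low_rank \<gamma> f t)"
        using rank_le_eq(1)[OF f \<open>0 \<le> t\<close> real(1,2)] True by auto
      from emeasure_mono[OF this sets]
      have "\<mu> (low_rank \<gamma> f t) \<le>
          \<mu> (level \<gamma> f l \<inter> low_rank \<gamma> f t)" .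
      ultimately show ?thesis by (simp only:)
    next
      case False
      have "level \<gamma> f l \<subseteq> level \<gamma> f l \<inter> low_rank \<gamma> f t"
      proof
        fix x assume x: "x \<in> level \<gamma> f l"
        then have "x \<in> low_rank \<gamma> f t"
          unfolding rank_le_eq(1)[OF f \<open>0 \<le> t\<close> real(1,2)] using False by simp
        then show "x \<in> (level \<gamma> f l \<inter> low_rank \<gamma> f t)"
          using x by simp
      qed
      then have "?D l \<le> \<mu> (level \<gamma> f l \<inter> low_rank \<gamma> f t)"
        unfolding distribution_function_def by (rule emeasure_mono[OF _ sets])
      with t show ?thesis by (rule order_trans)
    qed
  qed
qed

section \<open>The modular without rearrangement\<close>

text \<open>Lebesgue measure has no atoms: an initial part of \<open>B - A\<close> with the missing
  mass is added to \<open>A\<close>.\<close>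

lemma emeasure_between:
  fixes A B :: "real set"
  assumes A: "A \<in> \<L>" and B: "B \<in> \<L>" and "A \<subseteq> B" "B \<subseteq> {0..}"
    and "\<mu> A \<le> T" "T \<le> \<mu> B" "T < \<infinity>"
  obtains E where "E \<in> \<L>" "A \<subseteq> E" "E \<subseteq> B" "\<mu> E = T"
proof -
  define r where "r = T - \<mu> A"
  define C where "C = {x \<in> B - A. \<mu> ((B - A) \<inter> {0..x}) \<le> r}"
  have BA: "B - A \<in> \<L>" "B - A \<subseteq> {0..}" using assms by auto
  have "r < \<infinity>" using \<open>T < \<infinity>\<close> unfolding r_def by (rule order.strict_trans1[OF diff_le_self_ennreal])
  note C = emeasure_initial_part[OF BA this, folded C_def]
  have "\<mu> B = \<mu> A + \<mu> (B - A)"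
  proof -
    have "A \<union> (B - A) = B" using \<open>A \<subseteq> B\<close> by auto
    then show ?thesis using plus_emeasure[OF A BA(1)] by auto
  qed
  then have "r \<le> \<mu> (B - A)"
    unfolding r_def using assms(6) \<open>\<mu> A \<le> T\<close> \<open>T < \<infinity>\<close>
    by (auto simp: ennreal_minus_le_iff)
  then have "\<mu> C = r" unfolding C(2) by (rule min_absorb1)
  moreover have "\<mu> (A \<union> C) = \<mu> A + \<mu> C"
    by (rule plus_emeasure[symmetric, OF A C(1)]) (auto simp: C_def)
  ultimately have "\<mu> (A \<union> C) = T"
    unfolding r_def using assms(5) by (simp add: add_diff_inverse_ennreal)
  moreover have "A \<union> C \<in> \<L>" using A C by auto
  moreover have "A \<union> C \<subseteq> B" using \<open>A \<subseteq> B\<close> by (auto simp: C_def)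
  ultimately show thesis using that[of "A \<union> C"] by auto
qed

lemma rearrangement_antimono:
  assumes "s \<le> t" shows "rearrangement \<gamma> f t \<le> rearrangement \<gamma> f s"
  unfolding rearrangement_def
  by (intro Inf_superset_mono) (use order_trans[OF _ ennreal_leI[OF assms]] in blast)

lemma AE_lebesgue_neq: "AE t in lebesgue. t \<noteq> (a::real)"
  by (rule AE_I'[of "{a}"]) auto

lemma emeasure_rearrangement_level:
  assumes f: "f \<in> \<M>" and "0 \<le> l"
  shows "\<mu> {t. ennreal l < rearrangement \<gamma> f t * indicator (I_of \<gamma>) t} =
      \<mu> {x. ennreal l < ennreal \<bar>f x\<bar> * indicator (I_of \<gamma>) x}"
proof -
  let ?D = "\<D> \<gamma> f l"
  have "t \<in> I_of \<gamma>" if "0 \<le> t" "ennreal t < ?D" for t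
    using that distribution_function_le_I[of \<gamma> f l] mem_I_of_iff[of t \<gamma>] by (auto intro: order.strict_trans2)
  then have "{t. ennreal l < rearrangement \<gamma> f t * indicator (I_of \<gamma>) t} = {t. 0 \<le> t \<and> ennreal t < ?D}"
    using \<open>0 \<le> l\<close> I_of_nonneg[of _ \<gamma>] by (auto simp: indicator_def less_rearrangement_iff[OF f])
  moreover have "{x. ennreal l < ennreal \<bar>f x\<bar> * indicator (I_of \<gamma>) x} = level \<gamma> f l"
    using \<open>0 \<le> l\<close> by (auto simp: indicator_def ennreal_less_iff)
  ultimately show ?thesis
    using emeasure_lebesgue_interval_diff(1)[of 0 ?D] by (simp only: distribution_function_def) simp
qed

locale orlicz_weight = orlicz \<phi> for \<phi> :: "real \<Rightarrow> real" +
  fixes \<gamma> :: ereal and w :: "real \<Rightarrow> real"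
  assumes \<gamma>_pos: "0 < \<gamma>" and weight: "weight_function \<gamma> w"
begin

abbreviation "I \<equiv> I_of \<gamma>"
abbreviation "\<psi> \<equiv> perspective (slope_inverse \<phi>)"
abbreviation "Orlicz_integral f v \<equiv>
  \<integral>\<^sup>+t\<in>I. Orlicz_ext \<phi> (rearrangement \<gamma> f t / ennreal (v t)) * ennreal (v t) \<partial>lebesgue"
abbreviation "W \<equiv> rearrangement_integral \<gamma> (cut \<gamma> w)"

lemma w_decreasing: "positive_decreasing \<gamma> w"
  using weight by (simp add: weight_function_def)

text \<open>Unlike the weights in \<open>P_fun\<close>, members need be neither decreasing nor
  positive; \<open>perspective\<close> has the right value where they vanish.\<close>

definition weights :: "(real \<Rightarrow> real) set" where
  "weights = {u \<in> \<M>. (\<forall>t. 0 \<le> u t) \<and>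
     (\<forall>E\<in>\<L>. E \<subseteq> I \<and> \<mu> E < \<infinity> \<longrightarrow>
        nint E u \<le> W (\<mu> E))}"

definition modular :: "(real \<Rightarrow> real) \<Rightarrow> (real \<Rightarrow> real) \<Rightarrow> ennreal" where
  "modular f u = (\<integral>\<^sup>+t\<in>I. \<psi> (ennreal \<bar>f t\<bar>) (u t) \<partial>lebesgue)"

lemma modular_eq: "modular f u = (\<integral>\<^sup>+t. \<psi> (ennreal \<bar>f t\<bar> * indicator I t) (u t) \<partial>lebesgue)"
  unfolding modular_def by (intro nn_integral_cong) (auto simp: indicator_def)

section \<open>From a decreasing weight to a weight arranged like f\<close>

lemma Orlicz_ext_integral:
  assumes v: "positive_decreasing \<gamma> v"
  shows "Orlicz_integral f v =
    (\<integral>\<^sup>+ t. \<psi> (rearrangement \<gamma> f t * indicator I t) (cut \<gamma> v t) \<partial>lebesgue)"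
proof (rule nn_integral_cong_AE, rule AE_mp[OF AE_lebesgue_neq[of 0]], rule AE_I2, rule impI)
  fix t :: real assume "t \<noteq> 0"
  show "Orlicz_ext \<phi> (rearrangement \<gamma> f t / ennreal (v t)) * ennreal (v t) * indicator I t =
      \<psi> (rearrangement \<gamma> f t * indicator I t) (cut \<gamma> v t)"
  proof (cases "t \<in> I")
    case True
    then have "0 < v t" using v \<open>t \<noteq> 0\<close> by (simp add: positive_decreasing_def)
    then show ?thesis using True \<open>t \<noteq> 0\<close> by (simp add: Orlicz_ext_perspective cut_def)
  qed simp
qed

text \<open>The weight is \<open>v\<close> composed with the rank, so large values of \<bar>f\<bar>
  meet large weights. For the joint level sets: up to a null set, points with \<open>u\<close> below
  \<open>c\<close> have rank at least \<open>?D c\<close>, while smaller ranks already fill that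
  much of the level set of \<open>f\<close>. What remains is at most the difference of the two
  distribution functions, which is available on the rearranged side.\<close>

lemma exists_weight:
  assumes f: "f \<in> \<M>" and v: "positive_decreasing \<gamma> v" and maj: "submajorized \<gamma> v w"
  shows "\<exists>u\<in>weights. modular f u \<le>
    Orlicz_integral f v"
proof -
  let ?D = "\<D> \<gamma> (cut \<gamma> v)"
  \<comment> \<open>The limit of \<open>v\<close> at infinity, meant for points of infinite rank.
    Since \<open>enn2real\<close> maps infinity to 0, rank 0 receives the same value, but only on a
    null set. For finite \<gamma> no point of \<open>I\<close> has infinite rank.\<close>
  define vinf where "vinf = (if \<gamma> = \<infinity> then Inf (v ` {0<..}) else 0)"
  define R where "R t = (if 0 < t then cut \<gamma> v t else vinf)" for t
  define rk where "rk x = (if x \<in> I then decreasing_rank \<gamma> f x else \<infinity>)" for x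
  define u where "u x = R (enn2real (rk x))" for x
  have I_inf: "t \<in> I" if "\<gamma> = \<infinity>" "0 \<le> t" for t using that by (simp add: I_of_def)
  have v_pos: "0 < v t" if "t \<in> I" "0 < t" for t
    using v that by (simp add: positive_decreasing_def)
  have vinf_nonneg: "0 \<le> vinf"
  proof (cases "\<gamma> = \<infinity>")
    case True
    have "0 \<le> Inf (v ` {0<..})"
      by (rule cINF_greatest) (use I_inf[OF True] v_pos in \<open>auto intro: less_imp_le\<close>)
    then show ?thesis by (simp add: vinf_def)
  qed (simp add: vinf_def)
  have vinf_le: "vinf \<le> v t" if "\<gamma> = \<infinity>" "0 < t" for t
  proof -
    have "bdd_below (v ` {0<..})"
      by (rule bdd_belowI[of _ 0]) (use I_inf[OF that(1)] v_pos in \<open>auto intro: less_imp_le\<close>)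
    then have "Inf (v ` {0<..}) \<le> v t" using that by (intro cINF_lower) auto
    then show ?thesis using that by (simp add: vinf_def)
  qed
  have R_meas: "R \<in> borel_measurable borel"
    unfolding R_def[abs_def] using cut_borel_measurable[OF v] by measurable
  have rk_meas: "rk \<in> \<M>"
  proof (rule borel_measurableI_le)
    fix y :: ennreal
    show "{x \<in> space lebesgue. rk x \<le> y} \<in> \<L>"
    proof (cases y)
      case (real t)
      have "{x \<in> space lebesgue. rk x \<le> y} = low_rank \<gamma> f t"
        using real by (auto simp: rk_def top_unique split: if_splits)
      then show ?thesis using rank_le_measurable(1)[OF f real(1), of \<gamma>] by simp
    qed simp
  qed
  have u_meas: "u \<in> \<M>"
    unfolding u_def[abs_def] using R_meas rk_meas by measurable
  have u_nonneg: "0 \<le> u x" for x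
    using vinf_nonneg cut_nonneg[OF v] by (simp add: u_def R_def)
  have Du: "\<D> \<gamma> u c \<le> ?D c" if "0 \<le> c" for c
  proof (cases "?D c")
    case (real d)
    \<comment> \<open>Where \<open>u\<close> exceeds \<open>c\<close>, the rank is at most the mass
      \<open>d\<close> of the set on which \<open>v\<close> exceeds \<open>c\<close>.\<close>
    have "level \<gamma> u c \<subseteq> low_rank \<gamma> f d"
    proof safe
      fix x assume x: "x \<in> I" "c < \<bar>u x\<bar>"
      define r where "r = enn2real (rk x)"
      have cR: "c < R r" using x u_nonneg[of x] by (simp add: u_def r_def)
      show "decreasing_rank \<gamma> f x \<le> ennreal d"
      proof (cases "0 < r")
        case True
        then have "c < cut \<gamma> v r" using cR by (simp add: R_def)
        then have "r \<in> I" "c < v r" using \<open>0 \<le> c\<close> by (auto simp: cut_def split: if_splits)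
        then have "ennreal r \<le> ennreal d"
          using distribution_function_decreasing(1)[OF v True \<open>0 \<le> c\<close>] real by simp
        moreover have "rk x = ennreal r"
          using True unfolding r_def by (cases "rk x") auto
        ultimately show ?thesis using x by (simp add: rk_def)
      next
        case False
        then have c: "c < vinf" using cR by (simp add: R_def)
        have "rk x \<noteq> \<infinity>"
        proof
          have inf: "\<gamma> = \<infinity>" using c \<open>0 \<le> c\<close> by (auto simp: vinf_def split: if_splits)
          have "0 < d + 1" using real by simp
          have "ennreal (d + 1) \<le> ?D c"
            using distribution_function_decreasing(1)[OF v \<open>0 < d + 1\<close> \<open>0 \<le> c\<close>] I_inf[OF inf]
              vinf_le[OF inf \<open>0 < d + 1\<close>] c \<open>0 < d + 1\<close> by simp
          then show False using real by simp
        qed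
        then have "rk x = 0" using False unfolding r_def
          by (cases "rk x") auto
        then show ?thesis using x by (simp add: rk_def)
      qed
    qed
    then have "\<D> \<gamma> u c \<le> \<mu> (low_rank \<gamma> f d)"
      unfolding distribution_function_def by (rule emeasure_mono[OF _ rank_le_measurable(1)[OF f real(1)]])
    also have "\<dots> \<le> ennreal d" by (rule rank_le_measurable(2)[OF f real(1)])
    finally show ?thesis using real by simp
  qed simp
  have "u \<in> weights"
    unfolding weights_def
  proof (intro CollectI conjI ballI impI allI u_meas u_nonneg)
    fix E assume E: "E \<in> \<L>" "E \<subseteq> I \<and> \<mu> E < \<infinity>"
    have "nint E u \<le> rearrangement_integral \<gamma> u (\<mu> E)"
      using E by (intro nn_integral_le_rearrangement_integral u_meas) auto
    also have "\<dots> \<le> rearrangement_integral \<gamma> (cut \<gamma> v) (\<mu> E)"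
      unfolding rearrangement_integral_def
      by (intro nn_integral_mono) (auto simp: indicator_def intro: min.coboundedI2 Du)
    also have "\<dots> \<le> W (\<mu> E)"
    proof (cases "\<mu> E")
      case (real t)
      show ?thesis
      proof (cases "t = 0")
        case True
        then show ?thesis using real by (simp add: rearrangement_integral_def)
      next
        case False
        then show ?thesis using maj real unfolding submajorized_iff[OF v w_decreasing] by simp
      qed
    qed (use E in simp)
    finally show "nint E u \<le> W (\<mu> E)" .
  qed
  moreover have "modular f u \<le> (\<integral>\<^sup>+ t. \<psi> (rearrangement \<gamma> f t * indicator I t) (cut \<gamma> v t) \<partial>lebesgue)"
    unfolding modular_eq
  proof (rule nn_integral_perspective_le)
    show "(\<lambda>x. ennreal \<bar>f x\<bar> * indicator I x) \<in> \<M>"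
      using f I_of_sets[of \<gamma>] by measurable
    show "(\<lambda>x. rearrangement \<gamma> f x * indicator I x) \<in> \<M>"
      by (rule rearrangement_measurable[OF f I_of_sets])
    show "\<mu> {x. ennreal l < ennreal \<bar>f x\<bar> * indicator I x} \<le>
        \<mu> {x. ennreal l < rearrangement \<gamma> f x * indicator I x}" if "0 < l" for l
      using emeasure_rearrangement_level[OF f, of l \<gamma>] that by simp
    fix l c :: real assume "0 < l" "0 < c"
    let ?L = "{x \<in> I. l < \<bar>f x\<bar> \<and> u x < c}"
    let ?Df = "\<D> \<gamma> f l"
    have L_eq: "{x. u x < c \<and> ennreal l < ennreal \<bar>f x\<bar> * indicator I x} = ?L"
      using \<open>0 < l\<close> by (auto simp: indicator_def ennreal_less_iff)
    have L_meas: "?L \<in> \<L>"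
    proof -
      have 1: "{x \<in> space lebesgue. u x < c} \<in> \<L>" using u_meas by measurable
      have 2: "?L = level \<gamma> f l \<inter> {x \<in> space lebesgue. u x < c}" by auto
      show ?thesis unfolding 2 by (rule sets.Int[OF level_set_measurable(1)[OF f] 1])
    qed
    have low_rank: "decreasing_rank \<gamma> f x \<le> 0 \<or> ?D c \<le> decreasing_rank \<gamma> f x" if "x \<in> I" "u x < c" for x
    proof (rule ccontr)
      assume "\<not> (decreasing_rank \<gamma> f x \<le> 0 \<or> ?D c \<le> decreasing_rank \<gamma> f x)"
      then have r: "0 < decreasing_rank \<gamma> f x" "decreasing_rank \<gamma> f x < ?D c"
        by (auto simp: not_le zero_less_iff_neq_zero)
      then obtain t where t: "decreasing_rank \<gamma> f x = ennreal t" "0 < t"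
        by (cases "decreasing_rank \<gamma> f x") auto
      then have "c < v t" "t \<in> I"
        using distribution_function_decreasing(2)[OF v, of t c] r \<open>0 < c\<close> by auto
      then have "c < u x" using t that by (simp add: u_def rk_def R_def cut_def)
      with that show False by simp
    qed
    let ?R = "{x. cut \<gamma> v x \<le> c \<and> ennreal l < rearrangement \<gamma> f x * indicator I x}"
    have "\<mu> ?L \<le> \<mu> ?R"
    proof (cases "?D c")
      \<comment> \<open>Here \<open>v\<close> stays above \<open>c\<close> everywhere, so
        \<open>vinf\<close> is at least \<open>c\<close> and no point has \<open>u\<close> below
        \<open>c\<close>.\<close>
      case top
      have all: "t \<in> I \<and> c < v t" if "0 < t" for t
        using distribution_function_decreasing(2)[OF v that, of c] top \<open>0 < c\<close> by simp
      have inf: "\<gamma> = \<infinity>"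
      proof (rule ccontr)
        assume "\<gamma> \<noteq> \<infinity>"
        then obtain g where "\<gamma> = ereal g" using \<gamma>_pos by (cases \<gamma>) auto
        then show False using all[of g] \<gamma>_pos by (simp add: I_of_def)
      qed
      have "c \<le> Inf (v ` {0<..})"
        by (rule cINF_greatest) (use all in \<open>auto intro: less_imp_le\<close>)
      then have "c \<le> vinf" using inf by (simp add: vinf_def)
      then have "c \<le> u x" for x using all by (auto simp: u_def R_def cut_def intro: less_imp_le)
      then have "?L = {}" by (auto simp: not_less[symmetric])
      then show ?thesis by (simp only: emeasure_empty zero_le)
    next
      case (real d)
      have "{t. d < t \<and> ennreal t < ?Df} \<subseteq> ?R"
      proof safe
        fix t assume t: "d < t" "ennreal t < ?Df"
        then have "0 < t" using real by simp
        have "ennreal t < \<mu> I"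
          using t(2) distribution_function_le_I by (rule order.strict_trans2)
        then have tI: "t \<in> I" using mem_I_of_iff[of t \<gamma>] \<open>0 < t\<close> by simp
        have "\<not> c < v t"
        proof
          assume "c < v t"
          then have "ennreal t \<le> ennreal d"
            using distribution_function_decreasing(1)[OF v \<open>0 < t\<close>, of c] tI real \<open>0 < c\<close> by simp
          with t real show False by simp
        qed
        then show "cut \<gamma> v t \<le> c" using \<open>0 < c\<close> by (simp add: cut_def)
        show "ennreal l < rearrangement \<gamma> f t * indicator I t"
          using tI t less_rearrangement_iff[OF f, of l \<gamma> t] \<open>0 < l\<close> by simp
      qed
      note sub = this
      have sets: "?R \<in> \<L>"
      proof -
        have "{x \<in> space lebesgue. cut \<gamma> v x \<le> c} \<in> \<L>" using cut_measurable[OF v] by measurable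
        moreover have "{x \<in> space lebesgue. ennreal l < rearrangement \<gamma> f x * indicator I x} \<in> \<L>"
          using rearrangement_measurable[OF f I_of_sets] by measurable
        ultimately have "{x \<in> space lebesgue. cut \<gamma> v x \<le> c} \<inter>
            {x \<in> space lebesgue. ennreal l < rearrangement \<gamma> f x * indicator I x} \<in> \<L>" by (rule sets.Int)
        then show ?thesis by (rule back_subst[of "\<lambda>A. A \<in> \<L>"]) auto
      qed
      have RHS: "?Df - ennreal d \<le>
          \<mu> ?R"
        using emeasure_mono[OF sub sets] unfolding emeasure_lebesgue_interval_diff(2)[OF real(1)] .
      show ?thesis
      proof (cases ?Df)
        case top
        then show ?thesis using RHS by (simp add: top_unique)
      next
        case e: (real e)
        \<comment> \<open>Ranks up to \<open>\<tau>\<close> fill mass at least \<open>\<tau>\<close>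
          of the level set and, apart from the null set of rank 0, avoid \<open>?L\<close>. As
          \<open>?L\<close> may contain points of rank exactly \<open>d\<close>,
          \<open>\<tau>\<close> has to stay below \<open>d\<close>.\<close>
        have sum: "\<mu> ?L + ennreal \<tau> \<le> ennreal e" if \<tau>: "0 \<le> \<tau>" "\<tau> < d" "\<tau> \<le> e" for \<tau>
        proof -
          let ?N = "low_rank \<gamma> f 0"
          let ?B = "(level \<gamma> f l \<inter> low_rank \<gamma> f \<tau>)"
          have N: "?N \<in> \<L>" "\<mu> ?N = 0"
            using rank_le_measurable[OF f, of 0 \<gamma>] by auto
          have B: "?B \<in> \<L>"
            by (rule sets.Int[OF level_set_measurable(1)[OF f] rank_le_measurable(1)[OF f \<tau>(1)]])
          have "ennreal \<tau> \<le> \<mu> ?B"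
            by (rule emeasure_rank_le_level[OF f \<tau>(1)]) (use e \<tau> \<open>0 < l\<close> in auto)
          then have "\<mu> ?L + ennreal \<tau> \<le> \<mu> (?L - ?N) + \<mu> ?B"
            using emeasure_Diff_null_set[of ?N lebesgue ?L] N L_meas by (intro add_mono) (auto simp: null_sets_def)
          also have "\<dots> = \<mu> ((?L - ?N) \<union> ?B)"
          proof (rule plus_emeasure)
            show "?L - ?N \<in> \<L>" using L_meas N by (intro sets.Diff)
            show "(?L - ?N) \<inter> ?B = {}"
            proof (rule equals0I)
              fix x assume "x \<in> (?L - ?N) \<inter> ?B"
              then have x: "x \<in> I" "u x < c" "decreasing_rank \<gamma> f x \<le> ennreal \<tau>"
                "\<not> decreasing_rank \<gamma> f x \<le> 0" by auto
              then have "?D c \<le> ennreal \<tau>" using low_rank[OF x(1,2)] by (auto intro: order_trans)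
              then show False using \<tau> real by (simp add: ennreal_le_iff)
            qed
          qed (rule B)
          also have "\<dots> \<le> ?Df"
            unfolding distribution_function_def
            by (rule emeasure_mono[OF _ level_set_measurable(1)[OF f]]) auto
          finally show ?thesis using e by simp
        qed
        have "\<mu> ?L \<le> ?Df"
          unfolding distribution_function_def
          by (rule emeasure_mono[OF _ level_set_measurable(1)[OF f]]) auto
        then obtain a where a: "\<mu> ?L = ennreal a" "0 \<le> a" "a \<le> e"
          using e by (cases "\<mu> ?L") (auto simp: top_unique)
        \<comment> \<open>Let \<open>\<tau>\<close> tend to \<open>min d e\<close> from
          below.\<close>
        have "a + min d e \<le> e"
        proof (cases "0 < min d e")
          case True
          show ?thesis
          proof (rule field_le_epsilon)
            fix \<epsilon> :: real assume "0 < \<epsilon>"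
            define \<tau> where "\<tau> = max 0 (min d e - \<epsilon>)"
            have "0 \<le> \<tau>" "\<tau> < d" "\<tau> \<le> e" "min d e \<le> \<tau> + \<epsilon>"
              using True \<open>0 < \<epsilon>\<close> by (auto simp: \<tau>_def)
            then show "a + min d e \<le> e + \<epsilon>"
              using sum[of \<tau>] a by (simp flip: ennreal_plus)
          qed
        qed (use a real e in auto)
        then have "a \<le> e - d \<or> a \<le> 0" by (auto simp: min_def split: if_splits)
        then have "ennreal a \<le> ennreal e - ennreal d"
          using a real by (auto simp: ennreal_minus ennreal_leI)
        then show ?thesis using RHS a e by simp
      qed
    qed
    then show "\<mu> {x. u x < c \<and> ennreal l < ennreal \<bar>f x\<bar> * indicator I x} \<le>
        \<mu> {x. cut \<gamma> v x \<le> c \<and> ennreal l < rearrangement \<gamma> f x * indicator I x}"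
      by (simp only: L_eq)
  qed (auto simp: u_meas u_nonneg cut_measurable[OF v] cut_nonneg[OF v] slope_inverse_nonneg slope_inverse_measurable)
  ultimately show ?thesis unfolding Orlicz_ext_integral[OF v] by blast
qed

section \<open>Convexity of the weights and the way back to decreasing ones\<close>

lemma cut_w_weights: "cut \<gamma> w \<in> weights"
  unfolding weights_def
  by (intro CollectI conjI allI ballI impI cut_measurable[OF w_decreasing] cut_nonneg[OF w_decreasing]
      nn_integral_le_rearrangement_integral) auto

lemma weightsD:
  assumes "u \<in> weights"
  shows "u \<in> \<M>" "0 \<le> u t"
    and "E \<in> \<L> \<Longrightarrow> E \<subseteq> I \<Longrightarrow> \<mu> E < \<infinity> \<Longrightarrow>
        nint E u \<le> W (\<mu> E)"
  using assms by (auto simp: weights_def)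

lemma weights_convex:
  assumes u1: "u1 \<in> weights" and u2: "u2 \<in> weights" and e: "0 \<le> a" "0 \<le> b" "a + b = 1"
  shows "(\<lambda>t. a * u1 t + b * u2 t) \<in> weights"
proof -
  note [measurable] = weightsD(1)[OF u1] weightsD(1)[OF u2]
  have "nint E (\<lambda>t. a * u1 t + b * u2 t) \<le> W (\<mu> E)"
    if E[measurable]: "E \<in> \<L>" and E': "E \<subseteq> I" "\<mu> E < \<infinity>" for E
  proof -
    have "nint E (\<lambda>t. a * u1 t + b * u2 t) =
        (\<integral>\<^sup>+t. ennreal a * (ennreal (u1 t) * indicator E t) + ennreal b * (ennreal (u2 t) * indicator E t) \<partial>lebesgue)"
      using e weightsD(2)[OF u1] weightsD(2)[OF u2]
      by (intro nn_integral_cong) (auto simp: indicator_def ennreal_mult)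
    also have "\<dots> = ennreal a * nint E u1 + ennreal b * nint E u2"
      by (simp add: nn_integral_add nn_integral_cmult)
    also have "\<dots> \<le> ennreal a * W (\<mu> E) + ennreal b * W (\<mu> E)"
      by (intro add_mono mult_left_mono weightsD(3) u1 u2 E E') auto
    also have "\<dots> = ennreal (a + b) * W (\<mu> E)"
      using ennreal_plus[OF e(1,2)] by (simp only: distrib_right)
    also have "\<dots> = W (\<mu> E)" unfolding e by simp
    finally show ?thesis .
  qed
  then show ?thesis
    unfolding weights_def using e weightsD(2)[OF u1] weightsD(2)[OF u2] by auto
qed

text \<open>As \<open>w\<close> is decreasing, rearranging it does not raise it off 0, which bounds
  \<open>W\<close> from above; the reverse inequality is the membership of
  \<open>cut \<gamma> w\<close> in \<open>weights\<close>.\<close>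

lemma W_eq:
  assumes "t \<in> I"
  shows "W (ennreal t) = nint {0..t} (cut \<gamma> w)" "W (ennreal t) < \<infinity>"
proof -
  have t: "0 \<le> t" using assms I_of_nonneg by blast
  have tI: "{0..t} \<subseteq> I" using I_of_downward[OF assms] by auto
  have "W (ennreal t) = (\<integral>\<^sup>+ s\<in>{0..t}. rearrangement \<gamma> (cut \<gamma> w) s \<partial>lebesgue)"
    by (rule nn_integral_rearrangement[symmetric, OF cut_measurable[OF w_decreasing] t])
  also have "\<dots> \<le> nint {0..t} (cut \<gamma> w)"
  proof (rule nn_integral_mono_AE, rule AE_mp[OF AE_lebesgue_neq[of 0]], rule AE_I2, rule impI)
    fix s :: real assume "s \<noteq> 0"
    show "rearrangement \<gamma> (cut \<gamma> w) s * indicator {0..t} s \<le> ennreal (cut \<gamma> w s) * indicator {0..t} s"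
    proof (cases "s \<in> {0..t}")
      case True
      with \<open>s \<noteq> 0\<close> have s: "0 < s" "s \<in> I" using tI by auto
      then have "0 < w s" "cut \<gamma> w s = w s" using w_decreasing by (auto simp: positive_decreasing_def cut_def)
      have "\<not> ennreal (w s) < rearrangement \<gamma> (cut \<gamma> w) s"
        using less_rearrangement_iff[OF cut_measurable[OF w_decreasing], of "w s" \<gamma> s]
          distribution_function_decreasing(2)[OF w_decreasing s(1), of "w s"] \<open>0 < w s\<close> by auto
      then show ?thesis using True \<open>cut \<gamma> w s = w s\<close> by simp
    qed simp
  qed
  finally have le: "W (ennreal t) \<le> nint {0..t} (cut \<gamma> w)" .
  moreover have "nint {0..t} (cut \<gamma> w) \<le> W (ennreal t)"
    using weightsD(3)[OF cut_w_weights, of "{0..t}"] tI t by simp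
  ultimately show "W (ennreal t) = nint {0..t} (cut \<gamma> w)" by (rule antisym)
  have "nint {0..t} (cut \<gamma> w) \<le> nint {0..t} w"
    by (intro nn_integral_mono mult_right_mono) (auto simp: cut_def)
  also have "\<dots> < \<infinity>" using weight assms by (auto simp: weight_function_def)
  finally show "W (ennreal t) < \<infinity>" using le by (rule order.strict_trans1[rotated])
qed

text \<open>Otherwise level sets of every height have mass above \<open>t\<close>, and a subset of
  mass \<open>t\<close> at height \<open>(K + 1) / t\<close> carries more than \<open>K\<close>, the
  value of \<open>W\<close> at \<open>t\<close>.\<close>

lemma rearrangement_weight_finite:
  assumes u: "u \<in> weights" and t: "t \<in> I" "0 < t"
  shows "rearrangement \<gamma> u t < \<infinity>"
proof (rule ccontr)
  assume "\<not> rearrangement \<gamma> u t < \<infinity>"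
  then have top: "rearrangement \<gamma> u t = \<infinity>" by (metis infinity_ennreal_def top.not_eq_extremum)
  note um = weightsD(1)[OF u]
  obtain K where K: "W (ennreal t) = ennreal K" "0 \<le> K" using W_eq(2)[OF t(1)] by (cases "W (ennreal t)") auto
  define l where "l = (K + 1) / t"
  have l: "0 \<le> l" using K t by (simp add: l_def)
  have "ennreal t < \<D> \<gamma> u l"
    using less_rearrangement_iff[OF um l, of \<gamma> t] top by simp
  then have tB: "ennreal t \<le> \<mu> (level \<gamma> u l)"
    unfolding distribution_function_def by (rule less_imp_le)
  have "level \<gamma> u l \<subseteq> {0..}" using I_of_nonneg by auto
  then obtain E where E: "E \<in> \<L>" "{} \<subseteq> E" "E \<subseteq> level \<gamma> u l" "\<mu> E = ennreal t"
    using emeasure_between[OF sets.empty_sets level_set_measurable(1)[OF um] empty_subsetI _ _ tB]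
    by (metis emeasure_empty ennreal_less_top infinity_ennreal_def zero_le)
  have "ennreal (K + 1) = ennreal l * \<mu> E"
    using E t l by (simp add: l_def flip: ennreal_mult)
  also have "\<dots> = (\<integral>\<^sup>+x. ennreal l * indicator E x \<partial>lebesgue)"
    using E by (simp add: nn_integral_cmult_indicator)
  also have "\<dots> \<le> nint E u"
    using E(3) weightsD(2)[OF u]
    by (intro nn_integral_mono) (auto simp: indicator_def intro!: ennreal_leI less_imp_le)
  also have "\<dots> \<le> ennreal K"
    using weightsD(3)[OF u E(1)] E K by auto
  finally show False using K by (simp add: ennreal_le_iff)
qed

text \<open>The other half of Hardy-Littlewood: a set of mass \<open>t\<close> between the level
  sets of \<open>u\<close> at \<open>\<zeta>\<close>, the rearrangement at \<open>t\<close>, and at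
  a slightly lower \<open>l0\<close> realises the rearranged integral up to
  \<open>t * (\<zeta> - l0)\<close>. The slack is needed because on an infinite interval the set
  where u \<ge> \<zeta> can have mass below \<open>t\<close>.\<close>

lemma rearrangement_integral_weight_le:
  assumes u: "u \<in> weights" and "0 < t"
  shows "rearrangement_integral \<gamma> u (ennreal t) \<le> W (ennreal t)"
proof -
  let ?D = "\<D> \<gamma> u"
  note um = weightsD(1)[OF u]
  have abs_u: "\<bar>u x\<bar> = u x" for x using weightsD(2)[OF u] by simp
  \<comment> \<open>If \<open>u\<close> lives on a set of measure at most \<open>t\<close>, that set
    itself is the test set.\<close>
  have whole: "rearrangement_integral \<gamma> u (ennreal t) \<le> W (ennreal t)"
    if E: "E \<in> \<L>" "E \<subseteq> I" "{x \<in> I. 0 < u x} \<subseteq> E" "\<mu> E \<le> ennreal t" for E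
  proof -
    have "rearrangement_integral \<gamma> u (ennreal t) \<le> (\<integral>\<^sup>+l\<in>{0..}. \<mu> {x \<in> E. l < u x} \<partial>lborel)"
      unfolding rearrangement_integral_def
    proof (rule nn_integral_mono)
      fix l :: real
      have "level \<gamma> u l = {x \<in> E. l < u x}" if "0 \<le> l"
        using E that by (auto simp: abs_u)
      then show "min (ennreal t) (?D l) * indicator {0..} l \<le>
          \<mu> {x \<in> E. l < u x} * indicator {0..} l"
        by (auto simp: indicator_def distribution_function_def)
    qed
    also have "\<dots> = nint E u"
      by (rule nn_integral_set_layers[symmetric, OF um E(1)])
    also have "\<dots> \<le> W (\<mu> E)"
      using E by (intro weightsD(3)[OF u]) (auto intro: order.strict_trans1)
    also have "\<dots> \<le> W (ennreal t)" by (rule rearrangement_integral_mono[OF E(4)])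
    finally show ?thesis .
  qed
  show ?thesis
  proof (cases "t \<in> I")
    case False
    then have "\<mu> I \<le> ennreal t" using mem_I_of_iff[of t \<gamma>] \<open>0 < t\<close> by simp
    then show ?thesis by (intro whole[of I] I_of_sets) auto
  next
    case True
    obtain \<zeta> where \<zeta>: "rearrangement \<gamma> u t = ennreal \<zeta>" "0 \<le> \<zeta>"
      using rearrangement_weight_finite[OF u True \<open>0 < t\<close>] by (cases "rearrangement \<gamma> u t") auto
    have D\<zeta>: "?D \<zeta> \<le> ennreal t" using less_rearrangement_iff[OF um \<zeta>(2), of \<gamma> t] \<zeta> by simp
    show ?thesis
    proof (cases "\<zeta> = 0")
      case True
      show ?thesis
      proof (rule whole)
        show "level \<gamma> u 0 \<in> \<L>" by (rule level_set_measurable(1)[OF um])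
        show "\<mu> (level \<gamma> u 0) \<le> ennreal t"
          using D\<zeta> True by (simp add: distribution_function_def)
      qed auto
    next
      case False
      show ?thesis
      proof (rule ennreal_le_epsilon)
        fix e :: real assume "0 < e"
        \<comment> \<open>Keeps \<open>l0\<close> nonnegative and makes the layers between
          \<open>l0\<close> and \<open>\<zeta>\<close> contribute at most \<open>e\<close>.\<close>
        define d where "d = min \<zeta> (e / t)"
        have d: "0 < d" "d \<le> \<zeta>" "t * d \<le> e"
          using False \<zeta> \<open>0 < e\<close> \<open>0 < t\<close> by (auto simp: d_def min_def field_simps)
        define l0 where "l0 = \<zeta> - d"
        have l0: "0 \<le> l0" "l0 < \<zeta>" using d by (auto simp: l0_def)
        have "ennreal t < ?D l0"
          using less_rearrangement_iff[OF um l0(1), of \<gamma> t] \<zeta> l0 by (simp add: ennreal_less_iff)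
        then have tB: "ennreal t \<le> \<mu> (level \<gamma> u l0)"
          unfolding distribution_function_def by (rule less_imp_le)
        have sub: "level \<gamma> u \<zeta> \<subseteq> level \<gamma> u l0" using l0 by auto
        have nn: "level \<gamma> u l0 \<subseteq> {0..}" using I_of_nonneg by auto
        obtain E where E: "E \<in> \<L>" "level \<gamma> u \<zeta> \<subseteq> E" "E \<subseteq> level \<gamma> u l0"
            "\<mu> E = ennreal t"
          by (rule emeasure_between[OF level_set_measurable(1)[OF um] level_set_measurable(1)[OF um] sub nn
                D\<zeta>[unfolded distribution_function_def] tB]) auto
        have "rearrangement_integral \<gamma> u (ennreal t) \<le>
          (\<integral>\<^sup>+l. \<mu> {x \<in> E. l < u x} * indicator {0..} l + ennreal t * indicator {l0..\<zeta>} l \<partial>lborel)"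
          unfolding rearrangement_integral_def
        proof (rule nn_integral_mono)
          fix l :: real
          consider "l < 0" | "0 \<le> l" "l \<le> l0" | "0 \<le> l" "l0 \<le> l" "l \<le> \<zeta>" | "\<zeta> < l" by linarith
          then show "min (ennreal t) (?D l) * indicator {0..} l \<le>
              \<mu> {x \<in> E. l < u x} * indicator {0..} l + ennreal t * indicator {l0..\<zeta>} l"
          proof cases
            case 2
            then have "{x \<in> E. l < u x} = E" using E(3) by (auto simp: abs_u)
            then have "min (ennreal t) (?D l) \<le> \<mu> {x \<in> E. l < u x}"
              using E(4) by (simp add: min.coboundedI1)
            then show ?thesis using 2 by (simp add: add_increasing2)
          next
            case 3
            have "min (ennreal t) (?D l) \<le> ennreal t" by (rule min.cobounded1)
            then show ?thesis using 3 by (simp add: add_increasing)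
          next
            case 4
            then have "{x \<in> E. l < u x} = level \<gamma> u l" using E(2,3) by (auto simp: abs_u)
            then have "min (ennreal t) (?D l) \<le> \<mu> {x \<in> E. l < u x}"
              by (simp add: distribution_function_def)
            then show ?thesis using 4 \<zeta>(2) by (simp add: add_increasing2)
          qed simp
        qed
        also have "\<dots> = nint E u + ennreal t * ennreal (\<zeta> - l0)"
        proof -
          have "(\<lambda>l. \<mu> {x \<in> E. l < u x}) \<in> borel_measurable borel"
          proof -
            note [measurable] = um E(1)
            have "(\<lambda>l. \<integral>\<^sup>+x. indicator {x. l < u x} x * indicator E x \<partial>lebesgue) \<in> borel_measurable (lborel :: real measure)"
              by (rule lebesgue.borel_measurable_nn_integral) measurable
            also have "(\<lambda>l. \<integral>\<^sup>+x. indicator {x. l < u x} x * indicator E x \<partial>lebesgue) =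
                (\<lambda>l. \<mu> {x \<in> E. l < u x})"
            proof
              fix l
              have "{x \<in> space lebesgue. l < u x} \<in> \<L>" by measurable
              then have "{x \<in> space lebesgue. l < u x} \<inter> E \<in> \<L>" using E(1) by (rule sets.Int)
              moreover have "{x \<in> space lebesgue. l < u x} \<inter> E = {x \<in> E. l < u x}" by auto
              ultimately have "{x \<in> E. l < u x} \<in> \<L>" by (simp only:)
              then have "\<mu> {x \<in> E. l < u x} = (\<integral>\<^sup>+x. indicator {x \<in> E. l < u x} x \<partial>lebesgue)"
                by (rule nn_integral_indicator[symmetric])
              also have "\<dots> = (\<integral>\<^sup>+x. indicator {x. l < u x} x * indicator E x \<partial>lebesgue)"
                by (intro nn_integral_cong) (auto simp: indicator_def)
              finally show "(\<integral>\<^sup>+x. indicator {x. l < u x} x * indicator E x \<partial>lebesgue) =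
                \<mu> {x \<in> E. l < u x}" ..
            qed
            finally show ?thesis by (simp only: measurable_lborel2)
          qed
          then show ?thesis
            using l0 by (subst nn_integral_add)
              (auto simp: nn_integral_set_layers[OF um E(1)] nn_integral_cmult_indicator)
        qed
        also have "\<dots> \<le> W (ennreal t) + ennreal e"
        proof (rule add_mono)
          show "nint E u \<le> W (ennreal t)"
            using weightsD(3)[OF u E(1)] E by auto
          show "ennreal t * ennreal (\<zeta> - l0) \<le> ennreal e"
            using d \<open>0 < t\<close> by (simp add: l0_def ennreal_leI flip: ennreal_mult)
        qed
        finally show "rearrangement_integral \<gamma> u (ennreal t) \<le> W (ennreal t) + ennreal e" .
      qed
    qed
  qed
qed

text \<open>Weights in \<open>P_fun\<close> must be positive, while \<open>u\<close> may vanish.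
  Mixing a share \<open>e\<close> of \<open>w\<close> into \<open>u\<close> repairs this, and
  shrinking \<open>f\<close> by \<open>1 - e\<close> pays for it: the mixture dominates
  \<open>(1 - e) * u\<close>, so homogeneity applies. The rearrangement of the mixture is then
  admissible.\<close>

lemma P_fun_le_modular:
  assumes f: "f \<in> \<M>" and u: "u \<in> weights" and e: "0 < e" "e < 1"
  shows "P_fun \<gamma> \<phi> w (\<lambda>x. (1 - e) * f x) \<le> modular f u"
proof -
  define F where "F x = (1 - e) * f x" for x
  define u' where "u' x = (1 - e) * u x + e * cut \<gamma> w x" for x
  define v where "v t = enn2real (rearrangement \<gamma> u' t)" for t
  have F: "F \<in> \<M>" unfolding F_def[abs_def] using f by measurable
  have u': "u' \<in> weights"
    unfolding u'_def[abs_def] using e by (intro weights_convex u cut_w_weights) auto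
  note u'm = weightsD(1)[OF u']
  let ?D = "\<D> \<gamma> u'"
  have u'_pos: "0 < u' x" if "x \<in> I" "x \<noteq> 0" for x
    using that e w_decreasing weightsD(2)[OF u, of x]
    by (auto simp: u'_def cut_def positive_decreasing_def intro!: add_nonneg_pos)
  have fin: "rearrangement \<gamma> u' t = ennreal (v t)" if "t \<in> I" "0 < t" for t
    unfolding v_def using rearrangement_weight_finite[OF u' that] by simp
  have v_less: "c < v t \<longleftrightarrow> ennreal t < ?D c" if "t \<in> I" "0 < t" "0 \<le> c" for t c
    using less_rearrangement_iff[OF u'm that(3), of \<gamma> t] that(3)
    unfolding fin[OF that(1,2)] by (simp add: ennreal_less_iff)
  have D0: "\<mu> I \<le> ?D 0"
  proof -
    have "I \<subseteq> level \<gamma> u' 0 \<union> {0}" using u'_pos by fastforce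
    then have "\<mu> I \<le> \<mu> (level \<gamma> u' 0 \<union> {0})"
      by (intro emeasure_mono sets.Un level_set_measurable u'm) auto
    also have "\<dots> = ?D 0"
      unfolding distribution_function_def by (intro emeasure_Un_null_set level_set_measurable u'm) simp
    finally show ?thesis .
  qed
  have v: "positive_decreasing \<gamma> v"
    unfolding positive_decreasing_def
  proof (intro conjI ballI monotone_onI)
    fix t assume t: "t \<in> I - {0}"
    then have "0 < t" using I_of_nonneg[of t \<gamma>] by auto
    then show "0 < v t"
      using t v_less[of t 0] mem_I_of_iff[of t \<gamma>] D0 by (auto intro: order.strict_trans2)
  next
    fix s t assume st: "s \<in> I - {0}" "t \<in> I - {0}" "s \<le> t"
    then have "0 < s" "0 < t" using I_of_nonneg[of s \<gamma>] I_of_nonneg[of t \<gamma>] by auto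
    then have "ennreal (v t) \<le> ennreal (v s)"
      using rearrangement_antimono[OF st(3), of \<gamma> u'] st fin[of s] fin[of t] by simp
    then show "v s \<ge> v t" by (simp add: v_def)
  qed
  have "submajorized \<gamma> v w"
    unfolding submajorized_iff[OF v w_decreasing]
  proof (intro allI impI)
    fix t :: real assume "0 < t"
    have "\<D> \<gamma> (cut \<gamma> v) l \<le> ?D l" if "0 \<le> l" for l
    proof -
      have "{t \<in> I. l < \<bar>cut \<gamma> v t\<bar>} \<subseteq> {t. 0 \<le> t \<and> ennreal t < ?D l}"
      proof safe
        fix t assume t: "t \<in> I" "l < \<bar>cut \<gamma> v t\<bar>"
        then have t': "t \<noteq> 0" "0 \<le> t" using that I_of_nonneg by (auto simp: cut_def split: if_splits)
        then have "l < v t" using t cut_nonneg[OF v, of t] by (simp add: cut_def)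
        then show "ennreal t < ?D l" using v_less[of t l] t t' that by simp
      qed (use I_of_nonneg in auto)
      moreover have "{t. 0 \<le> t \<and> ennreal t < ?D l} \<in> \<L>"
      proof -
        have "{t. 0 \<le> t \<and> ennreal t < ?D l} \<in> sets borel" by measurable
        then show ?thesis by auto
      qed
      ultimately have "\<mu> {t \<in> I. l < \<bar>cut \<gamma> v t\<bar>} \<le> \<mu> {t. 0 \<le> t \<and> ennreal t < ?D l}"
        by (rule emeasure_mono)
      then show ?thesis
        using emeasure_lebesgue_interval_diff(1)[of 0 "?D l"] unfolding distribution_function_def by simp
    qed
    then have "rearrangement_integral \<gamma> (cut \<gamma> v) (ennreal t) \<le> rearrangement_integral \<gamma> u' (ennreal t)"
      unfolding rearrangement_integral_def
      by (intro nn_integral_mono) (auto simp: indicator_def intro: min.coboundedI2)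
    also have "\<dots> \<le> W (ennreal t)" by (rule rearrangement_integral_weight_le[OF u' \<open>0 < t\<close>])
    finally show "rearrangement_integral \<gamma> (cut \<gamma> v) (ennreal t) \<le> W (ennreal t)" .
  qed
  then have "P_fun \<gamma> \<phi> w F \<le>
      Orlicz_integral F v"
    unfolding P_fun_def using v by (intro INF_lower) auto
  also have "\<dots> = (\<integral>\<^sup>+ t. \<psi> (rearrangement \<gamma> F t * indicator I t) (cut \<gamma> v t) \<partial>lebesgue)"
    by (rule Orlicz_ext_integral[OF v])
  also have "\<dots> \<le> modular F u'"
    unfolding modular_eq
  proof (rule nn_integral_perspective_le)
    show "(\<lambda>x. ennreal \<bar>F x\<bar> * indicator I x) \<in> \<M>"
      using F I_of_sets[of \<gamma>] by measurable
    show "(\<lambda>x. rearrangement \<gamma> F x * indicator I x) \<in> \<M>"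
      by (rule rearrangement_measurable[OF F I_of_sets])
    show "\<mu> {x. ennreal l < rearrangement \<gamma> F x * indicator I x} \<le>
        \<mu> {x. ennreal l < ennreal \<bar>F x\<bar> * indicator I x}" if "0 < l" for l
      using emeasure_rearrangement_level[OF F, of l \<gamma>] that by simp
    fix l c :: real assume "0 < l" "0 < c"
    let ?Df = "\<D> \<gamma> F l"
    let ?A = "level \<gamma> u' c" and ?B = "level \<gamma> F l"
    have AB: "?A \<in> \<L>" "?B \<in> \<L>"
      by (rule level_set_measurable(1)[OF u'm], rule level_set_measurable(1)[OF F])
    let ?T = "{t. 0 \<le> t \<and> ?D c \<le> ennreal t \<and> ennreal t < ?Df}"
    have sub: "{t. cut \<gamma> v t < c \<and> ennreal l < rearrangement \<gamma> F t * indicator I t} \<subseteq>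
        ?T \<union> {0}"
    proof safe
      fix t assume t: "cut \<gamma> v t < c" "ennreal l < rearrangement \<gamma> F t * indicator I t" "t \<noteq> 0"
      then have tI: "t \<in> I" by (cases "t \<in> I") auto
      then show "0 \<le> t" by (rule I_of_nonneg)
      then have "0 < t" using t by simp
      show "?D c \<le> ennreal t"
        using v_less[OF tI \<open>0 < t\<close>, of c] t tI \<open>0 < c\<close> by (simp add: cut_def not_less[symmetric])
      show "ennreal t < ?Df"
        using less_rearrangement_iff[OF F, of l \<gamma> t] t tI \<open>0 < l\<close> by simp
    qed
    have meas: "?T \<in> \<L>"
    proof -
      have "?T \<in> sets borel" by measurable
      then show ?thesis by auto
    qed
    have "\<mu> {t. cut \<gamma> v t < c \<and> ennreal l < rearrangement \<gamma> F t * indicator I t} \<le>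
        \<mu> (?T \<union> {0})"
      using meas by (intro emeasure_mono[OF sub] sets.Un) auto
    also have "\<dots> = \<mu> ?T"
      by (rule emeasure_Un_null_set[OF meas]) simp
    \<comment> \<open>After rearrangement both level sets are initial intervals. These overlap as
      much as their measures allow, so their difference is the smallest possible.\<close>
    also have "\<dots> \<le> \<mu> (?B - ?A)"
    proof (cases "?D c")
      case top
      then have "?T = {}" by (auto simp: top_unique)
      then show ?thesis by (simp only: emeasure_empty zero_le)
    next
      case (real d)
      have "?T = {t. d \<le> t \<and> ennreal t < ?Df}"
        using real by (auto simp: ennreal_le_iff)
      then have "\<mu> ?T = ?Df - ?D c"
        using emeasure_lebesgue_interval_diff(1)[OF real(1), of ?Df] real by simp
      also have "?Df \<le> \<mu> (?A \<union> (?B - ?A))"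
        unfolding distribution_function_def using AB by (intro emeasure_mono sets.Un sets.Diff) auto
      then have "?Df - ?D c \<le> \<mu> (?B - ?A)"
        using emeasure_subadditive[OF AB(1) sets.Diff[OF AB(2,1)]] real
        by (auto simp: ennreal_minus_le_iff distribution_function_def intro: order_trans)
      finally show ?thesis .
    qed
    also have "?B - ?A = {x. u' x \<le> c \<and> ennreal l < ennreal \<bar>F x\<bar> * indicator I x}"
      using \<open>0 < l\<close> weightsD(2)[OF u'] by (auto simp: indicator_def ennreal_less_iff not_less)
    finally show "\<mu> {t. cut \<gamma> v t < c \<and> ennreal l < rearrangement \<gamma> F t * indicator I t} \<le>
        \<mu> {x. u' x \<le> c \<and> ennreal l < ennreal \<bar>F x\<bar> * indicator I x}" .
  qed (auto simp: u'm weightsD(2)[OF u'] cut_measurable[OF v] cut_nonneg[OF v] slope_inverse_nonneg slope_inverse_measurable)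
  also have "\<dots> \<le> modular f u"
    unfolding modular_def
  proof (intro nn_integral_mono mult_right_mono)
    fix t
    have "\<psi> (ennreal \<bar>F t\<bar>) (u' t) \<le> \<psi> (ennreal (1 - e) * ennreal \<bar>f t\<bar>) ((1 - e) * u t)"
      using e cut_nonneg[OF w_decreasing, of t] slope_inverse_nonneg
      by (intro perspective_mono) (auto simp: F_def u'_def abs_mult ennreal_mult)
    also have "\<dots> = ennreal (1 - e) * \<psi> (ennreal \<bar>f t\<bar>) (u t)"
      using e weightsD(2)[OF u] slope_inverse_nonneg by (intro perspective_scale) auto
    also have "\<dots> \<le> 1 * \<psi> (ennreal \<bar>f t\<bar>) (u t)"
      using e by (intro mult_right_mono) (auto simp: ennreal_le_1)
    finally show "\<psi> (ennreal \<bar>F t\<bar>) (u' t) \<le> \<psi> (ennreal \<bar>f t\<bar>) (u t)" by simp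
  qed simp
  finally show ?thesis by (simp add: F_def[abs_def])
qed

end

section \<open>The norm\<close>

context orlicz
begin

section \<open>Young's inequality and the gain from lowering a function\<close>

lemma phi_continuous: "continuous_on {0..R} \<phi>"
proof (cases "0 \<le> R")
  case True
  have p: "0 \<le> right_slope \<phi> R"
    unfolding right_slope_def using True
    by (intro cINF_greatest divide_nonneg_nonneg) (auto intro!: phi_mono)
  have "\<bar>\<phi> b - \<phi> a\<bar> \<le> right_slope \<phi> R * (b - a)" if ab: "0 \<le> a" "a < b" "b \<le> R" for a b
  proof -
    have "\<phi> b - \<phi> a \<le> right_slope \<phi> b * (b - a)" using right_slope_bounds(2)[OF ab(1,2)] .
    also have "\<dots> \<le> right_slope \<phi> R * (b - a)"
      using ab by (intro mult_right_mono right_slope_mono) auto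
    finally show ?thesis using phi_mono[of a b] ab by simp
  qed
  then have "(right_slope \<phi> R)-lipschitz_on {0..R} \<phi>"
  proof (intro lipschitz_onI p)
    fix a b assume "a \<in> {0..R}" "b \<in> {0..R}"
      and *: "\<And>a b. 0 \<le> a \<Longrightarrow> a < b \<Longrightarrow> b \<le> R \<Longrightarrow> \<bar>\<phi> b - \<phi> a\<bar> \<le> right_slope \<phi> R * (b - a)"
    then show "dist (\<phi> a) (\<phi> b) \<le> right_slope \<phi> R * dist a b"
      using *[of a b] *[of b a] by (cases a b rule: linorder_cases) (auto simp: dist_real_def abs_minus_commute)
  qed
  then show ?thesis by (rule lipschitz_on_continuous_on)
qed simp

text \<open>Superlinearity makes the expression negative beyond some \<open>R\<close>, so its
  supremum is a maximum over a compact interval. The maximiser is where Young's inequality becomes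
  an equality.\<close>

lemma conjugate_attained:
  obtains u0 where "0 \<le> u0" "\<And>u. 0 \<le> u \<Longrightarrow> s * u - \<phi> u \<le> s * u0 - \<phi> u0"
proof -
  obtain R where R: "0 < R" "\<And>v. R \<le> v \<Longrightarrow> s * v < \<phi> v" using phi_superlinear[of s] by blast
  have "\<exists>x\<in>{0..R}. \<forall>y\<in>{0..R}. s * y - \<phi> y \<le> s * x - \<phi> x"
    using R(1) by (intro continuous_attains_sup continuous_intros phi_continuous) auto
  then obtain u0 where u0: "0 \<le> u0" "\<And>y. 0 \<le> y \<Longrightarrow> y \<le> R \<Longrightarrow> s * y - \<phi> y \<le> s * u0 - \<phi> u0"
    by auto
  have "s * u - \<phi> u \<le> s * u0 - \<phi> u0" if "0 \<le> u" for u
    using u0(2)[of u] u0(2)[of 0] R(2)[of u] R(1) that by (cases "u \<le> R") auto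
  with u0(1) show thesis by (rule that)
qed

lemma perspective_Young:
  assumes M: "\<And>u. 0 \<le> u \<Longrightarrow> s * u - \<phi> u \<le> M" and "0 \<le> x" "0 \<le> y" "0 \<le> s"
  shows "ennreal (s * x) \<le> perspective (slope_inverse \<phi>) (ennreal x) y + ennreal (M * y)"
proof (cases "y = 0")
  case True
  then show ?thesis using perspective_0_right[of "ennreal x" "slope_inverse \<phi>"] assms
    by (cases "x = 0") (auto simp: ennreal_0)
next
  case False
  with assms have y: "0 < y" by simp
  have "0 \<le> M" using M[of 0] by simp
  have "s * x = y * (s * (x / y))" using y by simp
  also have "\<dots> \<le> y * (\<phi> (x / y) + M)"
    using M[of "x / y"] y assms by (intro mult_left_mono) auto
  finally have "s * x \<le> y * \<phi> (x / y) + M * y" by (simp add: algebra_simps)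
  then have "ennreal (s * x) \<le> ennreal (y * \<phi> (x / y) + M * y)" by (rule ennreal_leI)
  also have "\<dots> = ennreal (y * \<phi> (x / y)) + ennreal (M * y)"
    using y assms \<open>0 \<le> M\<close> phi_nonneg[of "x / y"] by (intro ennreal_plus) auto
  finally show ?thesis using y assms by (simp add: perspective_eq)
qed

text \<open>Since \<phi> is convex and zero at 0, lowering \<open>x\<close> by \<open>d\<close>
  takes away at least the fraction \<open>d / x\<close> of the value. That amount is
  \<open>d\<close> times \<phi>(X) / X, a quotient increasing in X, so ratios of at least
  \<open>c\<close> give a bound free of \<open>x\<close> and \<open>y\<close>.\<close>

lemma perspective_gain:
  assumes "0 < c" "0 < \<phi> c" "0 < d" "d \<le> x" "c * y \<le> x" "0 \<le> y"
  shows "perspective (slope_inverse \<phi>) (ennreal (x - d)) y + ennreal (d * (\<phi> c / c)) \<le>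
    perspective (slope_inverse \<phi>) (ennreal x) y"
proof (cases "y = 0")
  case True
  then show ?thesis using perspective_0_right[of "ennreal x" "slope_inverse \<phi>"] assms by simp
next
  case False
  with assms have y: "0 < y" by simp
  define X where "X = x / y"
  have X: "c \<le> X" "0 < X" using y assms by (auto simp: X_def field_simps)
  have "\<phi> c \<le> c / X * \<phi> X" using phi_scale_le[of "c / X" X] X assms by simp
  then have slope: "\<phi> c / c \<le> \<phi> X / X" using X assms by (simp add: field_simps)
  have "\<phi> ((x - d) / x * X) \<le> (x - d) / x * \<phi> X"
    using assms X by (intro phi_scale_le) (auto simp: field_simps)
  also have "(x - d) / x * X = (x - d) / y" using y assms by (simp add: X_def)
  finally have "y * \<phi> ((x - d) / y) \<le> y * ((x - d) / x * \<phi> X)"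
    by (rule mult_left_mono) (use y in simp)
  also have "\<dots> = y * \<phi> X - d * (\<phi> X / X)"
    using y assms by (simp add: X_def field_simps)
  also have "\<dots> \<le> y * \<phi> X - d * (\<phi> c / c)"
    using mult_left_mono[OF slope, of d] assms by linarith
  finally have "y * \<phi> ((x - d) / y) + d * (\<phi> c / c) \<le> y * \<phi> (x / y)" by (simp add: X_def)
  then show ?thesis
    using y assms phi_nonneg[of "(x - d) / y"] by (simp add: perspective_eq ennreal_leI flip: ennreal_plus)
qed

end

lemma perspective_measurable:
  assumes [measurable]: "s \<in> borel_measurable borel" "g \<in> \<M>" "u \<in> \<M>"
  shows "(\<lambda>t. perspective s (g t) (u t)) \<in> borel_measurable (lebesgue :: real measure)"
  unfolding perspective_def by (rule lborel.borel_measurable_nn_integral) measurable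

context orlicz_weight
begin

section \<open>The Amemiya expression and the triangle inequality\<close>

definition amemiya :: "real \<Rightarrow> (real \<Rightarrow> real) \<Rightarrow> (real \<Rightarrow> real) \<Rightarrow> ennreal" where
  "amemiya k f u = ennreal (1 / k) * (1 + modular (\<lambda>x. k * f x) u)"

definition fun_norm :: "(real \<Rightarrow> real) \<Rightarrow> ennreal" where
  "fun_norm f = (INF k\<in>{0<..}. ennreal (1 / k) * (1 + P_fun \<gamma> \<phi> w (\<lambda>x. k * f x)))"

text \<open>The factor lost in \<open>P_fun_le_modular\<close> is moved into the scaling,
  \<open>k\<close> becoming \<open>z * k\<close>, and \<open>z\<close> tends to 1.\<close>

lemma fun_norm_le_amemiya:
  assumes f: "f \<in> \<M>" and u: "u \<in> weights" and "0 < k"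
  shows "fun_norm f \<le> amemiya k f u"
proof (cases "amemiya k f u")
  case (real a)
  have kf: "(\<lambda>x. k * f x) \<in> \<M>" using f by measurable
  have *: "fun_norm f \<le> ennreal (a / z)" if z: "0 < z" "z < 1" for z
  proof -
    have "fun_norm f \<le> ennreal (1 / (z * k)) * (1 + P_fun \<gamma> \<phi> w (\<lambda>x. z * k * f x))"
      unfolding fun_norm_def using z \<open>0 < k\<close> by (intro INF_lower) auto
    also have "\<dots> \<le> ennreal (1 / (z * k)) * (1 + modular (\<lambda>x. k * f x) u)"
      using P_fun_le_modular[OF kf u, of "1 - z"] z
      by (intro mult_left_mono add_left_mono) (auto simp: mult.assoc)
    also have "ennreal (1 / (z * k)) = ennreal (1 / z) * ennreal (1 / k)"
      using z \<open>0 < k\<close> by (simp flip: ennreal_mult)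
    also have "\<dots> * (1 + modular (\<lambda>x. k * f x) u) = ennreal (1 / z) * amemiya k f u"
      by (simp add: amemiya_def mult.assoc)
    also have "\<dots> = ennreal (a / z)" using real z by (simp flip: ennreal_mult)
    finally show ?thesis .
  qed
  obtain x where x: "fun_norm f = ennreal x" "0 \<le> x"
    using *[of "1/2"] by (cases "fun_norm f") (auto simp: top_unique)
  have "x \<le> a"
  proof (rule field_le_mult_one_interval)
    fix z :: real assume "0 < z" "z < 1"
    then show "z * x \<le> a" using *[of z] x real by (simp add: field_simps ennreal_le_iff)
  qed
  then show ?thesis using x real by (simp add: ennreal_leI)
qed simp

text \<open>The infima over the scaling and over the decreasing weights are approximated in turn;
  \<open>exists_weight\<close> then trades the decreasing weight for one in
  \<open>weights\<close>.\<close>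

lemma fun_norm_lessD:
  assumes f: "f \<in> \<M>" and "fun_norm f < C"
  obtains k u where "0 < k" "u \<in> weights" "amemiya k f u < C"
proof -
  obtain k where k: "0 < k" "ennreal (1 / k) * (1 + P_fun \<gamma> \<phi> w (\<lambda>x. k * f x)) < C"
    using assms(2) by (auto simp: fun_norm_def INF_less_iff)
  have kf: "(\<lambda>x. k * f x) \<in> \<M>" using f by measurable
  obtain c where c: "ennreal (1 / k) * (1 + P_fun \<gamma> \<phi> w (\<lambda>x. k * f x)) < c" "c < C"
    using dense[OF k(2)] by blast
  obtain p where p: "P_fun \<gamma> \<phi> w (\<lambda>x. k * f x) = ennreal p" "0 \<le> p"
    using c(1) k(1) by (cases "P_fun \<gamma> \<phi> w (\<lambda>x. k * f x)") (auto simp: ennreal_mult_top)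
  obtain c' where c': "c = ennreal c'" "0 \<le> c'" using c(2) by (cases c) auto
  have "ennreal (1 / k) * (1 + ennreal p) = ennreal (1 / k * (1 + p))"
    using p k by (simp flip: ennreal_1 ennreal_plus ennreal_mult)
  then have "1 / k * (1 + p) < c'"
    using c(1) p c' k by (simp add: ennreal_less_iff)
  then have "p < k * c' - 1" using k by (simp add: field_simps)
  then have "P_fun \<gamma> \<phi> w (\<lambda>x. k * f x) < ennreal (k * c' - 1)"
    using p by (simp add: ennreal_less_iff)
  then obtain v where v: "submajorized \<gamma> v w" "positive_decreasing \<gamma> v"
    "Orlicz_integral (\<lambda>x. k * f x) v < ennreal (k * c' - 1)"
    unfolding P_fun_def by (auto simp: INF_less_iff)
  obtain u where u: "u \<in> weights" "modular (\<lambda>x. k * f x) u \<le>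
     Orlicz_integral (\<lambda>x. k * f x) v"
    using exists_weight[OF kf v(2,1)] by blast
  have "amemiya k f u \<le> ennreal (1 / k) * (1 + ennreal (k * c' - 1))"
    unfolding amemiya_def by (intro mult_left_mono add_left_mono less_imp_le[OF le_less_trans[OF u(2) v(3)]]) auto
  also have "\<dots> = c"
    using \<open>p < k * c' - 1\<close> p k c' by (simp flip: ennreal_1 ennreal_plus ennreal_mult)
  finally have "amemiya k f u < C" using c(2) by simp
  with k(1) u(1) show thesis by (rule that)
qed

lemma modular_convex:
  assumes f: "f1 \<in> \<M>" "f2 \<in> \<M>"
    and u: "u1 \<in> weights" "u2 \<in> weights" and ab: "0 < a" "0 < b"
  shows "modular (\<lambda>x. a * f1 x + b * f2 x) (\<lambda>x. a * u1 x + b * u2 x) \<le>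
    ennreal a * modular f1 u1 + ennreal b * modular f2 u2"
proof -
  note [measurable] = f weightsD(1)[OF u(1)] weightsD(1)[OF u(2)] I_of_sets
  have pt: "\<psi> (ennreal \<bar>a * f1 x + b * f2 x\<bar>) (a * u1 x + b * u2 x) \<le>
      ennreal a * \<psi> (ennreal \<bar>f1 x\<bar>) (u1 x) + ennreal b * \<psi> (ennreal \<bar>f2 x\<bar>) (u2 x)" for x
  proof -
    have "\<bar>a * f1 x + b * f2 x\<bar> \<le> a * \<bar>f1 x\<bar> + b * \<bar>f2 x\<bar>"
      using ab by (metis abs_mult abs_of_pos abs_triangle_ineq)
    then have "ennreal \<bar>a * f1 x + b * f2 x\<bar> \<le> ennreal (a * \<bar>f1 x\<bar> + b * \<bar>f2 x\<bar>)"
      by (rule ennreal_leI)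
    also have "\<dots> = ennreal a * ennreal \<bar>f1 x\<bar> + ennreal b * ennreal \<bar>f2 x\<bar>"
      using ab by (simp add: ennreal_mult)
    finally have "\<psi> (ennreal \<bar>a * f1 x + b * f2 x\<bar>) (a * u1 x + b * u2 x) \<le>
        \<psi> (ennreal a * ennreal \<bar>f1 x\<bar> + ennreal b * ennreal \<bar>f2 x\<bar>) (a * u1 x + b * u2 x)"
      by (rule perspective_mono) (simp_all add: slope_inverse_nonneg)
    also have "\<dots> \<le> \<psi> (ennreal a * ennreal \<bar>f1 x\<bar>) (a * u1 x) + \<psi> (ennreal b * ennreal \<bar>f2 x\<bar>) (b * u2 x)"
      using ab weightsD(2)[OF u(1)] weightsD(2)[OF u(2)] slope_inverse_nonneg by (intro perspective_add) auto
    also have "\<dots> = ennreal a * \<psi> (ennreal \<bar>f1 x\<bar>) (u1 x) + ennreal b * \<psi> (ennreal \<bar>f2 x\<bar>) (u2 x)"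
      using ab weightsD(2)[OF u(1)] weightsD(2)[OF u(2)] slope_inverse_nonneg
      by (intro arg_cong2[where f="(+)"] perspective_scale) auto
    finally show ?thesis .
  qed
  have m1: "(\<lambda>x. \<psi> (ennreal \<bar>f1 x\<bar>) (u1 x)) \<in> \<M>"
    by (rule perspective_measurable) measurable
  have m2: "(\<lambda>x. \<psi> (ennreal \<bar>f2 x\<bar>) (u2 x)) \<in> \<M>"
    by (rule perspective_measurable) measurable
  have "modular (\<lambda>x. a * f1 x + b * f2 x) (\<lambda>x. a * u1 x + b * u2 x) \<le>
     (\<integral>\<^sup>+x. ennreal a * (\<psi> (ennreal \<bar>f1 x\<bar>) (u1 x) * indicator I x) +
            ennreal b * (\<psi> (ennreal \<bar>f2 x\<bar>) (u2 x) * indicator I x) \<partial>lebesgue)"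
    unfolding modular_def using pt by (intro nn_integral_mono) (auto simp: indicator_def)
  also have "\<dots> = ennreal a * modular f1 u1 + ennreal b * modular f2 u2"
    unfolding modular_def using m1 m2 by (simp add: nn_integral_add nn_integral_cmult)
  finally show ?thesis .
qed

text \<open>The harmonic choice of \<open>k\<close> gives 1/k = 1/k1 + 1/k2 and turns k (f1 + f2)
  into a convex combination of k1 f1 and k2 f2. Combining the weights with the same coefficients
  makes joint convexity applicable. Keeping scalings and weights arbitrary allows each function to
  be altered before the two are added.\<close>

lemma fun_norm_triangle_amemiya:
  assumes f: "f1 \<in> \<M>" "f2 \<in> \<M>"
    and u: "u1 \<in> weights" "u2 \<in> weights" and k: "0 < k1" "0 < k2"
  shows "fun_norm (\<lambda>x. f1 x + f2 x) \<le> amemiya k1 f1 u1 + amemiya k2 f2 u2"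
proof -
  define S where "S = k1 + k2"
  define a b k where "a = k2 / S" and "b = k1 / S" and "k = k1 * k2 / S"
  have abk: "0 < a" "0 < b" "0 < k" "a + b = 1" "k = a * k1" "k = b * k2" "1 / k * a = 1 / k1" "1 / k * b = 1 / k2"
  proof -
    have "0 < S" using k by (simp add: S_def)
    then show "0 < a" "0 < b" "0 < k" "k = a * k1" "k = b * k2" "1 / k * a = 1 / k1" "1 / k * b = 1 / k2"
      using k by (auto simp: a_def b_def k_def)
    show "a + b = 1"
      using \<open>0 < S\<close> unfolding a_def b_def add_divide_distrib[symmetric] by (simp add: S_def)
  qed
  have m: "(\<lambda>x. k1 * f1 x) \<in> \<M>" "(\<lambda>x. k2 * f2 x) \<in> \<M>"
    "(\<lambda>x. f1 x + f2 x) \<in> \<M>"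
    using f by measurable
  have "fun_norm (\<lambda>x. f1 x + f2 x) \<le> amemiya k (\<lambda>x. f1 x + f2 x) (\<lambda>x. a * u1 x + b * u2 x)"
    using abk by (intro fun_norm_le_amemiya m weights_convex u) auto
  also have "(\<lambda>x. k * (f1 x + f2 x)) = (\<lambda>x. a * (k1 * f1 x) + b * (k2 * f2 x))"
    using abk(5,6) by (auto simp: algebra_simps)
  then have "amemiya k (\<lambda>x. f1 x + f2 x) (\<lambda>x. a * u1 x + b * u2 x) =
      ennreal (1 / k) * (1 + modular (\<lambda>x. a * (k1 * f1 x) + b * (k2 * f2 x)) (\<lambda>x. a * u1 x + b * u2 x))"
    by (simp add: amemiya_def)
  also have "\<dots> \<le> ennreal (1 / k) * (ennreal (a + b) +
      (ennreal a * modular (\<lambda>x. k1 * f1 x) u1 + ennreal b * modular (\<lambda>x. k2 * f2 x) u2))"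
    using abk by (intro mult_left_mono add_mono modular_convex m u) auto
  also have "\<dots> = (ennreal (1 / k) * ennreal a) * (1 + modular (\<lambda>x. k1 * f1 x) u1) +
      (ennreal (1 / k) * ennreal b) * (1 + modular (\<lambda>x. k2 * f2 x) u2)"
    using abk(1,2) by (simp add: distrib_left mult.assoc ac_simps)
  also have "ennreal (1 / k) * ennreal a = ennreal (1 / k1)"
    using abk(1,3) ennreal_mult[of "1 / k" a] unfolding abk(7) by simp
  also have "ennreal (1 / k) * ennreal b = ennreal (1 / k2)"
    using abk(2,3) ennreal_mult[of "1 / k" b] unfolding abk(8) by simp
  finally show ?thesis by (simp add: amemiya_def)
qed

lemma fun_norm_triangle:
  assumes f: "f1 \<in> \<M>" "f2 \<in> \<M>"
  shows "fun_norm (\<lambda>x. f1 x + f2 x) \<le> fun_norm f1 + fun_norm f2"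
proof (cases "fun_norm f1 = \<infinity> \<or> fun_norm f2 = \<infinity>")
  case False
  show ?thesis
  proof (rule ennreal_le_epsilon)
    fix e :: real assume "0 < e"
    have less: "x < x + ennreal (e / 2)" if "x \<noteq> \<infinity>" for x
      using that \<open>0 < e\<close> by (cases x) (auto simp: ennreal_less_iff simp flip: ennreal_plus)
    obtain k1 u1 where 1: "0 < k1" "u1 \<in> weights" "amemiya k1 f1 u1 < fun_norm f1 + ennreal (e / 2)"
      using fun_norm_lessD[OF f(1) less] False by blast
    obtain k2 u2 where 2: "0 < k2" "u2 \<in> weights" "amemiya k2 f2 u2 < fun_norm f2 + ennreal (e / 2)"
      using fun_norm_lessD[OF f(2) less] False by blast
    have "fun_norm (\<lambda>x. f1 x + f2 x) \<le> amemiya k1 f1 u1 + amemiya k2 f2 u2"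
      by (rule fun_norm_triangle_amemiya[OF f 1(2) 2(2) 1(1) 2(1)])
    also have "\<dots> \<le> (fun_norm f1 + ennreal (e / 2)) + (fun_norm f2 + ennreal (e / 2))"
      using 1(3) 2(3) by (intro add_mono) auto
    also have "\<dots> = fun_norm f1 + fun_norm f2 + (ennreal (e / 2) + ennreal (e / 2))"
      by (simp add: ac_simps)
    also have "ennreal (e / 2) + ennreal (e / 2) = ennreal e"
      using \<open>0 < e\<close> by (simp flip: ennreal_plus)
    finally show "fun_norm (\<lambda>x. f1 x + f2 x) \<le> fun_norm f1 + fun_norm f2 + ennreal e" .
  qed
qed auto

lemma amemiya_minus: "amemiya k (\<lambda>x. - f x) u = amemiya k f u"
  by (simp add: amemiya_def modular_def)

text \<open>Lowering \<open>k * f\<close> by \<open>k * \<theta>\<close> gains a multiple of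
  \<open>k\<close>, which cancels against the factor \<open>1 / k\<close>. So the gain depends
  neither on the scaling nor on the weight.\<close>

lemma amemiya_gain:
  assumes f: "f \<in> \<M>" and u: "u \<in> weights" and "0 < k" and c: "0 < c" "0 < \<phi> c"
    and B: "B \<in> \<L>" "B \<subseteq> I" and "0 < \<theta>"
    and low: "\<And>t. t \<in> B \<Longrightarrow> \<theta> \<le> f t \<and> c * u t \<le> k * f t"
  shows "amemiya k (\<lambda>x. f x - \<theta> * indicator B x) u + ennreal (\<theta> * (\<phi> c / c)) * \<mu> B \<le> amemiya k f u"
proof -
  note [measurable] = f weightsD(1)[OF u] I_of_sets B(1)
  let ?g = "\<lambda>x. k * (f x - \<theta> * indicator B x)"
  have m: "(\<lambda>x. \<psi> (ennreal \<bar>?g x\<bar>) (u x)) \<in> \<M>"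
    by (rule perspective_measurable) measurable
  have pt: "\<psi> (ennreal \<bar>?g x\<bar>) (u x) * indicator I x + ennreal (k * \<theta> * (\<phi> c / c)) * indicator B x \<le>
      \<psi> (ennreal \<bar>k * f x\<bar>) (u x) * indicator I x" for x
  proof (cases "x \<in> B")
    case True
    have "\<psi> (ennreal (k * f x - k * \<theta>)) (u x) + ennreal (k * \<theta> * (\<phi> c / c)) \<le> \<psi> (ennreal (k * f x)) (u x)"
      using True low[of x] c \<open>0 < k\<close> \<open>0 < \<theta>\<close> weightsD(2)[OF u] by (intro perspective_gain) auto
    moreover have "\<bar>?g x\<bar> = k * f x - k * \<theta>" "\<bar>k * f x\<bar> = k * f x"
      using True low[of x] \<open>0 < k\<close> \<open>0 < \<theta>\<close> by (auto simp: algebra_simps abs_if not_less)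
    ultimately show ?thesis using True B(2) by auto
  qed simp
  have "modular ?g u + ennreal (k * \<theta> * (\<phi> c / c)) * \<mu> B =
     (\<integral>\<^sup>+x. \<psi> (ennreal \<bar>?g x\<bar>) (u x) * indicator I x + ennreal (k * \<theta> * (\<phi> c / c)) * indicator B x \<partial>lebesgue)"
    unfolding modular_def using m B(1) by (subst nn_integral_add) (auto simp: nn_integral_cmult_indicator)
  also have "\<dots> \<le> modular (\<lambda>x. k * f x) u"
    unfolding modular_def by (rule nn_integral_mono) (rule pt)
  finally have le: "modular ?g u + ennreal (k * \<theta> * (\<phi> c / c)) * \<mu> B \<le> modular (\<lambda>x. k * f x) u" .
  have "ennreal (\<theta> * (\<phi> c / c)) = ennreal (1 / k) * ennreal (k * \<theta> * (\<phi> c / c))"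
    using \<open>0 < k\<close> \<open>0 < \<theta>\<close> c by (simp flip: ennreal_mult)
  then have "amemiya k (\<lambda>x. f x - \<theta> * indicator B x) u + ennreal (\<theta> * (\<phi> c / c)) * \<mu> B =
      ennreal (1 / k) * (1 + (modular ?g u + ennreal (k * \<theta> * (\<phi> c / c)) * \<mu> B))"
    by (simp add: amemiya_def distrib_left mult.assoc add.assoc)
  also have "\<dots> \<le> amemiya k f u"
    unfolding amemiya_def by (intro mult_left_mono add_left_mono le) simp
  finally show ?thesis .
qed

end

section \<open>A slice of small diameter\<close>

lemma ident_lebesgue_measurable [measurable]: "(\<lambda>x::real. x) \<in> \<M>"
  by (rule measurable_completion) simp

lemma interval_lebesgue_measurable [measurable]:
  "{c..d::real} \<in> \<L>" "{c<..d::real} \<in> \<L>"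
  by auto

lemma ennreal_le_sumD:
  "ennreal p \<le> ennreal x + ennreal y + ennreal z \<Longrightarrow> 0 \<le> x \<Longrightarrow> 0 \<le> y \<Longrightarrow> 0 \<le> z \<Longrightarrow> p \<le> x + y + z"
  by (simp add: ennreal_le_iff flip: ennreal_plus)

context orlicz_weight
begin

text \<open>As a gauge integral \<open>W\<close> inherits the continuity of indefinite integrals,
  used to choose \<open>a\<close> by the intermediate value theorem.\<close>

lemma W_integral:
  assumes t: "t \<in> I"
  shows "cut \<gamma> w integrable_on {0..t}" "W (ennreal t) = ennreal (integral {0..t} (cut \<gamma> w))"
proof -
  obtain r where r: "W (ennreal t) = ennreal r" "0 \<le> r"
    using W_eq(2)[OF t] by (cases "W (ennreal t)") auto
  let ?h = "\<lambda>s. if s \<in> {0..t} then cut \<gamma> w s else 0"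
  have "?h \<in> \<M>"
    using cut_measurable[OF w_decreasing] by measurable
  moreover have "(\<integral>\<^sup>+s. ennreal (?h s) \<partial>lebesgue) = ennreal r"
    unfolding r(1)[symmetric] W_eq(1)[OF t] by (intro nn_integral_cong) (auto simp: indicator_def)
  moreover have "\<And>s. 0 \<le> ?h s" using cut_nonneg[OF w_decreasing] by simp
  ultimately have "(?h has_integral r) UNIV"
    using r has_integral_iff_nn_integral_lebesgue[of ?h r] by blast
  then have "(cut \<gamma> w has_integral r) {0..t}" by (simp only: has_integral_restrict_UNIV)
  then show "cut \<gamma> w integrable_on {0..t}" "W (ennreal t) = ennreal (integral {0..t} (cut \<gamma> w))"
    using r by (auto simp: integral_unique)
qed

lemma w_pos: "t \<in> I \<Longrightarrow> 0 < t \<Longrightarrow> 0 < w t"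
  using w_decreasing by (simp add: positive_decreasing_def)

text \<open>Quantifies that \<open>W\<close> is strictly increasing on \<open>I\<close>, so that a
  weight carrying almost \<open>W a\<close> cannot do so on a much smaller set.\<close>

lemma W_gap:
  assumes t: "t \<in> I" "0 \<le> s" "s < t"
  shows "W (ennreal s) + ennreal (w t * (t - s)) \<le> W (ennreal t)"
proof -
  have s: "s \<in> I" using I_of_downward[OF t(1,2)] t(3) by simp
  have anti: "w t \<le> cut \<gamma> w r" if "s < r" "r \<le> t" for r
    using w_decreasing that t I_of_downward[OF t(1), of r]
    by (auto simp: positive_decreasing_def monotone_on_def cut_def)
  note [measurable] = cut_measurable[OF w_decreasing]
  have e1: "ennreal (w t * (t - s)) = (\<integral>\<^sup>+r. ennreal (w t) * indicator {s<..t} r \<partial>lebesgue)"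
    using t w_pos[OF t(1)] by (simp add: nn_integral_cmult_indicator ennreal_mult less_imp_le)
  have "W (ennreal s) + ennreal (w t * (t - s)) =
      (\<integral>\<^sup>+r. ennreal (cut \<gamma> w r) * indicator {0..s} r + ennreal (w t) * indicator {s<..t} r \<partial>lebesgue)"
    unfolding W_eq(1)[OF s] e1 by (rule nn_integral_add[symmetric]) measurable
  also have "\<dots> \<le> nint {0..t} (cut \<gamma> w)"
    using t anti by (intro nn_integral_mono) (auto simp: indicator_def intro: ennreal_leI)
  also have "\<dots> = W (ennreal t)" by (rule W_eq(1)[OF t(1), symmetric])
  finally show ?thesis .
qed

lemma slice_parameters:
  obtains a s0 M u0 u3 where
    "0 < a" "a \<in> I" "0 < s0" "0 < M" "W (ennreal a) = ennreal (1 / M)"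
    "\<And>u. 0 \<le> u \<Longrightarrow> s0 * u - \<phi> u \<le> M" "0 \<le> u0" "s0 * u0 - \<phi> u0 = M"
    "0 < u3" "0 < \<phi> u3" "s0 * u3 < M"
proof -
  obtain u3 where u3: "0 \<le> u3" "\<phi> u3 \<noteq> 0" using phi_nontrivial by blast
  then have u3': "0 < u3" "0 < \<phi> u3" using phi_nonneg[of u3] by (auto simp: less_le)
  obtain q where q: "ereal 0 < q" "q < \<gamma>" using dense[OF \<gamma>_pos] by (auto simp: zero_ereal_def)
  then obtain t1 where t1: "0 < t1" "t1 \<in> I" by (cases q) (auto simp: I_of_def)
  define y1 where "y1 = integral {0..t1} (cut \<gamma> w)"
  have Wy1: "W (ennreal t1) = ennreal y1" unfolding y1_def by (rule W_integral(2)[OF t1(2)])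
  have "0 < W (ennreal t1)"
    using W_gap[OF t1(2), of 0] t1 w_pos[OF t1(2)]
    by (auto intro: order.strict_trans2[of _ "ennreal (w t1 * t1)"] simp: zero_less_iff_neq_zero)
  then have y1: "0 < y1" using Wy1 by simp
  \<comment> \<open>Testing the conjugate at \<open>u3 + 1\<close> gives
    \<open>M \<ge> s0 * u3 + 1 + 1 / y1\<close>. The summand 1 makes Young's inequality strict at
    ratios up to \<open>u3\<close>, and \<open>1 / y1\<close> brings \<open>1 / M\<close> below the
    mass \<open>y1\<close> of the weight on [0, t1].\<close>
  define s0 where "s0 = \<phi> (u3 + 1) + 1 + 1 / y1"
  have s0: "0 < s0" using phi_nonneg[of "u3 + 1"] u3' y1 by (simp add: s0_def add_nonneg_pos add_pos_pos)
  obtain u0 where u0: "0 \<le> u0" "\<And>u. 0 \<le> u \<Longrightarrow> s0 * u - \<phi> u \<le> s0 * u0 - \<phi> u0"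
    using conjugate_attained[of s0] by blast
  define M where "M = s0 * u0 - \<phi> u0"
  have M: "s0 * u3 + 1 + 1 / y1 \<le> M"
  proof -
    have "s0 * u3 + 1 + 1 / y1 = s0 * (u3 + 1) - \<phi> (u3 + 1)"
      by (simp add: distrib_left) (simp add: s0_def)
    also have "\<dots> \<le> M" using u0(2)[of "u3 + 1"] u3' by (simp add: M_def)
    finally show ?thesis .
  qed
  then have M': "s0 * u3 < M" "1 / y1 \<le> M" "0 < M"
    using s0 u3' y1 by (smt (verit) mult_pos_pos divide_pos_pos)+
  have My: "1 / M \<le> y1" using M' y1 by (simp add: field_simps)
  have "continuous_on {0..t1} (\<lambda>t. integral {0..t} (cut \<gamma> w))"
    by (rule indefinite_integral_continuous_1[OF W_integral(1)[OF t1(2)]])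
  then obtain a where a: "0 \<le> a" "a \<le> t1" "integral {0..a} (cut \<gamma> w) = 1 / M"
    using IVT'[of "\<lambda>t. integral {0..t} (cut \<gamma> w)" 0 "1 / M" t1] t1 My M'(3)
    by (auto simp: y1_def)
  have aI: "a \<in> I" using I_of_downward[OF t1(2) a(1,2)] .
  have "0 < a" using a M'(3) by (cases "a = 0") auto
  moreover have "W (ennreal a) = ennreal (1 / M)" using W_integral(2)[OF aI] a(3) by simp
  ultimately show thesis
    by (rule that[OF _ aI s0 M'(3) _ u0(2)[folded M_def] u0(1) M_def[symmetric] u3' M'(1)])
qed

end

text \<open>
  \<open>M\<close> is the conjugate \<open>\<phi>\<^sub>*(s0)\<close>, attained at \<open>u0\<close>; the choice of \<open>a\<close> in terms of \<open>M\<close> makes the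
  functional \<open>f \<mapsto> s0 \<integral>\<^sub>0\<^sup>a f\<close> have norm one.
\<close>

locale orlicz_slice = orlicz_weight +
  fixes a s0 M u0 u3 :: real
  assumes a: "0 < a" "a \<in> I" and s0: "0 < s0" and M: "0 < M" and Wa: "W (ennreal a) = ennreal (1 / M)"
    and Young: "\<And>u. 0 \<le> u \<Longrightarrow> s0 * u - \<phi> u \<le> M" and u0: "0 \<le> u0" "s0 * u0 - \<phi> u0 = M"
    and u3: "0 < u3" "0 < \<phi> u3" "s0 * u3 < M"
begin

abbreviation "A \<equiv> {0..a}"

section \<open>The functional of norm one\<close>

lemma A_subset: "A \<subseteq> I" using I_of_downward[OF a(2)] by auto

lemma weight_integral_A:
  assumes u: "u \<in> weights"
  shows "nint A u \<le> ennreal (1 / M)"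
  using weightsD(3)[OF u, of A] A_subset a(1) Wa by simp

text \<open>The integrated form of Young-type inequalities on \<open>A\<close>, where
  \<open>\<kappa>\<close> and \<open>C\<close> record a surplus on part of \<open>A\<close>. It is
  applied with slope \<open>s0\<close>, with slope \<open>2 * s0\<close>, and with slope
  \<open>s0\<close> and a surplus.\<close>

lemma modular_lower:
  assumes f: "f \<in> \<M>" and u: "u \<in> weights" and "0 < k"
    and C: "C \<in> \<L>" "C \<subseteq> A" "0 \<le> \<kappa>" "0 \<le> s" "0 \<le> N"
    and pt: "\<And>t. t \<in> A \<Longrightarrow> ennreal (s * (k * \<bar>f t\<bar>)) + ennreal (\<kappa> * u t) * indicator C t \<le>
        \<psi> (ennreal (k * \<bar>f t\<bar>)) (u t) + ennreal (N * u t)"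
  shows "ennreal (s * k) * nint A (\<lambda>t. \<bar>f t\<bar>) + ennreal \<kappa> * nint C u
    \<le> modular (\<lambda>x. k * f x) u + ennreal N * nint A u"
proof -
  note [measurable] = f weightsD(1)[OF u] C(1) I_of_sets
  have m: "(\<lambda>t. \<psi> (ennreal (k * \<bar>f t\<bar>)) (u t)) \<in> \<M>"
    by (rule perspective_measurable) measurable
  have "ennreal (s * k) * nint A (\<lambda>t. \<bar>f t\<bar>) + ennreal \<kappa> * nint C u =
     (\<integral>\<^sup>+t. ennreal (s * k) * (ennreal \<bar>f t\<bar> * indicator A t) + ennreal \<kappa> * (ennreal (u t) * indicator C t) \<partial>lebesgue)"
    by (subst nn_integral_add) (measurable, simp add: nn_integral_cmult)
  also have "\<dots> \<le> (\<integral>\<^sup>+t. \<psi> (ennreal (k * \<bar>f t\<bar>)) (u t) * indicator I t + ennreal N * (ennreal (u t) * indicator A t) \<partial>lebesgue)"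
  proof (rule nn_integral_mono)
    fix t
    show "ennreal (s * k) * (ennreal \<bar>f t\<bar> * indicator A t) + ennreal \<kappa> * (ennreal (u t) * indicator C t) \<le>
      \<psi> (ennreal (k * \<bar>f t\<bar>)) (u t) * indicator I t + ennreal N * (ennreal (u t) * indicator A t)"
    proof (cases "t \<in> A")
      case True
      have "ennreal (s * k) * ennreal \<bar>f t\<bar> = ennreal (s * (k * \<bar>f t\<bar>))"
        using C \<open>0 < k\<close> by (simp add: mult.assoc flip: ennreal_mult)
      moreover have "ennreal \<kappa> * ennreal (u t) = ennreal (\<kappa> * u t)" "ennreal N * ennreal (u t) = ennreal (N * u t)"
        using C weightsD(2)[OF u] by (simp_all flip: ennreal_mult)
      ultimately show ?thesis using pt[OF True] True A_subset by (auto simp: mult.assoc[symmetric])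
    next
      case False
      then show ?thesis using C(2) by (auto simp: indicator_def)
    qed
  qed
  also have "\<dots> = modular (\<lambda>x. k * f x) u + ennreal N * nint A u"
    unfolding modular_def using m \<open>0 < k\<close>
    by (subst nn_integral_add) (auto simp: abs_mult nn_integral_cmult)
  finally show ?thesis .
qed

text \<open>The weight has mass at most \<open>1 / M\<close> on \<open>A\<close>, so the conjugate
  term in Young's inequality contributes at most 1, the constant in the Amemiya expression.\<close>

lemma functional_le_amemiya:
  assumes f: "f \<in> \<M>" and u: "u \<in> weights" and k: "0 < k"
  shows "ennreal s0 * nint A (\<lambda>t. \<bar>f t\<bar>) \<le> amemiya k f u"
proof -
  have "ennreal (s0 * k) * nint A (\<lambda>t. \<bar>f t\<bar>) + ennreal 0 * nint {} u
    \<le> modular (\<lambda>x. k * f x) u + ennreal M * nint A u"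
    using perspective_Young[OF Young] k s0 M weightsD(2)[OF u]
    by (intro modular_lower[OF f u]) auto
  also have "\<dots> \<le> modular (\<lambda>x. k * f x) u + ennreal M * ennreal (1 / M)"
    by (intro add_left_mono mult_left_mono weight_integral_A u) simp
  also have "ennreal M * ennreal (1 / M) = 1" using M by (simp flip: ennreal_mult)
  finally have *: "ennreal (s0 * k) * nint A (\<lambda>t. \<bar>f t\<bar>) \<le> 1 + modular (\<lambda>x. k * f x) u"
    by (simp add: add.commute)
  have "ennreal s0 = ennreal (1 / k) * ennreal (s0 * k)" using k s0 by (simp flip: ennreal_mult)
  then have "ennreal s0 * nint A (\<lambda>t. \<bar>f t\<bar>) =
      ennreal (1 / k) * (ennreal (s0 * k) * nint A (\<lambda>t. \<bar>f t\<bar>))"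
    by (simp add: mult.assoc)
  also have "\<dots> \<le> amemiya k f u" unfolding amemiya_def by (intro mult_left_mono *) simp
  finally show ?thesis .
qed

lemma functional_le_norm:
  assumes f: "f \<in> \<M>"
  shows "ennreal s0 * nint A (\<lambda>t. \<bar>f t\<bar>) \<le> fun_norm f"
proof (rule ccontr)
  assume "\<not> ?thesis"
  then obtain k u where "0 < k" "u \<in> weights" "amemiya k f u < ennreal s0 * nint A (\<lambda>t. \<bar>f t\<bar>)"
    using fun_norm_lessD[OF f] by (auto simp: not_le)
  with functional_le_amemiya[OF f, of u k] show False by auto
qed

definition functional :: "(real \<Rightarrow> real) \<Rightarrow> real" where
  "functional f = s0 * (LINT t|lebesgue. f t * indicator A t)"

lemma integrable_A:
  assumes f: "f \<in> \<M>" and fin: "fun_norm f < \<infinity>"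
  shows "integrable lebesgue (\<lambda>t. f t * indicator A t)"
proof (rule integrableI_bounded)
  show "(\<lambda>t. f t * indicator A t) \<in> \<M>" using f by measurable
  have "ennreal s0 * nint A (\<lambda>t. \<bar>f t\<bar>) < \<infinity>"
    using functional_le_norm[OF f] fin by (rule order.strict_trans1)
  then have "nint A (\<lambda>t. \<bar>f t\<bar>) < \<infinity>"
    using s0 by (auto simp: ennreal_mult_less_top ennreal_mult_eq_top_iff less_top)
  moreover have "(\<integral>\<^sup>+t. ennreal (norm (f t * indicator A t)) \<partial>lebesgue) = nint A (\<lambda>t. \<bar>f t\<bar>)"
    by (intro nn_integral_cong) (auto simp: indicator_def)
  ultimately show "(\<integral>\<^sup>+t. ennreal (norm (f t * indicator A t)) \<partial>lebesgue) < \<infinity>" by simp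
qed

lemma functional_abs_le:
  assumes f: "f \<in> \<M>"
  shows "ennreal \<bar>functional f\<bar> \<le> fun_norm f"
proof (cases "fun_norm f < \<infinity>")
  case True
  have int: "integrable lebesgue (\<lambda>t. \<bar>f t\<bar> * indicator A t)"
    using integrable_abs[OF integrable_A[OF f True]] by (simp add: abs_mult)
  have "\<bar>functional f\<bar> \<le> s0 * (LINT t|lebesgue. \<bar>f t\<bar> * indicator A t)"
    using integral_abs_bound[of lebesgue "\<lambda>t. f t * indicator A t"] s0
    by (simp add: functional_def abs_mult)
  then have "ennreal \<bar>functional f\<bar> \<le> ennreal s0 * ennreal (LINT t|lebesgue. \<bar>f t\<bar> * indicator A t)"
    using s0 by (subst ennreal_mult[symmetric]) (auto intro: ennreal_leI Bochner_Integration.integral_nonneg)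
  also have "ennreal (LINT t|lebesgue. \<bar>f t\<bar> * indicator A t) = (\<integral>\<^sup>+t. ennreal (\<bar>f t\<bar> * indicator A t) \<partial>lebesgue)"
    by (rule nn_integral_eq_integral[symmetric, OF int]) auto
  also have "\<dots> = nint A (\<lambda>t. \<bar>f t\<bar>)"
    by (intro nn_integral_cong) (auto simp: indicator_def)
  also have "ennreal s0 * \<dots> \<le> fun_norm f" by (rule functional_le_norm[OF f])
  finally show ?thesis .
qed (simp add: less_top[symmetric])

section \<open>Near-maximisers are large on most of the interval\<close>

lemma large_values_measurable:
  assumes f [measurable]: "f \<in> \<M>" and u: "u \<in> weights"
  shows "{t \<in> A. \<theta> \<le> f t \<and> u3 * u t \<le> k * f t} \<in> \<L>"
proof -
  note [measurable] = weightsD(1)[OF u]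
  have "{t \<in> space lebesgue. t \<in> A \<and> \<theta> \<le> f t \<and> u3 * u t \<le> k * f t} \<in> \<L>" by measurable
  then show ?thesis by simp
qed

text \<open>The weight must carry almost \<open>1 / M\<close>, the value of \<open>W\<close> at
  \<open>a\<close>, on \<open>A\<close>. Little of this lies where
  \<open>k * \<bar>f t\<bar> < u3 * u t\<close>, where Young's inequality is strict. Elsewhere
  \<open>u\<close> is controlled by \<bar>f\<bar>, so little lies where f is below
  \<open>\<theta>\<close>. The good set thus carries more than \<open>W\<close> at
  \<open>2 * a / 3\<close>, and the constraint on weights converts this into measure.\<close>

lemma slice_large_values:
  obtains \<epsilon> \<theta> :: real where "0 < \<epsilon>" "\<epsilon> < 1" "0 < \<theta>"
    "\<And>f k u. f \<in> \<M> \<Longrightarrow> integrable lebesgue (\<lambda>t. f t * indicator A t) \<Longrightarrow>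
       0 < k \<Longrightarrow> u \<in> weights \<Longrightarrow> amemiya k f u \<le> ennreal (1 + \<epsilon>) \<Longrightarrow> 1 - \<epsilon> \<le> functional f \<Longrightarrow>
       ennreal (2 * a / 3) \<le> \<mu> {t \<in> A. \<theta> \<le> f t \<and> u3 * u t \<le> k * f t}"
proof -
  \<comment> \<open>The doubled slope is there to bound \<open>k\<close>: it raises the left side of
    the integrated inequality to about \<open>2 * k\<close>, while the right side is at most about
    \<open>k\<close> plus the constant \<open>M2 / M\<close>.\<close>
  obtain v0 where v0: "0 \<le> v0" "\<And>u. 0 \<le> u \<Longrightarrow> 2 * s0 * u - \<phi> u \<le> 2 * s0 * v0 - \<phi> v0"
    using conjugate_attained[of "2 * s0"] by blast
  define M2 where "M2 = 2 * s0 * v0 - \<phi> v0"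
  have M2: "2 * s0 * u - \<phi> u \<le> M2" if "0 \<le> u" for u using v0(2)[OF that] by (simp add: M2_def)
  have "0 \<le> s0 * u0" using s0 u0 by simp
  then have M2_pos: "0 < M2" using M2[OF u0(1)] u0(2) M by (simp add: algebra_simps)
  define \<kappa> where "\<kappa> = M - s0 * u3"
  have \<kappa>: "0 < \<kappa>" using u3 by (simp add: \<kappa>_def)
  define K where "K = 2 * M2 / M"
  have K: "0 < K" using M2_pos M by (simp add: K_def)
  have third: "2 * a / 3 \<in> I" using I_of_downward[OF a(2), of "2 * a / 3"] a(1) by simp
  obtain W2 where W2: "W (ennreal (2 * a / 3)) = ennreal W2" "0 \<le> W2"
    using W_eq(2)[OF third] by (cases "W (ennreal (2 * a / 3))") auto
  define g where "g = 1 / M - W2"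
  have "ennreal W2 + ennreal (w a * (a - 2 * a / 3)) \<le> ennreal (1 / M)"
    using W_gap[OF a(2), of "2 * a / 3"] a(1) by (simp add: W2 Wa)
  moreover have wa: "0 < w a * (a - 2 * a / 3)" using w_pos[OF a(2,1)] a(1) by simp
  ultimately have "W2 + w a * (a - 2 * a / 3) \<le> 1 / M"
    using W2 M by (simp add: ennreal_le_iff flip: ennreal_plus)
  then have g: "0 < g" using wa by (simp add: g_def)
  \<comment> \<open>The surplus mass \<open>g\<close> is split in three. \<open>\<theta>\<close>
    spends one third on points below it. \<open>\<epsilon>\<close> spends another on the defects
    summed in \<open>C\<close>: mass of \<open>u\<close> missing on \<open>A\<close>, mass where
    Young's inequality is strict, and the negative part of \<open>f\<close>. The last third keeps
    the conclusion strict. The bound \<open>1 / 6\<close> on \<open>\<epsilon>\<close> serves the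
    estimate of \<open>k\<close>.\<close>
  define \<theta> where "\<theta> = g * u3 / (3 * K * a)"
  have \<theta>: "0 < \<theta>" "K / u3 * (\<theta> * a) = g / 3" using g u3 K a by (auto simp: \<theta>_def)
  define C where "C = 2 * K / M + 2 * K / \<kappa> + 2 * K / (u3 * s0)"
  have C: "0 < C" using K M \<kappa> u3 s0 by (simp add: C_def add_pos_pos)
  define \<epsilon> where "\<epsilon> = min (1 / 6) (g / (3 * C))"
  have \<epsilon>: "0 < \<epsilon>" "\<epsilon> \<le> 1 / 6" "\<epsilon> * C \<le> g / 3"
    using g C by (auto simp: \<epsilon>_def min_def field_simps)
  show thesis
  proof (rule that[of \<epsilon> \<theta>])
    fix f u :: "real \<Rightarrow> real" and k :: real
    assume f: "f \<in> \<M>" and int: "integrable lebesgue (\<lambda>t. f t * indicator A t)"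
      and k: "0 < k" and u: "u \<in> weights" and am: "amemiya k f u \<le> ennreal (1 + \<epsilon>)"
      and fn: "1 - \<epsilon> \<le> functional f"
    note [measurable] = f weightsD(1)[OF u]
    let ?G = "{t \<in> A. \<theta> \<le> f t \<and> u3 * u t \<le> k * f t}"
    let ?C = "{t \<in> A. k * \<bar>f t\<bar> < u3 * u t}"
    have GC: "?G \<in> \<L>" "?C \<in> \<L>"
    proof -
      have "{t \<in> space lebesgue. t \<in> A \<and> k * \<bar>f t\<bar> < u3 * u t} \<in> \<L>" by measurable
      then show "?C \<in> \<L>" by simp
    qed (rule large_values_measurable[OF f u])
    have sub: "?G \<subseteq> A" "?C \<subseteq> A" by auto
    have inta: "integrable lebesgue (\<lambda>t. \<bar>f t\<bar> * indicator A t)"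
      using integrable_abs[OF int] by (simp add: abs_mult)
    define x y where "x = (LINT t|lebesgue. \<bar>f t\<bar> * indicator A t)" and "y = (LINT t|lebesgue. f t * indicator A t)"
    have x0: "0 \<le> x" unfolding x_def by (rule Bochner_Integration.integral_nonneg) simp
    have X: "nint A (\<lambda>t. \<bar>f t\<bar>) = ennreal x"
    proof -
      have "nint A (\<lambda>t. \<bar>f t\<bar>) = (\<integral>\<^sup>+t. ennreal (\<bar>f t\<bar> * indicator A t) \<partial>lebesgue)"
        by (intro nn_integral_cong) (auto simp: indicator_def)
      also have "\<dots> = ennreal x" unfolding x_def by (rule nn_integral_eq_integral[OF inta]) auto
      finally show ?thesis .
    qed
    obtain m where m: "modular (\<lambda>x. k * f x) u = ennreal m" "0 \<le> m"
      using am k by (cases "modular (\<lambda>x. k * f x) u") (auto simp: amemiya_def ennreal_mult_top top_unique)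
    have "ennreal (1 / k) * (1 + ennreal m) = ennreal (1 / k * (1 + m))"
      using m k by (simp flip: ennreal_1 ennreal_plus ennreal_mult)
    then have "ennreal (1 / k * (1 + m)) \<le> ennreal (1 + \<epsilon>)"
      using am unfolding amemiya_def m(1) by (simp only:)
    then have "1 / k * (1 + m) \<le> 1 + \<epsilon>" by (subst (asm) ennreal_le_iff) (use \<epsilon> in auto)
    then have mk: "1 + m \<le> k * (1 + \<epsilon>)" using k by (simp add: field_simps)
    have y: "1 - \<epsilon> \<le> s0 * y" using fn by (simp add: functional_def y_def)
    have "y \<le> x" unfolding x_def y_def
      by (rule integral_mono[OF int inta]) (auto simp: indicator_def)
    then have xy: "s0 * y \<le> s0 * x" using s0 by simp
    have "ennreal s0 * ennreal x \<le> ennreal (1 + \<epsilon>)"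
      using functional_le_amemiya[OF f u k] am unfolding X by (rule order_trans)
    then have "ennreal (s0 * x) \<le> ennreal (1 + \<epsilon>)" using s0 x0 by (simp only: ennreal_mult less_imp_le)
    then have x1: "s0 * x \<le> 1 + \<epsilon>" by (subst (asm) ennreal_le_iff) (use \<epsilon> in auto)
    define part where "part S = enn2real (nint S u)" for S
    have part: "nint S u = ennreal (part S)" "0 \<le> part S" if "S \<subseteq> A" for S
    proof -
      have "nint S u \<le> nint A u"
        using that by (intro nn_integral_mono) (auto simp: indicator_def)
      also have "\<dots> < \<infinity>" using weight_integral_A[OF u] by (rule order.strict_trans1) simp
      finally show "nint S u = ennreal (part S)" "0 \<le> part S"
        by (auto simp: part_def)
    qed
    have partA: "part A \<le> 1 / M" using weight_integral_A[OF u] part[OF order_refl] M by (simp add: ennreal_le_iff)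
    have "ennreal (2 * s0 * k) * ennreal x + ennreal 0 * nint {} u
      \<le> ennreal m + ennreal M2 * ennreal (part A)"
      unfolding X[symmetric] m(1)[symmetric] part(1)[OF order_refl, symmetric]
      using perspective_Young[OF M2] k s0 M2_pos weightsD(2)[OF u]
      by (intro modular_lower[OF f u]) auto
    then have "2 * s0 * k * x \<le> m + M2 * part A"
      using s0 k x0 m(2) M2_pos part(2)[OF order_refl] by (simp add: ennreal_le_iff flip: ennreal_mult ennreal_plus)
    also have "\<dots> \<le> m + M2 * (1 / M)" using partA M2_pos by (intro add_left_mono mult_left_mono) auto
    finally have "2 * (k * (s0 * x)) \<le> m + K / 2" by (simp add: K_def algebra_simps)
    moreover have kx: "k * (1 - \<epsilon>) \<le> k * (s0 * x)" using xy y k by (intro mult_left_mono) auto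
    ultimately have "2 * (k * (1 - \<epsilon>)) \<le> k * (1 + \<epsilon>) + K / 2" using mk by linarith
    then have "k * (1 - 3 * \<epsilon>) \<le> K / 2" by (simp add: algebra_simps)
    moreover have "k * (1 / 2) \<le> k * (1 - 3 * \<epsilon>)" using k \<epsilon> by (intro mult_left_mono) auto
    ultimately have kK: "k \<le> K" by simp
    \<comment> \<open>On \<open>?C\<close> the ratio is below \<open>u3\<close>, so
      \<open>s0 * (k * \<bar>f t\<bar>)\<close> falls short of \<open>M * u t\<close> by at least
      \<open>\<kappa> * u t\<close>, even before the modular is counted.\<close>
    have "ennreal (s0 * k) * ennreal x + ennreal \<kappa> * ennreal (part ?C) \<le> ennreal m + ennreal M * ennreal (part A)"
      unfolding X[symmetric] m(1)[symmetric] part(1)[OF order_refl, symmetric] part(1)[OF sub(2), symmetric]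
    proof (intro modular_lower[OF f u k GC(2)])
      fix t assume t: "t \<in> A"
      show "ennreal (s0 * (k * \<bar>f t\<bar>)) + ennreal (\<kappa> * u t) * indicator ?C t \<le>
          \<psi> (ennreal (k * \<bar>f t\<bar>)) (u t) + ennreal (M * u t)"
      proof (cases "t \<in> ?C")
        case True
        have "s0 * (k * \<bar>f t\<bar>) \<le> s0 * (u3 * u t)" using True s0 by (intro mult_left_mono) auto
        then have "s0 * (k * \<bar>f t\<bar>) + \<kappa> * u t \<le> M * u t" by (simp add: \<kappa>_def algebra_simps)
        then have "ennreal (s0 * (k * \<bar>f t\<bar>)) + ennreal (\<kappa> * u t) \<le> ennreal (M * u t)"
          using s0 k \<kappa> weightsD(2)[OF u, of t] by (simp add: ennreal_leI flip: ennreal_plus)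
        then show ?thesis using True by (simp add: add_increasing)
      next
        case False
        then show ?thesis
          using perspective_Young[OF Young, of "k * \<bar>f t\<bar>" "u t"] k s0 weightsD(2)[OF u, of t] by simp
      qed
    qed (use \<kappa> s0 M in auto)
    then have E: "s0 * k * x + \<kappa> * part ?C \<le> m + M * part A"
      using s0 k x0 m(2) M \<kappa> part(2)[OF order_refl] part(2)[OF sub(2)]
      by (simp add: ennreal_le_iff flip: ennreal_mult ennreal_plus)
    \<comment> \<open>The inequality \<open>E\<close> is read twice: with the upper bound for
      \<open>part A\<close> it makes \<open>part ?C\<close> small, and with \<open>part ?C\<close>
      dropped it makes \<open>part A\<close> large.\<close>
    have "M * part A \<le> 1" using partA M by (simp add: field_simps)
    with E mk kx have "\<kappa> * part ?C \<le> 2 * \<epsilon> * k" by (simp add: algebra_simps)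
    also have "\<dots> \<le> 2 * \<epsilon> * K" using kK \<epsilon> by (intro mult_left_mono) auto
    finally have C_small: "part ?C \<le> \<epsilon> * (2 * K / \<kappa>)" using \<kappa> by (simp add: field_simps)
    have "0 \<le> \<kappa> * part ?C" using \<kappa> part(2)[OF sub(2)] by auto
    with E mk kx have "1 - 2 * \<epsilon> * k \<le> M * part A" by (simp add: algebra_simps)
    moreover have "2 * \<epsilon> * k \<le> 2 * \<epsilon> * K" using kK \<epsilon> by (intro mult_left_mono) auto
    ultimately have "1 - 2 * \<epsilon> * K \<le> M * part A" by linarith
    then have A_large: "1 / M - \<epsilon> * (2 * K / M) \<le> part A" using M by (simp add: field_simps)
    \<comment> \<open>A majorant of \<open>u\<close> on the points of \<open>A\<close> outside
      \<open>?G\<close> and \<open>?C\<close>: there f < \<theta>, hence \<bar>f\<bar> \<le>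
      \<theta> + \<bar>f\<bar> - f. The integral of \<bar>f\<bar> - f is small because the integrals
      of \<bar>f\<bar> and of f are both close to \<open>1 / s0\<close>.\<close>
    let ?r = "\<lambda>t. K / u3 * (\<theta> * indicator A t + \<bar>f t\<bar> * indicator A t - f t * indicator A t)"
    have intr: "integrable lebesgue ?r"
      using inta int a(1) by (intro integrable_mult_right Bochner_Integration.integrable_diff Bochner_Integration.integrable_add) auto
    have r0: "0 \<le> ?r t" for t using K u3 \<theta> by (auto simp: indicator_def intro!: mult_nonneg_nonneg)
    have int_r: "(LINT t|lebesgue. ?r t) = K / u3 * (\<theta> * a + x - y)"
      using inta int a(1) by (simp add: x_def y_def Bochner_Integration.integral_diff Bochner_Integration.integral_add)
    have R: "(\<integral>\<^sup>+t. ennreal (?r t) \<partial>lebesgue) = ennreal (K / u3 * (\<theta> * a + x - y))"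
      unfolding int_r[symmetric] by (rule nn_integral_eq_integral[OF intr AE_I2]) (rule r0)
    have "ennreal (part A) \<le> (\<integral>\<^sup>+t. (ennreal (u t) * indicator ?G t + ennreal (u t) * indicator ?C t) + ennreal (?r t) \<partial>lebesgue)"
      unfolding part(1)[OF order_refl, symmetric]
    proof (rule nn_integral_mono)
      fix t
      show "ennreal (u t) * indicator A t \<le>
        (ennreal (u t) * indicator ?G t + ennreal (u t) * indicator ?C t) + ennreal (?r t)"
      proof (cases "t \<in> A \<and> t \<notin> ?G \<and> t \<notin> ?C")
        case False
        then show ?thesis by (cases "t \<in> A"; cases "t \<in> ?G") (auto intro: add_increasing2 add_increasing)
      next
        case True
        then have le: "u3 * u t \<le> k * \<bar>f t\<bar>" and nG: "\<not> (\<theta> \<le> f t \<and> u3 * u t \<le> k * f t)" by auto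
        have "f t < \<theta>"
        proof (rule ccontr)
          assume "\<not> f t < \<theta>"
          then have "\<bar>f t\<bar> = f t" "\<theta> \<le> f t" using \<theta> by auto
          with le nG show False by auto
        qed
        have "u3 * u t \<le> K * \<bar>f t\<bar>" using le mult_right_mono[OF kK, of "\<bar>f t\<bar>"] by simp
        also have "\<dots> \<le> K * (\<theta> + \<bar>f t\<bar> - f t)" using \<open>f t < \<theta>\<close> K by (intro mult_left_mono) auto
        finally have "u t \<le> ?r t" using u3 True by (simp add: field_simps)
        then have "ennreal (u t) \<le> ennreal (?r t)" by (rule ennreal_leI)
        then show ?thesis using True by (auto intro: add_increasing)
      qed
    qed
    also have "\<dots> = ennreal (part ?G) + ennreal (part ?C) + ennreal (K / u3 * (\<theta> * a + x - y))"
    proof -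
      have m: "(\<lambda>t. ennreal (u t) * indicator ?G t) \<in> \<M>"
        "(\<lambda>t. ennreal (u t) * indicator ?C t) \<in> \<M>"
        "(\<lambda>t. ennreal (?r t)) \<in> \<M>"
        using borel_measurable_integrable[OF intr]
        by (intro borel_measurable_times_ennreal measurable_compose[OF _ measurable_ennreal]
            borel_measurable_indicator GC weightsD(1)[OF u])+
      show ?thesis
        by (simp only: nn_integral_add[OF borel_measurable_add[OF m(1,2)] m(3)] nn_integral_add[OF m(1,2)]
            R sub[THEN part(1)])
    qed
    finally have "part A \<le> part ?G + part ?C + K / u3 * (\<theta> * a + x - y)"
    proof (rule ennreal_le_sumD[OF _ part(2)[OF sub(1)] part(2)[OF sub(2)]])
      have "0 \<le> \<theta> * a" using \<theta>(1) a(1) by simp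
      then show "0 \<le> K / u3 * (\<theta> * a + x - y)"
        using K u3(1) \<open>y \<le> x\<close> by (intro mult_nonneg_nonneg) auto
    qed
    also have "K / u3 * (\<theta> * a + x - y) = g / 3 + K / u3 * (x - y)"
      unfolding \<theta>(2)[symmetric] distrib_left[symmetric] by (simp only: add_diff_eq)
    also have "K / u3 * (x - y) \<le> \<epsilon> * (2 * K / (u3 * s0))"
    proof -
      have "s0 * (x - y) \<le> 2 * \<epsilon>" using x1 y by (simp add: algebra_simps)
      then have "x - y \<le> 2 * \<epsilon> / s0" using s0 by (simp add: field_simps)
      then have "K / u3 * (x - y) \<le> K / u3 * (2 * \<epsilon> / s0)" using K u3 by (intro mult_left_mono) auto
      then show ?thesis by (simp add: mult_ac)
    qed
    finally have "1 / M \<le> part ?G + \<epsilon> * C + g / 3"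
      using A_large C_small by (simp add: C_def distrib_left)
    then have G_large: "W2 < part ?G" using \<epsilon>(3) g g_def by linarith
    show "ennreal (2 * a / 3) \<le> \<mu> ?G"
    proof (rule ccontr)
      assume "\<not> ennreal (2 * a / 3) \<le> \<mu> ?G"
      then have small: "\<mu> ?G \<le> ennreal (2 * a / 3)" by simp
      have GI: "?G \<subseteq> I" "?G \<subseteq> A" using A_subset by auto
      have "ennreal (part ?G) \<le> W (\<mu> ?G)"
        unfolding part(1)[OF GI(2), symmetric]
        by (rule weightsD(3)[OF u GC(1) GI(1)]) (use small in \<open>auto intro: order.strict_trans1\<close>)
      also have "\<dots> \<le> ennreal W2" unfolding W2(1)[symmetric] by (rule rearrangement_integral_mono[OF small])
      finally show False using G_large W2 by (simp add: ennreal_le_iff)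
    qed
  qed (use \<epsilon> \<theta> in auto)
qed

lemma slice_diameter:
  obtains \<epsilon> \<delta> :: real where "0 < \<epsilon>" "\<epsilon> < 1" "0 < \<delta>"
    "\<And>f g. f \<in> \<M> \<Longrightarrow> g \<in> \<M> \<Longrightarrow>
       fun_norm f \<le> 1 \<Longrightarrow> fun_norm g \<le> 1 \<Longrightarrow> 1 - \<epsilon> < functional f \<Longrightarrow> 1 - \<epsilon> < functional g \<Longrightarrow>
       fun_norm (\<lambda>x. f x - g x) + ennreal \<delta> \<le> 2"
proof -
  obtain \<epsilon> \<theta> :: real where \<epsilon>: "0 < \<epsilon>" "\<epsilon> < 1" and \<theta>: "0 < \<theta>"
    and large: "\<And>f k u. f \<in> \<M> \<Longrightarrow> integrable lebesgue (\<lambda>t. f t * indicator A t) \<Longrightarrow>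
       0 < k \<Longrightarrow> u \<in> weights \<Longrightarrow> amemiya k f u \<le> ennreal (1 + \<epsilon>) \<Longrightarrow> 1 - \<epsilon> \<le> functional f \<Longrightarrow>
       ennreal (2 * a / 3) \<le> \<mu> {t \<in> A. \<theta> \<le> f t \<and> u3 * u t \<le> k * f t}"
    using slice_large_values by blast
  define d where "d = \<theta> * (\<phi> u3 / u3) * (a / 3)"
  have d: "0 < d" using \<theta> u3 a by (simp add: d_def)
  \<comment> \<open>Each near-minimiser exceeds 1 by at most \<open>\<eta>\<close>; since
    \<open>2 * \<eta> \<le> d\<close>, this uses up at most half of the combined gain
    \<open>2 * d\<close>.\<close>
  define \<eta> where "\<eta> = min \<epsilon> (d / 2)"
  have \<eta>: "0 < \<eta>" "\<eta> \<le> \<epsilon>" "\<eta> \<le> d / 2" using \<epsilon> d by (auto simp: \<eta>_def)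
  show thesis
  proof (rule that[OF \<epsilon> d])
    fix f g assume fg: "f \<in> \<M>" "g \<in> \<M>"
      and n: "fun_norm f \<le> 1" "fun_norm g \<le> 1" and fn: "1 - \<epsilon> < functional f" "1 - \<epsilon> < functional g"
    have ex: "\<exists>k u. 0 < k \<and> u \<in> weights \<and> amemiya k h u \<le> ennreal (1 + \<eta>) \<and>
        ennreal (2 * a / 3) \<le> \<mu> {t \<in> A. \<theta> \<le> h t \<and> u3 * u t \<le> k * h t}"
      if h: "h \<in> \<M>" "fun_norm h \<le> 1" "1 - \<epsilon> < functional h" for h
    proof -
      have "fun_norm h < ennreal (1 + \<eta>)"
        using h(2) \<eta>(1) by (auto intro: order.strict_trans1 simp flip: ennreal_1 simp: ennreal_less_iff)
      then obtain k u where ku: "0 < k" "u \<in> weights" "amemiya k h u < ennreal (1 + \<eta>)"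
        using fun_norm_lessD[OF h(1)] by blast
      moreover have "amemiya k h u \<le> ennreal (1 + \<epsilon>)"
        using ku(3) \<eta>(2) by (auto intro!: order_trans[OF less_imp_le[OF ku(3)]] ennreal_leI)
      moreover have "fun_norm h < \<infinity>" using h(2) by (rule order.strict_trans1) simp
      ultimately have "ennreal (2 * a / 3) \<le> \<mu> {t \<in> A. \<theta> \<le> h t \<and> u3 * u t \<le> k * h t}"
        using h(3) by (intro large h(1) integrable_A) auto
      with ku show ?thesis by (intro exI[of _ k] exI[of _ u]) auto
    qed
    obtain k1 u1 where 1: "0 < k1" "u1 \<in> weights" "amemiya k1 f u1 \<le> ennreal (1 + \<eta>)"
        "ennreal (2 * a / 3) \<le> \<mu> {t \<in> A. \<theta> \<le> f t \<and> u3 * u1 t \<le> k1 * f t}"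
      using ex[OF fg(1) n(1) fn(1)] by blast
    obtain k2 u2 where 2: "0 < k2" "u2 \<in> weights" "amemiya k2 g u2 \<le> ennreal (1 + \<eta>)"
        "ennreal (2 * a / 3) \<le> \<mu> {t \<in> A. \<theta> \<le> g t \<and> u3 * u2 t \<le> k2 * g t}"
      using ex[OF fg(2) n(2) fn(2)] by blast
    note [measurable] = fg
    define G1 where "G1 = {t \<in> A. \<theta> \<le> f t \<and> u3 * u1 t \<le> k1 * f t}"
    define G2 where "G2 = {t \<in> A. \<theta> \<le> g t \<and> u3 * u2 t \<le> k2 * g t}"
    define B where "B = G1 \<inter> G2"
    have G: "G1 \<in> \<L>" "G2 \<in> \<L>"
      unfolding G1_def G2_def by (rule large_values_measurable fg 1(2) 2(2))+
    have B: "B \<in> \<L>" "B \<subseteq> I" using G A_subset by (auto simp: B_def G1_def)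
    have "ennreal (2 * a / 3) + ennreal (2 * a / 3) \<le> \<mu> G1 + \<mu> G2"
      using 1(4) 2(4) unfolding G1_def G2_def by (rule add_mono)
    also have "\<dots> = \<mu> (G1 \<union> G2) + \<mu> B"
      unfolding B_def by (rule emeasure_Un_Int[OF G])
    also have "\<dots> \<le> \<mu> A + \<mu> B"
    proof (rule add_right_mono, rule emeasure_mono)
      show "G1 \<union> G2 \<subseteq> A" by (auto simp: G1_def G2_def)
    qed simp
    finally have "ennreal (4 * a / 3) \<le> ennreal a + \<mu> B"
      using a(1) by (simp flip: ennreal_plus)
    then have Ba: "ennreal (a / 3) \<le> \<mu> B"
    proof (cases "\<mu> B")
      case (real b)
      with \<open>ennreal (4 * a / 3) \<le> ennreal a + \<mu> B\<close> show ?thesis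
        using a(1) by (simp add: ennreal_le_iff flip: ennreal_plus)
    qed simp
    have gain: "amemiya k (\<lambda>x. h x - \<theta> * indicator B x) u + ennreal d \<le> ennreal (1 + \<eta>)"
      if "h \<in> \<M>" "u \<in> weights" "0 < k" "amemiya k h u \<le> ennreal (1 + \<eta>)"
        "\<And>t. t \<in> B \<Longrightarrow> \<theta> \<le> h t \<and> u3 * u t \<le> k * h t" for k h u
    proof -
      have "ennreal d \<le> ennreal (\<theta> * (\<phi> u3 / u3)) * \<mu> B"
      proof -
        have "ennreal d = ennreal (\<theta> * (\<phi> u3 / u3)) * ennreal (a / 3)"
          unfolding d_def using \<theta> u3 a by (intro ennreal_mult) auto
        also have "\<dots> \<le> ennreal (\<theta> * (\<phi> u3 / u3)) * \<mu> B"
          by (rule mult_left_mono[OF Ba]) simp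
        finally show ?thesis .
      qed
      then have "amemiya k (\<lambda>x. h x - \<theta> * indicator B x) u + ennreal d \<le>
          amemiya k (\<lambda>x. h x - \<theta> * indicator B x) u + ennreal (\<theta> * (\<phi> u3 / u3)) * \<mu> B"
        by (rule add_left_mono)
      also have "\<dots> \<le> amemiya k h u"
        by (rule amemiya_gain[OF that(1-3) u3(1,2) B \<theta> that(5)])
      also have "\<dots> \<le> ennreal (1 + \<eta>)" by (rule that(4))
      finally show ?thesis .
    qed
    let ?f = "\<lambda>x. f x - \<theta> * indicator B x" and ?g = "\<lambda>x. g x - \<theta> * indicator B x"
    have g1: "amemiya k1 ?f u1 + ennreal d \<le> ennreal (1 + \<eta>)"
      by (rule gain[OF fg(1) 1(2,1,3)]) (auto simp: B_def G1_def)
    have g2: "amemiya k2 ?g u2 + ennreal d \<le> ennreal (1 + \<eta>)"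
      by (rule gain[OF fg(2) 2(2,1,3)]) (auto simp: B_def G2_def)
    have meas: "?f \<in> \<M>"
        "(\<lambda>x. - (g x - \<theta> * indicator B x)) \<in> \<M>"
      using B(1) by measurable
    have "fun_norm (\<lambda>x. f x - g x) = fun_norm (\<lambda>x. (f x - \<theta> * indicator B x) + - (g x - \<theta> * indicator B x))"
      by (rule arg_cong[where f = fun_norm]) auto
    also have "\<dots> \<le> amemiya k1 ?f u1 + amemiya k2 (\<lambda>x. - (g x - \<theta> * indicator B x)) u2"
      by (rule fun_norm_triangle_amemiya[OF meas 1(2) 2(2) 1(1) 2(1)])
    finally have le: "fun_norm (\<lambda>x. f x - g x) \<le>
        amemiya k1 ?f u1 + amemiya k2 ?g u2"
      by (simp only: amemiya_minus)
    obtain b1 where b1: "amemiya k1 ?f u1 = ennreal b1" "0 \<le> b1"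
      using g1 by (cases "amemiya k1 ?f u1") (auto simp: top_unique)
    obtain b2 where b2: "amemiya k2 ?g u2 = ennreal b2" "0 \<le> b2"
      using g2 by (cases "amemiya k2 ?g u2") (auto simp: top_unique)
    have "b1 + d \<le> 1 + \<eta>" "b2 + d \<le> 1 + \<eta>"
      using g1 g2 b1 b2 d \<eta> by (auto simp: ennreal_le_iff simp flip: ennreal_plus)
    then have "b1 + b2 + d \<le> 2" using \<eta>(3) by linarith
    then have "ennreal (b1 + b2 + d) \<le> ennreal 2" by (rule ennreal_leI)
    also have "ennreal (b1 + b2 + d) = ennreal b1 + ennreal b2 + ennreal d"
      using b1 b2 d by (simp flip: ennreal_plus)
    finally have sum: "ennreal b1 + ennreal b2 + ennreal d \<le> ennreal 2" .
    have "fun_norm (\<lambda>x. f x - g x) \<le> ennreal b1 + ennreal b2"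
      using le unfolding b1(1) b2(1) .
    then have "fun_norm (\<lambda>x. f x - g x) + ennreal d \<le> ennreal b1 + ennreal b2 + ennreal d"
      by (rule add_right_mono)
    also note sum
    finally show "fun_norm (\<lambda>x. f x - g x) + ennreal d \<le> 2" by simp
  qed
qed

end

section \<open>Failure of the diameter two properties\<close>

text \<open>A slice is relatively weakly open and is a convex combination of slices with one term,
  so the same slice refutes all five properties. The unit vector \<open>x\<close> is the test point
  of the diametral versions and makes the slice nonempty, as the real-valued supremum
  requires.\<close>

lemma small_slice_not_diameter_two:
  fixes V :: "'a::real_vector set"
  assumes f: "f \<in> dual_sphere V N" and "0 < \<epsilon>" "0 < \<delta>"
    and x: "x \<in> slice V N f \<epsilon>" "N x = 1"
    and small: "\<And>y z. y \<in> slice V N f \<epsilon> \<Longrightarrow> z \<in> slice V N f \<epsilon> \<Longrightarrow> N (y - z) \<le> 2 - \<delta>"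
  shows "\<not> LD2P V N" "\<not> D2P V N" "\<not> SD2P V N" "\<not> DLD2P V N" "\<not> DD2P V N"
proof -
  let ?S = "slice V N f \<epsilon>"
  have S: "is_slice V N ?S" using f \<open>0 < \<epsilon>\<close> by (auto simp: is_slice_def)
  have "norm_diameter N ?S \<le> 2 - \<delta>"
    unfolding norm_diameter_def using x(1) small by (intro cSUP_least) auto
  then have diam: "norm_diameter N ?S \<noteq> 2" using \<open>0 < \<delta>\<close> by linarith
  then show "\<not> LD2P V N" using S by (auto simp: LD2P_def)
  have "openin (weak_topology V N) {y \<in> V. f y \<in> {1 - \<epsilon><..}}"
    unfolding weak_topology_def using f
    by (intro topology_generated_by_Basis) (auto simp: dual_sphere_def intro!: exI[of _ f] exI[of _ "{1 - \<epsilon><..}"])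
  then have weak: "rel_weakly_open V N ?S"
    unfolding rel_weakly_open_def openin_subtopology
    by (intro exI[of _ "{y \<in> V. f y \<in> {1 - \<epsilon><..}}"]) (auto simp: slice_def unit_ball_def)
  then show "\<not> D2P V N" using diam x(1) by (auto simp: D2P_def)
  have "?S = {\<Sum>i<1::nat. 1 *\<^sub>R y i | y. \<forall>i<1. y i \<in> ?S}"
  proof (intro set_eqI iffI)
    fix z assume "z \<in> ?S"
    then show "z \<in> {\<Sum>i<1::nat. 1 *\<^sub>R y i | y. \<forall>i<1. y i \<in> ?S}" by (auto intro!: exI[of _ "\<lambda>_. z"] simp: lessThan_Suc)
  qed auto
  then have "convex_comb_of_slices V N ?S"
    unfolding convex_comb_of_slices_def using S
    by (intro exI[of _ "1::nat"] exI[of _ "\<lambda>_. 1"] exI[of _ "\<lambda>_. ?S"]) simp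
  then show "\<not> SD2P V N" using diam by (auto simp: SD2P_def)
  have xS: "x \<in> ?S \<inter> unit_sphere V N"
    using x by (auto simp: unit_sphere_def slice_def unit_ball_def)
  have far: "\<not> (\<exists>y\<in>?S. 2 - \<delta> / 2 \<le> N (x - y))"
    using small[OF x(1)] \<open>0 < \<delta>\<close> by fastforce
  then show "\<not> DLD2P V N"
    unfolding DLD2P_def using S xS \<open>0 < \<delta>\<close> by (metis half_gt_zero)
  show "\<not> DD2P V N"
    unfolding DD2P_def using weak x(1) xS far \<open>0 < \<delta>\<close> by (metis half_gt_zero empty_iff)
qed

text \<open>The rank-one operator sending y to \<open>- f y *\<^sub>R x\<close> has norm one, so the
  property would bring the norms of y - f(y) x up to 2 on the unit ball. If \<bar>f(y)\<bar> \<le> 1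
  - \<epsilon>, the triangle inequality leaves room \<open>\<epsilon>\<close>. Otherwise y and f(y)
  x, or their negatives, lie in the slice together, because f(x) = 1.\<close>

lemma small_slice_not_Daugavet:
  fixes V :: "'a::real_vector set"
  assumes V: "subspace V"
    and N_add: "\<And>y z. y \<in> V \<Longrightarrow> z \<in> V \<Longrightarrow> N (y + z) \<le> N y + N z"
    and N_scale: "\<And>c y. y \<in> V \<Longrightarrow> N (c *\<^sub>R y) = \<bar>c\<bar> * N y"
    and f: "f \<in> dual_sphere V N" and "0 < \<epsilon>" "0 < \<delta>"
    and x: "x \<in> V" "N x = 1" "f x = 1"
    and small: "\<And>y z. y \<in> slice V N f \<epsilon> \<Longrightarrow> z \<in> slice V N f \<epsilon> \<Longrightarrow> N (y - z) \<le> 2 - \<delta>"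
  shows "\<not> Daugavet_property V N"
proof
  assume D: "Daugavet_property V N"
  obtain C where C: "\<And>y. y \<in> V \<Longrightarrow> \<bar>f y\<bar> \<le> C * N y"
    using f by (auto simp: dual_sphere_def dual_space_def)
  have add: "f (y + z) = f y + f z" and scale: "f (c *\<^sub>R y) = c * f y" if "y \<in> V" "z \<in> V" for y z c
    using f that by (auto simp: dual_sphere_def dual_space_def linear_functional_on_def)
  have norm: "(SUP y\<in>unit_ball V N. \<bar>f y\<bar>) = 1"
    using f by (simp add: dual_sphere_def dual_norm_def)
  have N_nonneg: "0 \<le> N y" if "y \<in> V" for y
  proof -
    have "N (y + (-1) *\<^sub>R y) \<le> N y + N ((-1) *\<^sub>R y)"
      using that by (intro N_add subspace_scale V)
    moreover have "N (0 *\<^sub>R y) = 0" using N_scale[OF that, of 0] by simp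
    ultimately show ?thesis using N_scale[OF that, of "-1"] by simp
  qed
  \<comment> \<open>A real supremum bounds its members only for a bounded family, so boundedness is
    first derived from the constant \<open>C\<close>.\<close>
  have f_le: "\<bar>f y\<bar> \<le> 1" if "y \<in> unit_ball V N" for y
  proof -
    have "\<bar>f z\<bar> \<le> max 0 C" if "z \<in> unit_ball V N" for z
    proof -
      have z: "z \<in> V" "N z \<le> 1" using that by (auto simp: unit_ball_def)
      have "C * N z \<le> max 0 C * N z" using N_nonneg[OF z(1)] by (intro mult_right_mono) auto
      also have "\<dots> \<le> max 0 C * 1" using z(2) by (intro mult_left_mono) auto
      finally show ?thesis using C[OF z(1)] by simp
    qed
    then have "bdd_above ((\<lambda>y. \<bar>f y\<bar>) ` unit_ball V N)" by (intro bdd_aboveI2)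
    from cSUP_upper[OF that this] show ?thesis by (simp add: norm)
  qed
  define T where "T y = - f y *\<^sub>R x" for y
  have NT: "N (T y) = \<bar>f y\<bar>" for y unfolding T_def N_scale[OF x(1)] x(2) by simp
  have "bounded_operator_on V N T"
    unfolding bounded_operator_on_def
  proof (intro conjI ballI allI)
    show "T ` V \<subseteq> V" unfolding T_def using subspace_scale[OF V x(1)] by blast
    show "T (y + z) = T y + T z" if "y \<in> V" "z \<in> V" for y z
      using add[OF that] by (simp add: T_def scaleR_add_left[symmetric] scaleR_diff_left)
    show "T (c *\<^sub>R y) = c *\<^sub>R T y" if "y \<in> V" for c y using scale[OF that that] by (simp add: T_def)
    show "\<exists>C. \<forall>y\<in>V. N (T y) \<le> C * N y" using C by (auto simp: NT)
  qed
  moreover have "dim (T ` V) = 1"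
  proof (rule dim_unique[of "{x}"])
    have "x = T ((-1) *\<^sub>R x)" using scale[OF x(1,1), of "-1"] x(3) by (simp add: T_def)
    then show "{x} \<subseteq> T ` V" using subspace_scale[OF V x(1), of "-1"] by blast
    show "T ` V \<subseteq> span {x}" unfolding T_def span_singleton by blast
    have "x \<noteq> 0" using scale[OF x(1,1), of 0] x(3) by auto
    then show "independent {x}" by simp
  qed simp
  ultimately have "op_norm V N (\<lambda>y. y + T y) = 1 + op_norm V N T"
    using D by (auto simp: Daugavet_property_def rank_one_operator_def)
  also have "op_norm V N T = 1" unfolding op_norm_def NT norm ..
  finally have two: "(SUP y\<in>unit_ball V N. N (y + T y)) = 2" by (simp add: op_norm_def)
  have "(SUP y\<in>unit_ball V N. N (y + T y)) \<le> 2 - min \<epsilon> \<delta>"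
  proof (rule cSUP_least)
    show "unit_ball V N \<noteq> {}" using x by (auto simp: unit_ball_def)
    fix y assume y: "y \<in> unit_ball V N"
    then have yV: "y \<in> V" "N y \<le> 1" by (auto simp: unit_ball_def)
    have diff: "y + T y = y - f y *\<^sub>R x" by (simp add: T_def)
    have in_slice: "c *\<^sub>R x \<in> slice V N f \<epsilon>" if "1 - \<epsilon> < c" "\<bar>c\<bar> \<le> 1" for c
      using that x N_scale[OF x(1), of c] scale[OF x(1,1), of c] subspace_scale[OF V x(1)]
      by (simp add: slice_def unit_ball_def)
    consider "\<bar>f y\<bar> \<le> 1 - \<epsilon>" | "1 - \<epsilon> < f y" | "1 - \<epsilon> < - f y" by linarith
    then show "N (y + T y) \<le> 2 - min \<epsilon> \<delta>"
    proof cases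
      case 1
      have "N (y + T y) \<le> N y + N (T y)"
        using x(1) by (intro N_add yV) (simp add: T_def subspace_neg[OF V] subspace_scale[OF V])
      then show ?thesis using 1 yV(2) by (simp add: NT)
    next
      case 2
      then have "y \<in> slice V N f \<epsilon>" using y by (simp add: slice_def)
      from small[OF this in_slice[OF 2 f_le[OF y]]] show ?thesis by (simp add: diff)
    next
      case 3
      have "- y \<in> slice V N f \<epsilon>"
        using 3 yV N_scale[OF yV(1), of "-1"] scale[OF yV(1,1), of "-1"] subspace_neg[OF V yV(1)]
        by (simp add: slice_def unit_ball_def)
      from small[OF this in_slice[OF 3]] f_le[OF y]
      have "N (- y - (- f y) *\<^sub>R x) \<le> 2 - \<delta>" by simp
      also have "- y - (- f y) *\<^sub>R x = (-1) *\<^sub>R (y + T y)" by (simp add: T_def)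
      also have "N \<dots> = N (y + T y)"
        using N_scale[of "y + T y" "-1"] x(1) yV(1)
        by (simp add: T_def subspace_diff[OF V] subspace_scale[OF V])
      finally show ?thesis by simp
    qed
  qed
  with two \<open>0 < \<epsilon>\<close> \<open>0 < \<delta>\<close> show False by simp
qed

section \<open>Transfer to classes of functions modulo null sets\<close>

lemma L0_representative:
  obtains f where "f \<in> \<M>" "F = abs_L0 f"
proof -
  have "F = abs_L0 (rep_L0 F)" using Quotient_abs_rep[OF Quotient_L0] by simp
  moreover have "rep_L0 F \<in> \<M>"
    using Quotient_rep_reflp[OF Quotient_L0, of F] by simp
  ultimately show thesis using that by blast
qed

lift_definition L0_functional :: "real \<Rightarrow> real \<Rightarrow> L0 \<Rightarrow> real" is
  "\<lambda>s a f. s * (LINT t|lebesgue. f t * indicator {0..a} t)"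
proof -
  fix s a :: real and f g :: "real \<Rightarrow> real"
  assume *: "f \<in> \<M> \<and> g \<in> \<M> \<and> (AE x in lebesgue. f x = g x)"
  have "(LINT t|lebesgue. f t * indicator {0..a} t) = (LINT t|lebesgue. g t * indicator {0..a} t)"
  proof (rule integral_cong_AE)
    show "(\<lambda>t. f t * indicator {0..a} t) \<in> \<M>"
        "(\<lambda>t. g t * indicator {0..a} t) \<in> \<M>"
      using * by (auto intro!: borel_measurable_times borel_measurable_indicator)
    show "AE t in lebesgue. f t * indicator {0..a} t = g t * indicator {0..a} t"
      using * by (auto elim: eventually_mono)
  qed
  then show "s * (LINT t|lebesgue. f t * indicator {0..a} t) = s * (LINT t|lebesgue. g t * indicator {0..a} t)"
    by simp
qed

context orlicz_weight
begin

lemma P_fun_abs: "P_fun \<gamma> \<phi> w (\<lambda>x. c * f x) = P_fun \<gamma> \<phi> w (\<lambda>x. \<bar>c\<bar> * f x)"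
proof -
  have "\<D> \<gamma> (\<lambda>x. c * f x) = \<D> \<gamma> (\<lambda>x. \<bar>c\<bar> * f x)"
    by (simp add: distribution_function_def[abs_def] abs_mult)
  then have "rearrangement \<gamma> (\<lambda>x. c * f x) = rearrangement \<gamma> (\<lambda>x. \<bar>c\<bar> * f x)"
    by (intro rearrangement_cong) simp
  then show ?thesis by (simp add: P_fun_def)
qed

text \<open>Reparametrise the infimum by \<open>k / \<bar>c\<bar>\<close>. The same inequality for
  \<open>1 / c\<close> yields the converse in \<open>fun_norm_scale\<close>.\<close>

lemma fun_norm_scale_le:
  assumes "c \<noteq> 0"
  shows "ennreal (1 / \<bar>c\<bar>) * fun_norm (\<lambda>x. c * f x) \<le> fun_norm f"
  unfolding fun_norm_def[of f]
proof (rule INF_greatest)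
  fix k :: real assume "k \<in> {0<..}"
  then have k: "0 < k" by simp
  have "fun_norm (\<lambda>x. c * f x) \<le> ennreal (1 / (k / \<bar>c\<bar>)) * (1 + P_fun \<gamma> \<phi> w (\<lambda>x. k / \<bar>c\<bar> * (c * f x)))"
    unfolding fun_norm_def using k assms by (intro INF_lower) auto
  also have "P_fun \<gamma> \<phi> w (\<lambda>x. k / \<bar>c\<bar> * (c * f x)) = P_fun \<gamma> \<phi> w (\<lambda>x. k * f x)"
    using P_fun_abs[of "k / \<bar>c\<bar> * c" f] k assms by (simp add: abs_mult mult.assoc)
  also have "ennreal (1 / (k / \<bar>c\<bar>)) = ennreal \<bar>c\<bar> * ennreal (1 / k)"
    using k by (simp flip: ennreal_mult)
  finally have "ennreal (1 / \<bar>c\<bar>) * fun_norm (\<lambda>x. c * f x) \<le>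
      ennreal (1 / \<bar>c\<bar>) * (ennreal \<bar>c\<bar> * ennreal (1 / k) * (1 + P_fun \<gamma> \<phi> w (\<lambda>x. k * f x)))"
    by (rule mult_left_mono) simp
  also have "\<dots> = (ennreal (1 / \<bar>c\<bar>) * ennreal \<bar>c\<bar>) * (ennreal (1 / k) * (1 + P_fun \<gamma> \<phi> w (\<lambda>x. k * f x)))"
    by (simp add: mult.assoc)
  also have "ennreal (1 / \<bar>c\<bar>) * ennreal \<bar>c\<bar> = 1" using assms by (simp flip: ennreal_mult)
  finally show "ennreal (1 / \<bar>c\<bar>) * fun_norm (\<lambda>x. c * f x) \<le> ennreal (1 / k) * (1 + P_fun \<gamma> \<phi> w (\<lambda>x. k * f x))"
    by simp
qed

lemma fun_norm_scale: "fun_norm (\<lambda>x. c * f x) = ennreal \<bar>c\<bar> * fun_norm f"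
proof (cases "c = 0")
  case True
  have "fun_norm (\<lambda>x. 0) \<le> 0 + ennreal e" if "0 < e" for e
  proof -
    have "fun_norm (\<lambda>x. 0) \<le> amemiya (1 / e) (\<lambda>x. 0) (cut \<gamma> w)"
      using that by (intro fun_norm_le_amemiya cut_w_weights) auto
    then show ?thesis by (simp add: amemiya_def modular_def)
  qed
  then have "fun_norm (\<lambda>x. 0) \<le> 0" by (rule ennreal_le_epsilon)
  then show ?thesis using True by simp
next
  case False
  have inv: "ennreal \<bar>c\<bar> * ennreal (1 / \<bar>c\<bar>) = 1" using False by (simp flip: ennreal_mult)
  have "ennreal \<bar>c\<bar> * fun_norm f \<le> fun_norm (\<lambda>x. c * f x)"
    using fun_norm_scale_le[of "1 / c" "\<lambda>x. c * f x"] False by simp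
  moreover have "fun_norm (\<lambda>x. c * f x) \<le> ennreal \<bar>c\<bar> * fun_norm f"
  proof -
    have "ennreal \<bar>c\<bar> * (ennreal (1 / \<bar>c\<bar>) * fun_norm (\<lambda>x. c * f x)) \<le> ennreal \<bar>c\<bar> * fun_norm f"
      by (rule mult_left_mono[OF fun_norm_scale_le[OF False]]) simp
    then show ?thesis unfolding mult.assoc[symmetric] inv by simp
  qed
  ultimately show ?thesis by (rule antisym[rotated])
qed

abbreviation "V \<equiv> M_space \<gamma> \<phi> w"
abbreviation "N \<equiv> M_Orlicz_norm \<gamma> \<phi> w"

lemma scaleR_abs_L0: "f \<in> \<M> \<Longrightarrow> c *\<^sub>R abs_L0 f = abs_L0 (\<lambda>x. c * f x)"
  by (simp add: scaleR_L0.abs_eq)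

lemma P_functional_abs_L0:
  "f \<in> \<M> \<Longrightarrow> P_functional \<gamma> \<phi> w (abs_L0 f) = P_fun \<gamma> \<phi> w f"
  by (simp add: P_functional.abs_eq)

lemma norm_abs_L0:
  assumes f: "f \<in> \<M>"
  shows "N (abs_L0 f) = enn2real (fun_norm f)"
proof -
  have "P_functional \<gamma> \<phi> w (k *\<^sub>R abs_L0 f) = P_fun \<gamma> \<phi> w (\<lambda>x. k * f x)" for k
    unfolding scaleR_abs_L0[OF f] by (rule P_functional_abs_L0) (use f in measurable)
  then show ?thesis by (simp add: M_Orlicz_norm_def fun_norm_def)
qed

lemma abs_L0_mem_iff:
  assumes f: "f \<in> \<M>"
  shows "abs_L0 f \<in> V \<longleftrightarrow> supported_on_I \<gamma> (abs_L0 f) \<and> fun_norm f < \<infinity>"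
proof -
  have P: "P_functional \<gamma> \<phi> w (k *\<^sub>R abs_L0 f) = P_fun \<gamma> \<phi> w (\<lambda>x. k * f x)" for k
    unfolding scaleR_abs_L0[OF f] by (rule P_functional_abs_L0) (use f in measurable)
  have "fun_norm f < \<infinity> \<longleftrightarrow> (\<exists>k>0. P_fun \<gamma> \<phi> w (\<lambda>x. k * f x) < \<infinity>)"
    by (auto simp: fun_norm_def INF_less_iff ennreal_mult_less_top)
  then show ?thesis by (simp add: M_space_def P)
qed

lemma subspace_M_space: "subspace V"
proof (rule subspaceI)
  have "supported_on_I \<gamma> 0" by transfer simp
  moreover have "0 = abs_L0 (\<lambda>_. 0)" using scaleR_abs_L0[of "\<lambda>_. 0" 0] by simp
  ultimately show "0 \<in> V"
    using abs_L0_mem_iff[of "\<lambda>_. 0"] fun_norm_scale[of 0 "\<lambda>_. 0"] by simp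
next
  fix F G assume FG: "F \<in> V" "G \<in> V"
  obtain f where f: "f \<in> \<M>" "F = abs_L0 f" by (rule L0_representative)
  obtain g where g: "g \<in> \<M>" "G = abs_L0 g" by (rule L0_representative)
  have "supported_on_I \<gamma> (F + G)"
    using FG unfolding M_space_def mem_Collect_eq
    by transfer (auto elim: eventually_elim2)
  moreover have "F + G = abs_L0 (\<lambda>x. f x + g x)" using f g by (simp add: plus_L0.abs_eq)
  moreover have "fun_norm (\<lambda>x. f x + g x) < \<infinity>"
    using fun_norm_triangle[OF f(1) g(1)] FG f g abs_L0_mem_iff
    by (auto intro: order.strict_trans1)
  moreover have "(\<lambda>x. f x + g x) \<in> \<M>" using f g by measurable
  ultimately show "F + G \<in> V" using abs_L0_mem_iff by metis
next
  fix F c assume F: "F \<in> V"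
  obtain f where f: "f \<in> \<M>" "F = abs_L0 f" by (rule L0_representative)
  have "supported_on_I \<gamma> (c *\<^sub>R F)"
    using F unfolding M_space_def mem_Collect_eq by transfer (auto elim: eventually_mono)
  moreover have "c *\<^sub>R F = abs_L0 (\<lambda>x. c * f x)" using f scaleR_abs_L0 by simp
  moreover have "fun_norm (\<lambda>x. c * f x) < \<infinity>"
    using F f abs_L0_mem_iff by (simp add: fun_norm_scale ennreal_mult_less_top)
  moreover have "(\<lambda>x. c * f x) \<in> \<M>" using f by measurable
  ultimately show "c *\<^sub>R F \<in> V" using abs_L0_mem_iff by metis
qed

lemma M_Orlicz_norm_add:
  assumes "F \<in> V" "G \<in> V"
  shows "N (F + G) \<le> N F + N G"
proof -
  obtain f where f: "f \<in> \<M>" "F = abs_L0 f" by (rule L0_representative)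
  obtain g where g: "g \<in> \<M>" "G = abs_L0 g" by (rule L0_representative)
  have fin: "fun_norm f < \<infinity>" "fun_norm g < \<infinity>" using assms f g abs_L0_mem_iff by auto
  have "F + G = abs_L0 (\<lambda>x. f x + g x)" using f g by (simp add: plus_L0.abs_eq)
  moreover have "(\<lambda>x. f x + g x) \<in> \<M>" using f g by measurable
  ultimately have "N (F + G) = enn2real (fun_norm (\<lambda>x. f x + g x))" by (simp add: norm_abs_L0)
  also have "\<dots> \<le> enn2real (fun_norm f + fun_norm g)"
    using fin by (intro enn2real_mono fun_norm_triangle f g) auto
  also have "\<dots> = N F + N G" using fin f g by (simp add: norm_abs_L0 enn2real_plus)
  finally show ?thesis .
qed

lemma M_Orlicz_norm_scale: "N (c *\<^sub>R F) = \<bar>c\<bar> * N F"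
proof -
  obtain f where f: "f \<in> \<M>" "F = abs_L0 f" by (rule L0_representative)
  have "(\<lambda>x. c * f x) \<in> \<M>" using f by measurable
  then show ?thesis using f by (simp add: scaleR_abs_L0 norm_abs_L0 fun_norm_scale enn2real_mult)
qed

end

context orlicz_slice
begin

section \<open>A norm-attaining element and the slice around it\<close>

lemma u0_pos: "0 < u0"
  using u0 M by (cases "u0 = 0") auto

text \<open>A multiple of the weight itself, so that after scaling the ratio to the weight is
  constantly \<open>u0\<close> on \<open>A\<close>, the equality case of Young's inequality. The
  factor \<open>M / s0\<close> normalises the functional to 1.\<close>

definition "extremal t = M / s0 * (cut \<gamma> w t * indicator A t)"

lemma extremal_measurable: "extremal \<in> \<M>"
  unfolding extremal_def[abs_def] using cut_measurable[OF w_decreasing] by measurable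

lemma weight_w_A: "nint A (cut \<gamma> w) = ennreal (1 / M)"
  using W_eq(1)[OF a(2)] Wa by simp

lemma functional_extremal: "functional extremal = 1"
proof -
  have "(LINT t|lebesgue. cut \<gamma> w t * indicator A t) = enn2real (\<integral>\<^sup>+t. ennreal (cut \<gamma> w t * indicator A t) \<partial>lebesgue)"
    using cut_measurable[OF w_decreasing] cut_nonneg[OF w_decreasing]
    by (intro integral_eq_nn_integral) auto
  also have "(\<integral>\<^sup>+t. ennreal (cut \<gamma> w t * indicator A t) \<partial>lebesgue) = ennreal (1 / M)"
    unfolding weight_w_A[symmetric] by (intro nn_integral_cong) (auto simp: indicator_def)
  finally have "(LINT t|lebesgue. cut \<gamma> w t * indicator A t) = 1 / M" using M by simp
  moreover have "(\<lambda>t. extremal t * indicator A t) = (\<lambda>t. M / s0 * (cut \<gamma> w t * indicator A t))"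
    by (auto simp: extremal_def indicator_def)
  ultimately show ?thesis using M s0 by (simp add: functional_def)
qed

lemma fun_norm_extremal: "fun_norm extremal = 1"
proof (rule antisym)
  \<comment> \<open>Makes \<open>k * extremal t\<close> equal to
    \<open>u0 * cut \<gamma> w t\<close> on \<open>A\<close>. The modular is then
    \<open>\<phi> u0 / M\<close>, and \<open>1 + \<phi> u0 / M\<close> is again \<open>k\<close>
    because \<open>u0\<close> attains the conjugate, so the Amemiya expression equals 1.\<close>
  define k where "k = s0 * u0 / M"
  have k: "0 < k" using s0 u0_pos M by (simp add: k_def)
  have pt: "\<psi> (ennreal \<bar>k * extremal t\<bar>) (cut \<gamma> w t) * indicator I t =
      ennreal (\<phi> u0) * (ennreal (cut \<gamma> w t) * indicator A t)" for t
  proof (cases "t \<in> A \<and> 0 < cut \<gamma> w t")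
    case True
    then have "\<bar>k * extremal t\<bar> = u0 * cut \<gamma> w t"
      using s0 M u0_pos by (simp add: k_def extremal_def abs_mult)
    then show ?thesis
      using True A_subset u0(1) phi_nonneg[OF u0(1)]
      by (auto simp: perspective_eq mult.commute simp flip: ennreal_mult)
  next
    case False
    then have "t \<notin> A \<or> cut \<gamma> w t = 0"
      using cut_nonneg[OF w_decreasing, of t] by auto
    then have "extremal t = 0" "ennreal (cut \<gamma> w t) * indicator A t = 0"
      unfolding extremal_def by (auto simp: indicator_def)
    then show ?thesis by simp
  qed
  have "(\<lambda>t. ennreal (cut \<gamma> w t) * indicator A t) \<in> \<M>"
    using cut_measurable[OF w_decreasing] by measurable
  then have "modular (\<lambda>t. k * extremal t) (cut \<gamma> w) = ennreal (\<phi> u0) * ennreal (1 / M)"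
    unfolding modular_def pt weight_w_A[symmetric] by (rule nn_integral_cmult)
  also have "\<dots> = ennreal (\<phi> u0 / M)" using phi_nonneg[OF u0(1)] M by (simp flip: ennreal_mult)
  finally have "amemiya k extremal (cut \<gamma> w) = ennreal (1 / k) * ennreal (1 + \<phi> u0 / M)"
    unfolding amemiya_def using phi_nonneg[OF u0(1)] M by simp
  also have "\<dots> = ennreal (1 / k * (1 + \<phi> u0 / M))"
    using k phi_nonneg[OF u0(1)] M by (intro ennreal_mult[symmetric]) auto
  also have "1 + \<phi> u0 / M = k" using u0(2) M by (simp add: k_def field_simps)
  finally have "amemiya k extremal (cut \<gamma> w) = 1" using k by simp
  then show "fun_norm extremal \<le> 1"
    using fun_norm_le_amemiya[OF extremal_measurable cut_w_weights k] by simp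
  show "1 \<le> fun_norm extremal"
    using functional_abs_le[OF extremal_measurable] functional_extremal by simp
qed

abbreviation "X \<equiv> abs_L0 extremal"
abbreviation "L \<equiv> L0_functional s0 a"

lemma L_abs_L0: "f \<in> \<M> \<Longrightarrow> L (abs_L0 f) = functional f"
  by (simp add: L0_functional.abs_eq functional_def)

lemma X_mem: "X \<in> V"
proof -
  have "supported_on_I \<gamma> X"
    unfolding supported_on_I.abs_eq[of extremal, simplified, OF extremal_measurable]
  proof (rule AE_I2, rule impI)
    fix x assume "x \<notin> I"
    then have "x \<notin> A" using A_subset by blast
    then show "extremal x = 0" by (auto simp: extremal_def indicator_def)
  qed
  then show ?thesis using abs_L0_mem_iff[OF extremal_measurable] fun_norm_extremal by simp
qed

lemma norm_X: "N X = 1"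
  using norm_abs_L0[OF extremal_measurable] fun_norm_extremal by simp

lemma L_X: "L X = 1"
  using L_abs_L0[OF extremal_measurable] functional_extremal by simp

lemma L_abs_le:
  assumes "F \<in> V" shows "\<bar>L F\<bar> \<le> N F"
proof -
  obtain f where f: "f \<in> \<M>" "F = abs_L0 f" by (rule L0_representative)
  have "fun_norm f < \<infinity>" using assms f abs_L0_mem_iff by simp
  moreover have "ennreal \<bar>L F\<bar> \<le> fun_norm f" using functional_abs_le[OF f(1)] f L_abs_L0 by simp
  ultimately show ?thesis
    using enn2real_mono[of "ennreal \<bar>L F\<bar>" "fun_norm f"] f norm_abs_L0 by simp
qed

lemma L_dual_sphere: "L \<in> dual_sphere V N"
proof -
  have add: "L (F + G) = L F + L G" if "F \<in> V" "G \<in> V" for F G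
  proof -
    obtain f where f: "f \<in> \<M>" "F = abs_L0 f" by (rule L0_representative)
    obtain g where g: "g \<in> \<M>" "G = abs_L0 g" by (rule L0_representative)
    have fin: "fun_norm f < \<infinity>" "fun_norm g < \<infinity>" using that f g abs_L0_mem_iff by auto
    have "F + G = abs_L0 (\<lambda>x. f x + g x)" using f g by (simp add: plus_L0.abs_eq)
    moreover have "(\<lambda>x. f x + g x) \<in> \<M>" using f g by measurable
    ultimately have "L (F + G) = functional (\<lambda>x. f x + g x)" by (simp add: L_abs_L0)
    also have "\<dots> = functional f + functional g"
      using integrable_A[OF f(1) fin(1)] integrable_A[OF g(1) fin(2)]
      by (simp add: functional_def distrib_left distrib_right)
    finally show ?thesis using f g by (simp add: L_abs_L0)
  qed
  have scale: "L (c *\<^sub>R F) = c * L F" for c F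
  proof -
    obtain f where f: "f \<in> \<M>" "F = abs_L0 f" by (rule L0_representative)
    have "(\<lambda>x. c * f x) \<in> \<M>" using f by measurable
    then show ?thesis using f by (simp add: scaleR_abs_L0 L_abs_L0 functional_def mult.assoc)
  qed
  have "dual_norm V N L = 1"
    unfolding dual_norm_def
  proof (rule cSup_eq_maximum)
    show "1 \<in> (\<lambda>F. \<bar>L F\<bar>) ` unit_ball V N"
      by (rule image_eqI[of _ _ X]) (auto simp: L_X unit_ball_def X_mem norm_X)
    fix z assume "z \<in> (\<lambda>F. \<bar>L F\<bar>) ` unit_ball V N"
    then show "z \<le> 1" using L_abs_le by (fastforce simp: unit_ball_def)
  qed
  moreover have "L \<in> dual_space V N"
    unfolding dual_space_def linear_functional_on_def
    using add scale L_abs_le by (auto intro!: exI[of _ 1])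
  ultimately show ?thesis by (simp add: dual_sphere_def)
qed

lemma slice_diameter_L0:
  obtains \<epsilon> \<delta> :: real where "0 < \<epsilon>" "0 < \<delta>" "X \<in> slice V N L \<epsilon>"
    "\<And>F G. F \<in> slice V N L \<epsilon> \<Longrightarrow> G \<in> slice V N L \<epsilon> \<Longrightarrow> N (F - G) \<le> 2 - \<delta>"
proof -
  obtain \<epsilon> \<delta> :: real where \<epsilon>: "0 < \<epsilon>" "\<epsilon> < 1" "0 < \<delta>" and
    diam: "\<And>f g. f \<in> \<M> \<Longrightarrow> g \<in> \<M> \<Longrightarrow>
       fun_norm f \<le> 1 \<Longrightarrow> fun_norm g \<le> 1 \<Longrightarrow> 1 - \<epsilon> < functional f \<Longrightarrow> 1 - \<epsilon> < functional g \<Longrightarrow>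
       fun_norm (\<lambda>x. f x - g x) + ennreal \<delta> \<le> 2"
    using slice_diameter by blast
  show thesis
  proof (rule that[OF \<epsilon>(1,3)])
    show "X \<in> slice V N L \<epsilon>" using \<epsilon>(1) by (simp add: slice_def unit_ball_def X_mem norm_X L_X)
    fix F G assume FG: "F \<in> slice V N L \<epsilon>" "G \<in> slice V N L \<epsilon>"
    have rep: "\<exists>f. f \<in> \<M> \<and> H = abs_L0 f \<and> fun_norm f \<le> 1 \<and> 1 - \<epsilon> < functional f"
      if "H \<in> slice V N L \<epsilon>" for H
    proof -
      obtain f where f: "f \<in> \<M>" "H = abs_L0 f" by (rule L0_representative)
      have H: "H \<in> V" "N H \<le> 1" "1 - \<epsilon> < L H" using that by (auto simp: slice_def unit_ball_def)
      have "fun_norm f < \<infinity>" using H(1) f abs_L0_mem_iff by simp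
      then have "fun_norm f = ennreal (N H)" using f norm_abs_L0 by (simp add: less_top)
      also have "\<dots> \<le> ennreal 1" by (rule ennreal_leI[OF H(2)])
      finally show ?thesis using f H(3) L_abs_L0 by auto
    qed
    obtain f where f: "f \<in> \<M>" "F = abs_L0 f" "fun_norm f \<le> 1" "1 - \<epsilon> < functional f"
      using rep[OF FG(1)] by blast
    obtain g where g: "g \<in> \<M>" "G = abs_L0 g" "fun_norm g \<le> 1" "1 - \<epsilon> < functional g"
      using rep[OF FG(2)] by blast
    have "F - G = abs_L0 (\<lambda>x. f x - g x)" using f g by (simp add: minus_L0.abs_eq)
    moreover have "(\<lambda>x. f x - g x) \<in> \<M>" using f g by measurable
    ultimately have NFG: "N (F - G) = enn2real (fun_norm (\<lambda>x. f x - g x))" by (simp add: norm_abs_L0)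
    have le: "fun_norm (\<lambda>x. f x - g x) + ennreal \<delta> \<le> ennreal 2"
      using diam[OF f(1) g(1) f(3) g(3) f(4) g(4)] by simp
    then obtain r where r: "fun_norm (\<lambda>x. f x - g x) = ennreal r" "0 \<le> r"
      by (cases "fun_norm (\<lambda>x. f x - g x)") (auto simp: top_unique)
    have "ennreal (r + \<delta>) \<le> ennreal 2" using le r \<epsilon>(3) by (simp only: ennreal_plus less_imp_le)
    then have "r + \<delta> \<le> 2" by (subst (asm) ennreal_le_iff) auto
    then show "N (F - G) \<le> 2 - \<delta>" using r NFG by simp
  qed
qed

end

theorem theorem4p12:
  fixes \<gamma> :: ereal and \<phi> w :: "real \<Rightarrow> real"
  assumes "0 < \<gamma>"
    and "Orlicz_function \<phi>"
    and "N_function_at_infinity \<phi>"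
    and "weight_function \<gamma> w"
  shows "\<not> LD2P (M_space \<gamma> \<phi> w) (M_Orlicz_norm \<gamma> \<phi> w)
       \<and> \<not> D2P (M_space \<gamma> \<phi> w) (M_Orlicz_norm \<gamma> \<phi> w)
       \<and> \<not> SD2P (M_space \<gamma> \<phi> w) (M_Orlicz_norm \<gamma> \<phi> w)
       \<and> \<not> DLD2P (M_space \<gamma> \<phi> w) (M_Orlicz_norm \<gamma> \<phi> w)
       \<and> \<not> DD2P (M_space \<gamma> \<phi> w) (M_Orlicz_norm \<gamma> \<phi> w)
       \<and> \<not> Daugavet_property (M_space \<gamma> \<phi> w) (M_Orlicz_norm \<gamma> \<phi> w)"
proof -
  interpret orlicz_weight \<phi> \<gamma> w
    using assms by unfold_locales
  obtain a s0 M u0 u3 where par: "0 < a" "a \<in> I" "0 < s0" "0 < M" "W (ennreal a) = ennreal (1 / M)"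
    "\<And>u. 0 \<le> u \<Longrightarrow> s0 * u - \<phi> u \<le> M" "0 \<le> u0" "s0 * u0 - \<phi> u0 = M"
    "0 < u3" "0 < \<phi> u3" "s0 * u3 < M"
    using slice_parameters by blast
  interpret orlicz_slice \<phi> \<gamma> w a s0 M u0 u3
    using par by unfold_locales
  obtain \<epsilon> \<delta> :: real where \<epsilon>: "0 < \<epsilon>" "0 < \<delta>" "X \<in> slice V N L \<epsilon>"
    and small: "\<And>F G. F \<in> slice V N L \<epsilon> \<Longrightarrow> G \<in> slice V N L \<epsilon> \<Longrightarrow> N (F - G) \<le> 2 - \<delta>"
    using slice_diameter_L0 by blast
  show ?thesis
    using small_slice_not_diameter_two[OF L_dual_sphere \<epsilon> norm_X small]
      small_slice_not_Daugavet[OF subspace_M_space M_Orlicz_norm_add M_Orlicz_norm_scale L_dual_sphere \<epsilon>(1,2)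
        X_mem norm_X L_X small]
    by blast
qed

end
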